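(* Let $\mathbb T^2=\mathbb R^2/\mathbb Z^2$ carry the flat metric $dx^2+dy^2$, and for $N\in\mathbb N=\{1,2,\dots\}$ let $$H_N=-\frac{\partial^2}{\partial x^2}-\left(\frac{\partial}{\partial y}-2\pi N i x\right)^2$$ be the magnetic Laplacian acting on sections of $L^N$, where $L\to\mathbb T^2$ is the Hermitian line bundle described in the context. For $\varphi\in\mathcal S(\mathbb R)$ let $Y_N(\varphi)=\operatorname{tr}\varphi\left(\frac1N H_N\right)$. Then for every $\varphi\in\mathcal S(\mathbb R)$ and every $N\in\mathbb N$, $$Y_N(\varphi)=f_0(\varphi)\,N,\qquad f_0(\varphi)=\frac{i}{4\pi}\left\langle \frac{1}{\sin 2\pi(t+i0)},\hat\varphi(t)\right\rangle .$$
   Context: Magnetic field: $F=2\pi\,dx\wedge dy$. The line bundle $L$ on $\mathbb T^2$ consists of equivalence classes of triples $(x,y,u)\in\mathbb R^2\times\mathbb C$ with $(x+1,y,u)\sim(x,y,e^{-2\pi i y}u)$, $(x,y+1,u)\sim(x,y,u)$, and projection $(x,y,u)\mapsto(x,y)$, with the Hermitian structure induced by $|u|$. Smooth sections of $L$ are identified with $u\in C^\infty(\mathbb R^2)$ satisfying $u(x+1,y)=e^{2\pi i y}u(x,y)$, $u(x,y+1)=u(x,y)$; correspondingly, smooth sections of the tensor power $L^N=L^{\otimes N}$ are identified with $u\in C^\infty(\mathbb R^2)$ satisfying $u(x+1,y)=e^{2\pi i N y}u(x,y)$, $u(x,y+1)=u(x,y)$. The Hermitian connection on $L$ is $\nabla^L=d-2\pi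 i x\,dy$ (so on $L^N$ it is $d-2\pi i N x\,dy$), and $H_N=\Delta^{L^N}=(\nabla^{L^N})^*\nabla^{L^N}$. $H_N$ is self-adjoint in $L^2(\mathbb T^2,L^N)$ with discrete spectrum; if $\nu_{N,j}$, $j=0,1,2,\dots$, are its eigenvalues counted with multiplicity, then $Y_N(\varphi)=\operatorname{tr}\varphi(\frac1N H_N)=\sum_{j\ge 0}\varphi\left(\frac1N\nu_{N,j}\right)$. Fourier transform: $\hat\varphi(k)=\int_{\mathbb R}\varphi(\lambda)e^{-ik\lambda}\,d\lambda$. For $c>0$ the distribution $\frac{1}{\sin c(t+i0)}\in\mathcal S'(\mathbb R)$ is defined by $\left\langle\frac{1}{\sin c(t+i0)},\psi\right\rangle=\lim_{\varepsilon\to0+}\int_{\mathbb R}\frac{\psi(t)}{\sin c(t+i\varepsilon)}\,dt$ for $\psi\in\mathcal S(\mathbb R)$. *)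

theory Defs
  imports "HOL-Analysis.Analysis"
begin

section \<open>Schwartz functions and the Fourier transform on the line\<close>

definition vderiv :: "(real \<Rightarrow> complex) \<Rightarrow> real \<Rightarrow> complex" where
  "vderiv f = (\<lambda>x. vector_derivative f (at x))"

definition schwartz :: "(real \<Rightarrow> complex) \<Rightarrow> bool" where
  "schwartz f \<longleftrightarrow>
     (\<forall>l x. (vderiv ^^ l) f differentiable (at x)) \<and>
     (\<forall>k l. bounded (range (\<lambda>x. x ^ k *\<^sub>R (vderiv ^^ l) f x)))"

definition fourier :: "(real \<Rightarrow> complex) \<Rightarrow> real \<Rightarrow> complex" where
  "fourier f k = (LINT l|lborel. f l * exp (- (\<i> * of_real k * of_real l)))"

text \<open>The pairing of the distribution \<open>1 / sin (c (t + i0))\<close> with a test function.\<close>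

definition inv_sin_pairing :: "real \<Rightarrow> (real \<Rightarrow> complex) \<Rightarrow> complex" where
  "inv_sin_pairing c \<psi> =
     Lim (at_right 0)
       (\<lambda>\<epsilon>. LINT t|lborel. \<psi> t / sin (of_real c * (of_real t + \<i> * of_real \<epsilon>)))"

definition f0 :: "(real \<Rightarrow> complex) \<Rightarrow> complex" where
  "f0 \<phi> = \<i> / (4 * of_real pi) * inv_sin_pairing (2 * pi) (fourier \<phi>)"

section \<open>Sections of the powers of the line bundle over the torus\<close>

definition partial_x :: "(real \<times> real \<Rightarrow> complex) \<Rightarrow> real \<times> real \<Rightarrow> complex" where
  "partial_x u = (\<lambda>(x, y). vector_derivative (\<lambda>s. u (s, y)) (at x))"

definition partial_y :: "(real \<times> real \<Rightarrow> complex) \<Rightarrow> real \<times> real \<Rightarrow> complex" where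
  "partial_y u = (\<lambda>(x, y). vector_derivative (\<lambda>s. u (x, s)) (at y))"

primrec Ck :: "nat \<Rightarrow> (real \<times> real \<Rightarrow> complex) \<Rightarrow> bool" where
  "Ck 0 u \<longleftrightarrow> continuous_on UNIV u"
| "Ck (Suc k) u \<longleftrightarrow> u differentiable_on UNIV \<and> Ck k (partial_x u) \<and> Ck k (partial_y u)"

definition smooth :: "(real \<times> real \<Rightarrow> complex) \<Rightarrow> bool" where
  "smooth u \<longleftrightarrow> (\<forall>k. Ck k u)"

text \<open>
  Sections of \<open>L\<^sup>N\<close> are represented by their lifts to the plane, which are quasi-periodic; the
  pointwise Hermitian norm is the modulus, a periodic function.
\<close>

definition quasiperiodic :: "nat \<Rightarrow> (real \<times> real \<Rightarrow> complex) \<Rightarrow> bool" where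
  "quasiperiodic N u \<longleftrightarrow>
     (\<forall>x y. u (x + 1, y) = exp (2 * of_real pi * \<i> * of_nat N * of_real y) * u (x, y)) \<and>
     (\<forall>x y. u (x, y + 1) = u (x, y))"

definition smooth_sections :: "nat \<Rightarrow> (real \<times> real \<Rightarrow> complex) set" where
  "smooth_sections N = {u. smooth u \<and> quasiperiodic N u}"

text \<open>The unit square is a fundamental domain for the torus.\<close>

abbreviation unit_square :: "(real \<times> real) set" where
  "unit_square \<equiv> {0..1} \<times> {0..1}"

definition L2_sections :: "nat \<Rightarrow> (real \<times> real \<Rightarrow> complex) set" where
  "L2_sections N =
     {u \<in> borel_measurable borel. quasiperiodic N u \<and>
        set_integrable lborel unit_square (\<lambda>z. (cmod (u z))\<^sup>2)}"

definition L2_norm :: "(real \<times> real \<Rightarrow> complex) \<Rightarrow> real" where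
  "L2_norm u = sqrt (set_lebesgue_integral lborel unit_square (\<lambda>z. (cmod (u z))\<^sup>2))"

section \<open>The magnetic Laplacian and its eigenvalues\<close>

text \<open>The \<open>y\<close>-component of the connection on \<open>L\<^sup>N\<close>; the \<open>x\<close>-component is \<^const>\<open>partial_x\<close>.\<close>

definition nabla_y :: "nat \<Rightarrow> (real \<times> real \<Rightarrow> complex) \<Rightarrow> real \<times> real \<Rightarrow> complex" where
  "nabla_y N u = (\<lambda>(x, y). partial_y u (x, y)
     - 2 * of_real pi * of_nat N * \<i> * of_real x * u (x, y))"

definition magnetic_laplacian ::
    "nat \<Rightarrow> (real \<times> real \<Rightarrow> complex) \<Rightarrow> real \<times> real \<Rightarrow> complex" where
  "magnetic_laplacian N u = (\<lambda>z. - partial_x (partial_x u) z - nabla_y N (nabla_y N u) z)"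

text \<open>
  The self-adjoint operator in \<open>L\<^sup>2\<close> is the closure of the differential operator on smooth
  sections, which is essentially self-adjoint. \<open>H_graph N u v\<close> says that \<open>u\<close> lies in its domain
  and is mapped to \<open>v\<close>. Both arguments are representatives of almost-everywhere classes.
\<close>

definition H_graph ::
    "nat \<Rightarrow> (real \<times> real \<Rightarrow> complex) \<Rightarrow> (real \<times> real \<Rightarrow> complex) \<Rightarrow> bool" where
  "H_graph N u v \<longleftrightarrow> u \<in> L2_sections N \<and> v \<in> L2_sections N \<and>
     (\<exists>w. (\<forall>n::nat. w n \<in> smooth_sections N) \<and>
        (\<lambda>n. L2_norm (\<lambda>z. w n z - u z)) \<longlonglongrightarrow> 0 \<and>
        (\<lambda>n. L2_norm (\<lambda>z. magnetic_laplacian N (w n) z - v z)) \<longlonglongrightarrow> 0)"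

definition eigenspace :: "nat \<Rightarrow> real \<Rightarrow> (real \<times> real \<Rightarrow> complex) set" where
  "eigenspace N \<nu> = {u. H_graph N u (\<lambda>z. of_real \<nu> * u z)}"

text \<open>
  The eigenspace, modulo equality almost everywhere, has complex dimension \<open>m\<close>: it has a
  basis of \<open>m\<close> elements. Dimension 0 means that \<open>\<nu>\<close> is not an eigenvalue.
\<close>

definition has_multiplicity :: "nat \<Rightarrow> real \<Rightarrow> nat \<Rightarrow> bool" where
  "has_multiplicity N \<nu> m \<longleftrightarrow>
     (\<exists>b. (\<forall>i<m. b i \<in> eigenspace N \<nu>) \<and>
        (\<forall>u\<in>eigenspace N \<nu>. \<exists>!c. c \<in> extensional {..<m} \<and>
           (AE z in lborel. u z = (\<Sum>i<m. c i * b i z))))"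

definition enumerates_eigenvalues :: "nat \<Rightarrow> (nat \<Rightarrow> real) \<Rightarrow> bool" where
  "enumerates_eigenvalues N \<nu> \<longleftrightarrow>
     (\<forall>\<mu>. finite {j. \<nu> j = \<mu>} \<and> has_multiplicity N \<mu> (card {j. \<nu> j = \<mu>}))"

text \<open>
  The eigenvalues counted with multiplicity. Two enumerations differ by a permutation of the
  indices, so the unordered sum \<open>Y\<close> does not depend on the choice.
\<close>

definition eigenvalue :: "nat \<Rightarrow> nat \<Rightarrow> real" where
  "eigenvalue N = (SOME \<nu>. enumerates_eigenvalues N \<nu>)"

definition Y :: "nat \<Rightarrow> (real \<Rightarrow> complex) \<Rightarrow> complex" where
  "Y N \<phi> = (\<Sum>\<^sub>\<infinity>j. \<phi> (eigenvalue N j / real N))"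

end

theory Submission
  imports Defs "HOL-Probability.Levy" "HOL-Library.Nat_Bijection"
begin

text \<open>
  Write \<open>B = 2\<pi>N\<close>. The commutator of the two components of the connection on \<open>L\<^sup>N\<close> is \<open>- \<i>B\<close>, so
  \<open>H\<^sub>N\<close> is a harmonic oscillator: its spectrum consists of the Landau levels \<open>B(2k + 1)\<close>, each of
  multiplicity \<open>N\<close>. Expanding a section in a Fourier series in \<open>y\<close>, quasi-periodicity links the
  coefficients whose indices agree modulo \<open>N\<close>, and the section unfolds into \<open>N\<close> functions on the
  line, on which \<open>H\<^sub>N\<close> acts by \<open>- d\<^sup>2/dx\<^sup>2 + B\<^sup>2x\<^sup>2\<close> up to a translation. Folding the Hermite
  functions back up gives explicit smooth eigensections. They are complete because a function with
  Gaussian decay all of whose moments vanish has an identically vanishing Fourier transform, and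
  completeness with the symmetry of \<open>H\<^sub>N\<close> on smooth sections determines all eigenspaces of the closure.
  On the other side, \<open>1 / sin z\<close> is the sum of \<open>- 2\<i> e\<^bsup>\<i>(2k+1)z\<^esup>\<close> in the upper half plane, so Fourier
  inversion turns \<open>f\<^sub>0(\<phi>)\<close> into the sum of \<open>\<phi>(2\<pi>(2k + 1))\<close>.
\<close>

section \<open>Schwartz functions and Fourier inversion\<close>

text \<open>The identity is exact because dividing the levels by N leaves 2\<pi>(2k + 1),
  independent of N, while each level is repeated N times. The constant of \<open>f0\<close> fits
  because (\<i>/(4\<pi>)) (-2\<i>) (2\<pi>) = 1, with 2\<pi> contributed by Fourier inversion.

  Two features of the definitions shape the spectral half. An eigensection of the closure is only an
  L2 limit of smooth sections, so the differential expression cannot be applied to it; it is paired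
  with smooth sections, and the operator is moved to the smooth side before the limit is taken. The
  eigenvalues come from an unspecified choice among all enumerations, so the fibres of an arbitrary
  enumeration must be computed. Besides a basis of N elements this takes the uniqueness of the size
  of a basis modulo null sets.

  Completeness is reduced to moments on the line twice: for the Fourier coefficients as functions of
  x, and for functions of y on the unit interval, where multiplication by y preserves the vanishing
  of all Fourier coefficients.\<close>

lemma schwartz_vderiv: "schwartz f \<Longrightarrow> schwartz (vderiv f)"
proof -
  assume f: "schwartz f"
  have "(vderiv ^^ l) (vderiv f) = (vderiv ^^ Suc l) f" for l
    by (simp add: funpow_swap1)
  with f show ?thesis unfolding schwartz_def by presburger
qed

lemma schwartz_has_vderiv:
  assumes "schwartz f" shows "(f has_vector_derivative vderiv f x) (at x)"
proof -
  have "f differentiable (at x)" using assms unfolding schwartz_def by (metis funpow_0)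
  then show ?thesis by (simp add: vderiv_def vector_derivative_works)
qed

lemma schwartz_continuous: "schwartz f \<Longrightarrow> continuous_on A f"
  by (meson continuous_at_imp_continuous_on has_vector_derivative_continuous schwartz_has_vderiv)

lemma schwartz_measurable [measurable_dest]: "schwartz f \<Longrightarrow> f \<in> borel_measurable borel"
  by (intro borel_measurable_continuous_onI schwartz_continuous)

lemma schwartz_bound:
  assumes "schwartz f"
  obtains C where "C \<ge> 0" "\<And>x. norm (f x) \<le> C / (1 + x\<^sup>2)"
proof -
  have b: "bounded (range (\<lambda>x. x ^ k *\<^sub>R f x))" for k
    using assms unfolding schwartz_def by (metis funpow_0)
  obtain C0 where C0: "norm (f x) \<le> C0" for x using b[of 0] by (auto simp: bounded_iff)
  obtain C2 where C2: "x\<^sup>2 * norm (f x) \<le> C2" for x using b[of 2] by (auto simp: bounded_iff)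
  have "norm (f x) \<le> (C0 + C2) / (1 + x\<^sup>2)" for x
    using C0[of x] C2[of x] by (simp add: pos_le_divide_eq add_pos_nonneg algebra_simps)
  moreover have "C0 + C2 \<ge> 0" 
    using order.trans[OF norm_ge_zero C0] order.trans[OF _ C2[of 0], of 0] by simp
  ultimately show ?thesis using that by blast
qed

lemma integrable_inverse_1_plus_square:
  "integrable lborel (\<lambda>x::real. C / (1 + x\<^sup>2))"
proof -
  have "set_integrable lborel (einterval (-\<infinity>) \<infinity>) (\<lambda>x. inverse (1 + x\<^sup>2) :: real)"
    by (rule interval_integral_FTC_nonneg(1)[where F = arctan and A = "- pi/2" and B = "pi/2"])
      (auto intro!: derivative_eq_intros continuous_intros simp: add_nonneg_eq_0_iff 
        ereal_tendsto_simps tendsto_arctan_at_top tendsto_arctan_at_bot)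
  then have "integrable lborel (\<lambda>x::real. inverse (1 + x\<^sup>2))"
    by (simp add: set_integrable_def einterval_def)
  then have "integrable lborel (\<lambda>x::real. C * inverse (1 + x\<^sup>2))" by (rule integrable_mult_right)
  then show ?thesis by (simp add: field_simps)
qed

lemma integrable_quadratic_decay:
  fixes f :: "real \<Rightarrow> complex"
  assumes [measurable]: "f \<in> borel_measurable borel" and "\<And>x. norm (f x) \<le> C / (1 + x\<^sup>2)"
  shows "integrable lborel f"
proof (rule Bochner_Integration.integrable_bound[OF integrable_inverse_1_plus_square[of C]])
  show "AE x in lborel. norm (f x) \<le> norm (C / (1 + x\<^sup>2))"
    using assms(2) by (intro AE_I2) (smt (verit) real_norm_def)
qed simp

lemma schwartz_integrable: "schwartz f \<Longrightarrow> integrable lborel f"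
  by (metis schwartz_bound integrable_quadratic_decay schwartz_measurable)

lemma quadratic_decay_tendsto_0:
  assumes "\<And>x::real. norm (f x :: complex) \<le> C / (1 + x\<^sup>2)" "filterlim X at_infinity F"
  shows "((\<lambda>n. f (X n)) \<longlongrightarrow> 0) F"
proof (rule Lim_null_comparison)
  show "\<forall>\<^sub>F n in F. norm (f (X n)) \<le> C / (1 + (X n)\<^sup>2)" using assms(1) by simp
  have "filterlim (\<lambda>n. (X n)\<^sup>2) at_infinity F"
    using filterlim_at_infinity_times[OF assms(2) assms(2)] by (simp add: power2_eq_square)
  then have "filterlim (\<lambda>n. 1 + (X n)\<^sup>2) at_infinity F"
    by (intro tendsto_add_filterlim_at_infinity[OF tendsto_const])
  then show "((\<lambda>n. C / (1 + (X n)\<^sup>2)) \<longlongrightarrow> 0) F"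
    by (rule tendsto_divide_0[OF tendsto_const])
qed

text \<open>Integration by parts without boundary terms: the primitive vanishes at both ends, so the
  integrals over \<open>{- real n .. real n}\<close> tend to 0, and integrability of
  \<open>f\<close> makes them tend to the full integral as well.\<close>

lemma integral_derivative_eq_0:
  fixes F f :: "real \<Rightarrow> complex"
  assumes F: "\<And>x. (F has_vector_derivative f x) (at x)" and f: "continuous_on UNIV f"
    and i: "integrable lborel f"
    and b: "\<And>x. norm (F x) \<le> C / (1 + x\<^sup>2)"
  shows "integral\<^sup>L lborel f = 0"
proof -
  have "(\<lambda>n. LINT x|lborel. indicator {- real n .. real n} x *\<^sub>R f x) \<longlonglongrightarrow> integral\<^sup>L lborel f"
  proof (rule integral_dominated_convergence[OF _ _ integrable_norm[OF i]])
    show "AE x in lborel. (\<lambda>n. indicat_real {- real n..real n} x *\<^sub>R f x) \<longlonglongrightarrow> f x"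
    proof (intro AE_I2 tendsto_eventually)
      fix x :: real
      obtain N :: nat where N: "\<bar>x\<bar> \<le> N" using real_arch_simple by blast
      show "\<forall>\<^sub>F n in sequentially. indicat_real {- real n..real n} x *\<^sub>R f x = f x"
        using eventually_ge_at_top[of N] by eventually_elim (use N in \<open>auto simp: indicator_def abs_le_iff\<close>)
    qed
    show "f \<in> borel_measurable lborel" using i by auto
    then show "(\<lambda>x. indicat_real {- real n..real n} x *\<^sub>R f x) \<in> borel_measurable lborel" for n
      by measurable
  qed (auto simp: indicator_def)
  also have "(\<lambda>n. LINT x|lborel. indicator {- real n .. real n} x *\<^sub>R f x) = (\<lambda>n. F (real n) - F (- real n))"
    by (intro ext integral_FTC_atLeastAtMost) 
      (auto intro: has_vector_derivative_at_within F continuous_on_subset[OF f])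
  finally have "(\<lambda>n. F (real n) - F (- real n)) \<longlonglongrightarrow> integral\<^sup>L lborel f" .
  moreover have "(\<lambda>n. F (real n) - F (- real n)) \<longlonglongrightarrow> 0 - 0"
    by (intro tendsto_diff quadratic_decay_tendsto_0[OF b] filterlim_real_sequentially
          filterlim_at_top_imp_at_infinity filterlim_at_bot_imp_at_infinity
          filterlim_compose[OF filterlim_uminus_at_bot_at_top])
  ultimately show ?thesis using LIMSEQ_unique by fastforce
qed

lemma fourier_integrand_integrable:
  assumes "integrable lborel f"
  shows "integrable lborel (\<lambda>l. f l * exp (- (\<i> * of_real k * of_real l)))"
proof (rule Bochner_Integration.integrable_bound[OF assms])
  show "(\<lambda>l. f l * exp (- (\<i> * of_real k * of_real l))) \<in> borel_measurable lborel"
    using borel_measurable_integrable[OF assms] by measurable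
qed (simp add: norm_mult)

lemma norm_fourier_le: 
  assumes "integrable lborel f"
  shows "norm (fourier f k) \<le> (LINT l|lborel. norm (f l))"
  unfolding fourier_def
  by (rule order.trans[OF integral_norm_bound]) (simp add: norm_mult)

lemma fourier_vderiv:
  assumes f: "schwartz f"
  shows "fourier (vderiv f) k = \<i> * of_real k * fourier f k"
proof -
  let ?e = "\<lambda>l. exp (- (\<i> * of_real k * of_real l))"
  note i = fourier_integrand_integrable[OF schwartz_integrable[OF f]]
    and i' = fourier_integrand_integrable[OF schwartz_integrable[OF schwartz_vderiv[OF f]]]
  obtain C where C: "norm (f x) \<le> C / (1 + x\<^sup>2)" for x using schwartz_bound[OF f] by blast
  have "(LINT l|lborel. vderiv f l * ?e l - \<i> * of_real k * (f l * ?e l)) = 0"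
  proof (rule integral_derivative_eq_0)
    fix l
    have "((\<lambda>z. exp (- (\<i> * of_real k * z))) has_field_derivative - \<i> * of_real k * ?e l) (at (of_real l))"
      by (auto intro!: derivative_eq_intros)
    from has_vector_derivative_mult[OF schwartz_has_vderiv[OF f] has_vector_derivative_real_field[OF this]]
    show "((\<lambda>l. f l * ?e l) has_vector_derivative vderiv f l * ?e l - \<i> * of_real k * (f l * ?e l)) (at l)"
      by (simp add: algebra_simps)
  next
    show "continuous_on UNIV (\<lambda>l. vderiv f l * ?e l - \<i> * of_real k * (f l * ?e l))"
      by (intro continuous_intros schwartz_continuous f schwartz_vderiv)
    show "integrable lborel (\<lambda>l. vderiv f l * ?e l - \<i> * of_real k * (f l * ?e l))"
      using i i' by auto
    show "norm (f l * ?e l) \<le> C / (1 + l\<^sup>2)" for l using C by (simp add: norm_mult)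
  qed
  moreover have "(LINT l|lborel. vderiv f l * ?e l - \<i> * of_real k * (f l * ?e l)) = 
     fourier (vderiv f) k - \<i> * of_real k * fourier f k"
    unfolding fourier_def using i i' by (subst Bochner_Integration.integral_diff) auto
  ultimately show ?thesis by simp
qed

text \<open>Two derivatives become the factor k^2 on the Fourier side, which is already enough decay
  for integrability.\<close>

lemma fourier_decay:
  assumes f: "schwartz f"
  obtains C where "C \<ge> 0" "\<And>k. norm (fourier f k) \<le> C / (1 + k\<^sup>2)"
proof -
  let ?f2 = "vderiv (vderiv f)"
  define C where "C = (LINT l|lborel. norm (f l)) + (LINT l|lborel. norm (?f2 l))"
  have "norm (fourier f k) \<le> C / (1 + k\<^sup>2)" for k
  proof -
    have "fourier ?f2 k = - of_real (k\<^sup>2) * fourier f k"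
      by (simp add: fourier_vderiv f schwartz_vderiv power2_eq_square)
        (metis i_squared minus_mult_left mult.assoc mult.commute mult_1)
    then have "k\<^sup>2 * norm (fourier f k) = norm (fourier ?f2 k)" by (simp add: norm_mult norm_power)
    also have "\<dots> \<le> (LINT l|lborel. norm (?f2 l))"
      by (intro norm_fourier_le schwartz_integrable schwartz_vderiv f)
    finally have "(1 + k\<^sup>2) * norm (fourier f k) \<le> C"
      using norm_fourier_le[OF schwartz_integrable[OF f], of k] by (simp add: C_def algebra_simps)
    then show ?thesis by (simp add: pos_le_divide_eq add_pos_nonneg mult.commute)
  qed
  moreover have "C \<ge> 0" by (simp add: C_def)
  ultimately show ?thesis using that by blast
qed

lemma fourier_measurable: 
  assumes [measurable]: "f \<in> borel_measurable borel"
  shows "fourier f \<in> borel_measurable borel"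
proof -
  have "(\<lambda>k. LINT l|lborel. f l * exp (- (\<i> * of_real k * of_real l))) \<in> borel_measurable borel"
    by measurable
  then show ?thesis by (simp add: fourier_def[abs_def])
qed

lemma fourier_integrable: 
  assumes "schwartz f" shows "integrable lborel (fourier f)"
proof -
  obtain C where "\<And>k. norm (fourier f k) \<le> C / (1 + k\<^sup>2)" using fourier_decay[OF assms] by blast
  then show ?thesis 
    by (intro integrable_quadratic_decay fourier_measurable schwartz_measurable assms)
qed

section \<open>Gaussian regularisation and Fourier inversion\<close>

lemma gaussian_integrable: "integrable lborel (\<lambda>x::real. exp (- (x\<^sup>2 / 2)))"
proof -
  have "integrable lborel (\<lambda>x. sqrt (2 * pi) * std_normal_density x)"
    by (intro integrable_mult_right integrable_normal_density) simp
  then show ?thesis by (simp add: std_normal_density_def)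
qed

text \<open>Read off from the characteristic function of the standard normal distribution.\<close>

lemma gaussian_fourier:
  "(LINT x|lborel. of_real (exp (- (x\<^sup>2 / 2))) * iexp (t * x)) = of_real (sqrt (2 * pi) * exp (- (t\<^sup>2 / 2)))"
proof -
  have "of_real (exp (- (t\<^sup>2 / 2))) = (LINT x|lborel. std_normal_density x *\<^sub>R iexp (t * x))"
    using fun_cong[OF char_std_normal_distribution, of t] unfolding char_def
    by (subst (asm) integral_density) (auto simp: normal_density_nonneg)
  also have "\<dots> = (LINT x|lborel. of_real (1 / sqrt (2 * pi)) * (of_real (exp (- (x\<^sup>2 / 2))) * iexp (t * x)))"
    by (intro Bochner_Integration.integral_cong) (simp_all add: std_normal_density_def scaleR_conv_of_real)
  also have "\<dots> = of_real (1 / sqrt (2 * pi)) * (LINT x|lborel. of_real (exp (- (x\<^sup>2 / 2))) * iexp (t * x))"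
    by (rule Bochner_Integration.integral_mult_right_zero)
  finally show ?thesis by (simp add: field_simps)
qed

lemma integrable_tensor:
  fixes f g :: "real \<Rightarrow> complex"
  assumes f: "integrable lborel f" and g: "integrable lborel g"
  shows "integrable (lborel \<Otimes>\<^sub>M lborel) (\<lambda>(x, y). f x * g y)"
proof (rule lborel_pair.Fubini_integrable)
  have [measurable]: "f \<in> borel_measurable borel" "g \<in> borel_measurable borel" using f g by auto
  show "(\<lambda>(x, y). f x * g y) \<in> borel_measurable (lborel \<Otimes>\<^sub>M lborel)" by measurable
qed (use f g in \<open>auto simp: norm_mult\<close>)

text \<open>The Gaussian factor makes the double integral absolutely convergent, so Fubini applies.
  Integrating over \<open>k\<close> first produces a Gaussian of width \<open>s\<close> around
  \<open>x\<close>, hence an average of \<open>f\<close> near \<open>x\<close>.\<close>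

lemma fourier_gaussian_mollifier:
  fixes f :: "real \<Rightarrow> complex"
  assumes f: "integrable lborel f" and s: "s > 0"
  shows "(LINT k|lborel. fourier f k * iexp (k * x) * of_real (exp (- ((s * k)\<^sup>2 / 2)))) =
    sqrt (2 * pi) * (LINT w|lborel. f (x + s * w) * of_real (exp (- (w\<^sup>2 / 2))))"
proof -
  have [measurable]: "f \<in> borel_measurable borel" using f by auto
  define G where "G = (\<lambda>k::real. complex_of_real (exp (- ((s * k)\<^sup>2 / 2))))"
  have [measurable]: "G \<in> borel_measurable borel" unfolding G_def by measurable
  have Gi: "integrable lborel G" 
    using lborel_integrable_real_affine[OF gaussian_integrable, of s 0] s
    by (simp add: G_def)
  define h where "h = (\<lambda>(k, l). f l * exp (- (\<i> * of_real k * of_real l)) * iexp (k * x) * G k)"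
  have hi: "integrable (lborel \<Otimes>\<^sub>M lborel) h"
  proof (rule Bochner_Integration.integrable_bound[OF integrable_tensor[OF Gi f]])
    show "h \<in> borel_measurable (lborel \<Otimes>\<^sub>M lborel)" unfolding h_def by measurable
  qed (auto simp: h_def norm_mult)
  have inner: "(LINT k|lborel. h (k, l)) = f l * of_real (sqrt (2 * pi) / s * exp (- (((x - l) / s)\<^sup>2 / 2)))" for l
  proof -
    have "(LINT k|lborel. h (k, l)) = \<bar>inverse s\<bar> *\<^sub>R (LINT u|lborel. h (0 + inverse s * u, l))"
      by (rule lborel_integral_real_affine) (use s in simp)
    also have "(LINT u|lborel. h (0 + inverse s * u, l)) =
       (LINT u|lborel. f l * (of_real (exp (- (u\<^sup>2 / 2))) * iexp ((x - l) / s * u)))"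
    proof (intro Bochner_Integration.integral_cong refl)
      fix u :: real
      have "h (0 + inverse s * u, l) = f l * (G (u / s) * (exp (- (\<i> * of_real (u / s) * of_real l)) * iexp (u / s * x)))"
        by (simp add: h_def divide_inverse mult_ac)
      also have "exp (- (\<i> * of_real (u / s) * of_real l)) * iexp (u / s * x) = iexp ((x - l) / s * u)"
        using s by (simp add: exp_add[symmetric] field_simps)
      also have "G (u / s) = of_real (exp (- (u\<^sup>2 / 2)))" using s by (simp add: G_def)
      finally show "h (0 + inverse s * u, l) = f l * (of_real (exp (- (u\<^sup>2 / 2))) * iexp ((x - l) / s * u))" .
    qed
    also have "\<dots> = f l * (LINT u|lborel. of_real (exp (- (u\<^sup>2 / 2))) * iexp ((x - l) / s * u))"
      by (rule Bochner_Integration.integral_mult_right_zero)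
    also have "\<dots> = f l * of_real (sqrt (2 * pi) * exp (- (((x - l) / s)\<^sup>2 / 2)))"
      by (simp only: gaussian_fourier)
    also have "\<bar>inverse s\<bar> *\<^sub>R (f l * of_real (sqrt (2 * pi) * c)) = f l * of_real (sqrt (2 * pi) / s * c)" for c
      using s by (simp add: scaleR_conv_of_real field_simps)
    finally show ?thesis .
  qed
  have "(LINT k|lborel. fourier f k * iexp (k * x) * G k) = (LINT k|lborel. LINT l|lborel. h (k, l))"
    by (simp add: fourier_def h_def)
  also have "\<dots> = (LINT l|lborel. LINT k|lborel. h (k, l))"
    using lborel_pair.Fubini_integral[of "\<lambda>k l. h (k, l)"] hi by simp
  also have "\<dots> = (LINT l|lborel. f l * of_real (sqrt (2 * pi) / s * exp (- (((x - l) / s)\<^sup>2 / 2))))"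
    by (simp add: inner)
  also have "\<dots> = \<bar>s\<bar> *\<^sub>R (LINT w|lborel. f (x + s * w) * of_real (sqrt (2 * pi) / s * exp (- (((x - (x + s * w)) / s)\<^sup>2 / 2))))"
    by (rule lborel_integral_real_affine) (use s in simp)
  also have "\<dots> = \<bar>s\<bar> *\<^sub>R (LINT w|lborel. of_real (sqrt (2 * pi) / s) * (f (x + s * w) * of_real (exp (- (w\<^sup>2 / 2)))))"
    using s by (intro arg_cong[where f = "\<lambda>u. \<bar>s\<bar> *\<^sub>R u"] Bochner_Integration.integral_cong) auto
  also have "\<dots> = sqrt (2 * pi) * (LINT w|lborel. f (x + s * w) * of_real (exp (- (w\<^sup>2 / 2))))"
    using s by (simp only: Bochner_Integration.integral_mult_right_zero) (simp add: scaleR_conv_of_real)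
  finally show ?thesis by (simp add: G_def)
qed

text \<open>The width in the mollified identity tends to 0. On the left \<open>fourier f\<close>
  dominates, on the right a multiple of the Gaussian, as \<open>f\<close> is bounded; the constant
  is the product of two factors \<open>sqrt (2 * pi)\<close>.\<close>

theorem fourier_inversion:
  fixes f :: "real \<Rightarrow> complex"
  assumes f: "schwartz f"
  shows "(LINT k|lborel. fourier f k * iexp (k * x)) = 2 * pi * f x"
proof -
  have [measurable]: "f \<in> borel_measurable borel" "fourier f \<in> borel_measurable borel"
    using f by (auto intro: fourier_measurable schwartz_measurable)
  define s where "s = (\<lambda>n. inverse (real (Suc n)))"
  have s: "s n > 0" for n by (simp add: s_def)
  have slim: "s \<longlonglongrightarrow> 0" unfolding s_def by (rule LIMSEQ_inverse_real_of_nat)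
  obtain C where C: "C \<ge> 0" "\<And>x. norm (f x) \<le> C / (1 + x\<^sup>2)" using schwartz_bound[OF f] by blast
  have C': "norm (f x) \<le> C" for x
    by (rule order.trans[OF C(2)]) (use C(1) in \<open>simp add: pos_divide_le_eq add_pos_nonneg mult_le_cancel_left1\<close>)
  have "(\<lambda>n. LINT k|lborel. fourier f k * iexp (k * x) * of_real (exp (- ((s n * k)\<^sup>2 / 2))))
      \<longlonglongrightarrow> (LINT k|lborel. fourier f k * iexp (k * x))"
  proof (rule integral_dominated_convergence[OF _ _ integrable_norm[OF fourier_integrable[OF f]]])
    show "AE k in lborel. (\<lambda>n. fourier f k * iexp (k * x) * complex_of_real (exp (- ((s n * k)\<^sup>2 / 2))))
           \<longlonglongrightarrow> fourier f k * iexp (k * x)"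
    proof (rule AE_I2)
      fix k
      have "(\<lambda>n. fourier f k * iexp (k * x) * complex_of_real (exp (- ((s n * k)\<^sup>2 / 2))))
           \<longlonglongrightarrow> fourier f k * iexp (k * x) * complex_of_real (exp (- ((0 * k)\<^sup>2 / 2)))"
        by (intro tendsto_intros slim) simp
      then show "(\<lambda>n. fourier f k * iexp (k * x) * complex_of_real (exp (- ((s n * k)\<^sup>2 / 2))))
           \<longlonglongrightarrow> fourier f k * iexp (k * x)" by simp
    qed
  qed (auto simp: norm_mult mult_left_le)
  moreover have "(\<lambda>n. LINT w|lborel. f (x + s n * w) * of_real (exp (- (w\<^sup>2 / 2))))
      \<longlonglongrightarrow> (LINT w|lborel. f x * of_real (exp (- (w\<^sup>2 / 2))))"
  proof (rule integral_dominated_convergence)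
    show "integrable lborel (\<lambda>w. C * exp (- (w\<^sup>2 / 2)))" using gaussian_integrable by simp
    show "AE w in lborel. norm (f (x + s n * w) * of_real (exp (- (w\<^sup>2 / 2)))) \<le> C * exp (- (w\<^sup>2 / 2))" for n
      by (rule AE_I2) (use C' in \<open>simp add: norm_mult mult_right_mono\<close>)
    show "AE w in lborel. (\<lambda>n. f (x + s n * w) * of_real (exp (- (w\<^sup>2 / 2)))) \<longlonglongrightarrow> f x * of_real (exp (- (w\<^sup>2 / 2)))"
    proof (rule AE_I2)
      fix w
      have "(\<lambda>n. x + s n * w) \<longlonglongrightarrow> x + 0 * w" by (intro tendsto_intros slim)
      moreover have "isCont f (x + 0 * w)"
        using schwartz_continuous[OF f, of UNIV] by (simp add: continuous_on_eq_continuous_at)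
      ultimately have "(\<lambda>n. f (x + s n * w)) \<longlonglongrightarrow> f (x + 0 * w)" by (rule isCont_tendsto_compose[rotated])
      then show "(\<lambda>n. f (x + s n * w) * of_real (exp (- (w\<^sup>2 / 2)))) \<longlonglongrightarrow> f x * of_real (exp (- (w\<^sup>2 / 2)))"
        by (intro tendsto_mult) auto
    qed
  qed measurable
  then have "(\<lambda>n. sqrt (2 * pi) * (LINT w|lborel. f (x + s n * w) * of_real (exp (- (w\<^sup>2 / 2)))))
     \<longlonglongrightarrow> sqrt (2 * pi) * (LINT w|lborel. f x * of_real (exp (- (w\<^sup>2 / 2))))"
    by (intro tendsto_mult tendsto_const)
  ultimately have "(LINT k|lborel. fourier f k * iexp (k * x)) =
      sqrt (2 * pi) * (LINT w|lborel. f x * of_real (exp (- (w\<^sup>2 / 2))))"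
    unfolding fourier_gaussian_mollifier[OF schwartz_integrable[OF f] s] by (rule LIMSEQ_unique)
  also have "(LINT w|lborel. f x * of_real (exp (- (w\<^sup>2 / 2)))) = f x * sqrt (2 * pi)"
    using gaussian_fourier[of 0] by simp
  finally show ?thesis by (simp add: mult.commute flip: of_real_mult)
qed

section \<open>The distribution 1 / sin as a sum over the Landau levels\<close>

text \<open>With q = exp (\<i> z) one has sin z = (q - 1/q) / (2\<i>), so 1 / sin z is -2\<i>q times
  a geometric series in q^2; the upper half plane is where |q| < 1.\<close>

lemma inverse_sin_sums:
  assumes z: "Im z > 0"
  shows "(\<lambda>k. - 2 * \<i> * exp (\<i> * z) ^ (2 * k + 1)) sums (1 / sin z)"
proof -
  define q where "q = exp (\<i> * z)"
  have q0: "q \<noteq> 0" by (simp add: q_def)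
  have q: "norm q < 1" using z by (simp add: q_def)
  then have q2: "norm (q\<^sup>2) < 1" by (simp add: norm_power power_less_one_iff)
  then have q21: "q\<^sup>2 \<noteq> 1" by auto
  have "(\<lambda>k. - 2 * \<i> * q * (q\<^sup>2) ^ k) sums (- 2 * \<i> * q * (1 / (1 - q\<^sup>2)))"
    by (intro sums_mult geometric_sums q2)
  moreover have "sin z = (q - 1 / q) / (2 * \<i>)"
    by (simp add: sin_exp_eq q_def exp_minus field_simps)
  moreover have "- 2 * \<i> * q * (1 / (1 - q\<^sup>2)) = 1 / ((q - 1 / q) / (2 * \<i>))"
    using q0 q21 by (simp add: field_simps power2_eq_square)
  ultimately show ?thesis
    by (simp add: q_def[symmetric] power_mult mult.assoc)
qed

lemma schwartz_landau_summable:
  assumes "schwartz \<phi>"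
  shows "summable (\<lambda>k. norm (\<phi> (2 * pi * (2 * real k + 1))))"
proof -
  obtain C where C: "C \<ge> 0" "\<And>x. norm (\<phi> x) \<le> C / (1 + x\<^sup>2)" using schwartz_bound[OF assms] by blast
  have "summable (\<lambda>n. inverse (real (Suc n) ^ 2))"
    using inverse_power_summable[of 2, where 'a = real] by (subst summable_Suc_iff) simp
  then have s: "summable (\<lambda>k. C * inverse (real (Suc k) ^ 2))" by (rule summable_mult)
  show ?thesis
  proof (rule summable_comparison_test'[OF s])
    fix k
    have "real (Suc k) \<le> 2 * pi * (2 * real k + 1)"
    proof -
      have "1 * real (Suc k) \<le> (2 * pi) * (2 * real k + 1)" by (intro mult_mono) (use pi_gt3 in auto)
      then show ?thesis by simp
    qed
    then have "real (Suc k) ^ 2 \<le> (2 * pi * (2 * real k + 1))\<^sup>2" by (intro power_mono) auto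
    then have "real (Suc k) ^ 2 \<le> 1 + (2 * pi * (2 * real k + 1))\<^sup>2" by linarith
    then have "C / (1 + (2 * pi * (2 * real k + 1))\<^sup>2) \<le> C / real (Suc k) ^ 2"
      by (rule divide_left_mono) (intro C(1) mult_pos_pos add_pos_nonneg; simp)+
    then show "norm (norm (\<phi> (2 * pi * (2 * real k + 1)))) \<le> C * inverse (real (Suc k) ^ 2)"
      using C(2)[of "2 * pi * (2 * real k + 1)"] by (simp add: divide_inverse)
  qed
qed

text \<open>For fixed \<epsilon> the modulus \<open>r\<close> is the same for all real
  \<open>t\<close>, so the series may be integrated termwise against the integrable
  \<open>fourier \<phi>\<close>. Fourier inversion evaluates each term; the shift by \<i>\<epsilon>
  survives only as an exponential damping.\<close>

lemma integral_fourier_div_sin: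
  assumes f: "schwartz \<phi>" and e: "\<epsilon> > 0"
  shows "(LINT t|lborel. fourier \<phi> t / sin (of_real (2 * pi) * (of_real t + \<i> * of_real \<epsilon>))) =
    (\<Sum>k. - 4 * pi * \<i> * (of_real (exp (- (2 * pi * (2 * real k + 1)) * \<epsilon>)) * \<phi> (2 * pi * (2 * real k + 1))))"
proof -
  note i = fourier_integrable[OF f]
  then have [measurable]: "fourier \<phi> \<in> borel_measurable borel" by auto
  define r where "r = exp (- 2 * pi * \<epsilon>)"
  have r: "0 \<le> r" "r < 1" "r\<^sup>2 < 1" using e by (auto simp: r_def power_less_one_iff)
  define q where "q = (\<lambda>t. exp (\<i> * (of_real (2 * pi) * (of_real t + \<i> * of_real \<epsilon>))))"
  have q: "q t ^ (2 * k + 1) = of_real (r ^ (2 * k + 1)) * iexp (t * (2 * pi * (2 * real k + 1)))" for k t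
    by (simp add: q_def r_def exp_of_real[symmetric] algebra_simps flip: exp_of_nat_mult exp_add)
  have nq: "norm (q t ^ (2 * k + 1)) = r ^ (2 * k + 1)" for k t
    unfolding q by (simp add: norm_mult norm_power r(1))
  have qm[measurable]: "q \<in> borel_measurable borel" unfolding q_def by measurable
  define F where "F = (\<lambda>k t. fourier \<phi> t * (- 2 * \<i> * q t ^ (2 * k + 1)))"
  have nF: "norm (F k t) = 2 * norm (fourier \<phi> t) * r ^ (2 * k + 1)" for k t
    unfolding F_def norm_mult nq by simp
  have sg: "summable (\<lambda>k. c * r ^ (2 * k + 1))" for c
  proof -
    have "summable (\<lambda>k. c * r * (r\<^sup>2) ^ k)" using r by (intro summable_mult summable_geometric) auto
    then show ?thesis by (simp add: power_mult mult.assoc)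
  qed
  have Fi: "integrable lborel (F k)" for k
  proof (rule Bochner_Integration.integrable_bound)
    show "integrable lborel (\<lambda>t. 2 * norm (fourier \<phi> t) * r ^ (2 * k + 1))" using i by simp
    show "F k \<in> borel_measurable lborel" unfolding F_def by measurable
    show "AE t in lborel. norm (F k t) \<le> norm (2 * norm (fourier \<phi> t) * r ^ (2 * k + 1))"
      unfolding nF using r by simp
  qed
  have "(LINT t|lborel. fourier \<phi> t / sin (of_real (2 * pi) * (of_real t + \<i> * of_real \<epsilon>))) =
    (LINT t|lborel. (\<Sum>k. F k t))"
  proof (intro Bochner_Integration.integral_cong refl)
    fix t
    have "(\<lambda>k. - 2 * \<i> * q t ^ (2 * k + 1)) sums (1 / sin (of_real (2 * pi) * (of_real t + \<i> * of_real \<epsilon>)))"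
      unfolding q_def by (rule inverse_sin_sums) (use e in simp)
    then have "(\<lambda>k. F k t) sums (fourier \<phi> t * (1 / sin (of_real (2 * pi) * (of_real t + \<i> * of_real \<epsilon>))))"
      unfolding F_def by (rule sums_mult)
    then show "fourier \<phi> t / sin (of_real (2 * pi) * (of_real t + \<i> * of_real \<epsilon>)) = (\<Sum>k. F k t)"
      by (simp add: sums_iff)
  qed
  also have "\<dots> = (\<Sum>k. integral\<^sup>L lborel (F k))"
  proof (rule integral_suminf[OF Fi])
    show "AE t in lborel. summable (\<lambda>k. norm (F k t))" unfolding nF by (intro AE_I2 sg)
    have "(LINT t|lborel. norm (F k t)) = (LINT t|lborel. 2 * norm (fourier \<phi> t)) * r ^ (2 * k + 1)" for k
      unfolding nF by (rule Bochner_Integration.integral_mult_left_zero)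
    then show "summable (\<lambda>k. LINT t|lborel. norm (F k t))" by (simp only: sg)
  qed
  also have "\<dots> = (\<Sum>k. - 4 * pi * \<i> * (of_real (exp (- (2 * pi * (2 * real k + 1)) * \<epsilon>)) * \<phi> (2 * pi * (2 * real k + 1))))"
  proof (rule suminf_cong)
    fix k
    have "integral\<^sup>L lborel (F k) = (LINT t|lborel. (- 2 * \<i> * of_real (r ^ (2 * k + 1))) *
        (fourier \<phi> t * iexp (t * (2 * pi * (2 * real k + 1)))))"
      unfolding F_def q by (intro Bochner_Integration.integral_cong refl) (simp only: mult_ac)
    also have "\<dots> = (- 2 * \<i> * of_real (r ^ (2 * k + 1))) * (2 * pi * \<phi> (2 * pi * (2 * real k + 1)))"
      by (simp only: Bochner_Integration.integral_mult_right_zero fourier_inversion[OF f])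
    also have "r ^ (2 * k + 1) = exp (- (2 * pi * (2 * real k + 1)) * \<epsilon>)"
      unfolding r_def by (subst exp_of_nat_mult[symmetric]) (simp add: algebra_simps)
    finally show "integral\<^sup>L lborel (F k) = - 4 * pi * \<i> * (of_real (exp (- (2 * pi * (2 * real k + 1)) * \<epsilon>)) * \<phi> (2 * pi * (2 * real k + 1)))"
      by (simp add: mult_ac)
  qed
  finally show ?thesis .
qed

lemma pairing_constant: "\<i> / (4 * of_real pi) * (of_real (- 4 * pi) * \<i> * s) = s" for s
  by (simp add: field_simps)

text \<open>For positive \<epsilon> the damping factors are at most 1, so the summable values of
  \<phi> dominate and Tannery's theorem lets \<epsilon> tend to 0 inside the sum.\<close>

theorem f0_eq_landau_sum:
  assumes f: "schwartz \<phi>"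
  shows "f0 \<phi> = (\<Sum>k. \<phi> (2 * pi * (2 * real k + 1)))"
proof -
  let ?l = "\<lambda>k. 2 * pi * (2 * real k + 1)"
  define a where "a = (\<lambda>k \<epsilon>. - 4 * pi * \<i> * (of_real (exp (- ?l k * \<epsilon>)) * \<phi> (?l k)))"
  have "((\<lambda>\<epsilon>. \<Sum>k. a k \<epsilon>) \<longlongrightarrow> (\<Sum>k. - 4 * pi * \<i> * \<phi> (?l k))) (at_right 0)"
  proof (rule conjunct2[OF conjunct2[OF tannerys_theorem]])
    show "((\<lambda>\<epsilon>. a k \<epsilon>) \<longlongrightarrow> - 4 * pi * \<i> * \<phi> (?l k)) (at_right 0)" for k
    proof -
      have "((\<lambda>\<epsilon>. a k \<epsilon>) \<longlongrightarrow> - 4 * pi * \<i> * (of_real (exp (- ?l k * 0)) * \<phi> (?l k))) (at_right 0)"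
        unfolding a_def by (intro tendsto_mult tendsto_const tendsto_of_real tendsto_exp tendsto_ident_at)
      then show ?thesis by simp
    qed
    show "\<forall>\<^sub>F (k, \<epsilon>) in at_top \<times>\<^sub>F at_right 0. norm (a k \<epsilon>) \<le> 4 * pi * norm (\<phi> (?l k))"
    proof -
      have "\<forall>\<^sub>F \<epsilon> in at_right (0::real). 0 < \<epsilon>" by (rule eventually_at_right_less)
      then have "\<forall>\<^sub>F x in (at_top :: nat filter) \<times>\<^sub>F at_right (0::real). 0 < snd x"
        by (rule eventually_compose_filterlim[OF _ filterlim_snd])
      then show ?thesis
      proof eventually_elim
        case (elim x)
        have "?l (fst x) * snd x \<ge> 0" using elim by (intro mult_nonneg_nonneg) auto
        then have "exp (- ?l (fst x) * snd x) \<le> 1" by (simp only: mult_minus_left exp_le_one_iff neg_le_0_iff_le)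
        then have "4 * pi * (exp (- ?l (fst x) * snd x) * norm (\<phi> (?l (fst x)))) \<le> 4 * pi * (1 * norm (\<phi> (?l (fst x))))"
          by (intro mult_left_mono mult_right_mono) auto
        then show ?case by (simp add: case_prod_unfold a_def norm_mult)
      qed
    qed
    show "summable (\<lambda>k. 4 * pi * norm (\<phi> (?l k)))"
      by (intro summable_mult schwartz_landau_summable f)
  qed simp
  moreover have "\<forall>\<^sub>F \<epsilon> in at_right 0. (\<Sum>k. a k \<epsilon>) = 
     (LINT t|lborel. fourier \<phi> t / sin (of_real (2 * pi) * (of_real t + \<i> * of_real \<epsilon>)))"
    using eventually_at_right_less[of 0] by eventually_elim (simp only: a_def integral_fourier_div_sin[OF f])
  ultimately have "((\<lambda>\<epsilon>. LINT t|lborel. fourier \<phi> t / sin (of_real (2 * pi) * (of_real t + \<i> * of_real \<epsilon>)))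
     \<longlongrightarrow> (\<Sum>k. - 4 * pi * \<i> * \<phi> (?l k))) (at_right 0)"
    by (rule Lim_transform_eventually)
  then have "inv_sin_pairing (2 * pi) (fourier \<phi>) = (\<Sum>k. - 4 * pi * \<i> * \<phi> (?l k))"
    unfolding inv_sin_pairing_def by (intro tendsto_Lim) simp_all
  also have "\<dots> = - 4 * pi * \<i> * (\<Sum>k. \<phi> (?l k))"
    by (rule suminf_mult[OF summable_norm_cancel[OF schwartz_landau_summable[OF f]]])
  finally have "f0 \<phi> = \<i> / (4 * of_real pi) * (- 4 * pi * \<i> * (\<Sum>k. \<phi> (?l k)))" by (simp only: f0_def)
  also have "\<dots> = (\<Sum>k. \<phi> (?l k))" by (rule pairing_constant)
  finally show ?thesis .
qed

section \<open>Uniqueness for Fourier transforms and Fourier coefficients\<close>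

text \<open>At \<open>t = 0\<close> the positive and negative parts of \<open>g\<close> are seen to
  have the same mass \<open>c\<close>. Divided by \<open>c\<close> they are probability densities
  with equal characteristic functions, so Levy's uniqueness theorem identifies them; for
  \<open>c = 0\<close> both vanish almost everywhere.\<close>

lemma fourier_unique_real:
  fixes g :: "real \<Rightarrow> real"
  assumes g: "integrable lborel g"
    and 0: "\<And>t. (LINT x|lborel. of_real (g x) * iexp (t * x)) = 0"
  shows "AE x in lborel. g x = 0"
proof -
  define p where "p = (\<lambda>x. max 0 (g x))"
  define n where "n = (\<lambda>x. max 0 (- g x))"
  have ip: "integrable lborel p" and in': "integrable lborel n"
    using g by (auto simp: p_def n_def)
  have gm[measurable]: "g \<in> borel_measurable borel" using g by auto
  have pm[measurable]: "p \<in> borel_measurable borel" and nm[measurable]: "n \<in> borel_measurable borel"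
    by (auto simp: p_def n_def)
  have pn: "0 \<le> p x" "0 \<le> n x" "g x = p x - n x" for x by (auto simp: p_def n_def)
  have ie: "integrable lborel (\<lambda>x. of_real (f x) * iexp (t * x))"
    if "integrable lborel f" for f :: "real \<Rightarrow> real" and t
  proof (rule Bochner_Integration.integrable_bound[OF that])
    show "(\<lambda>x. complex_of_real (f x) * iexp (t * x)) \<in> borel_measurable lborel"
      using borel_measurable_integrable[OF that] by measurable
  qed (auto simp: norm_mult)
  have eq: "(LINT x|lborel. of_real (p x) * iexp (t * x)) = (LINT x|lborel. of_real (n x) * iexp (t * x))" for t
  proof -
    have "(LINT x|lborel. of_real (p x) * iexp (t * x)) - (LINT x|lborel. of_real (n x) * iexp (t * x)) = 
      (LINT x|lborel. of_real (p x) * iexp (t * x) - of_real (n x) * iexp (t * x))"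
      using ie[OF ip, of t] ie[OF in', of t] by (rule Bochner_Integration.integral_diff[symmetric])
    also have "\<dots> = (LINT x|lborel. of_real (g x) * iexp (t * x))"
      by (intro Bochner_Integration.integral_cong) (simp_all only: pn(3) of_real_diff left_diff_distrib)
    finally have "(LINT x|lborel. of_real (p x) * iexp (t * x)) - (LINT x|lborel. of_real (n x) * iexp (t * x)) = 
      (LINT x|lborel. of_real (g x) * iexp (t * x))" .
    with 0 show ?thesis by simp
  qed
  define c where "c = integral\<^sup>L lborel p"
  have "complex_of_real (integral\<^sup>L lborel n) = complex_of_real (integral\<^sup>L lborel p)"
    using eq[of 0] by simp
  then have c: "integral\<^sup>L lborel n = c" by (simp add: c_def)
  have c0: "c \<ge> 0" unfolding c_def by (simp add: pn)
  show ?thesis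
  proof (cases "c = 0")
    case True
    have "AE x in lborel. p x = 0" "AE x in lborel. n x = 0"
      using True c integral_nonneg_eq_0_iff_AE[OF ip] integral_nonneg_eq_0_iff_AE[OF in'] pn
      by (simp_all add: c_def)
    then show ?thesis by eventually_elim (simp add: pn)
  next
    case False
    with c0 have cp: "c > 0" by simp
    have rd: "real_distribution (density lborel (\<lambda>x. ennreal (f x / c)))"
      if f: "integrable lborel f" "\<And>x. f x \<ge> 0" "integral\<^sup>L lborel f = c" for f
    proof -
      have "(\<integral>\<^sup>+ x. ennreal (f x / c) \<partial>lborel) = ennreal (LINT x|lborel. f x / c)"
        using f cp by (intro nn_integral_eq_integral) auto
      also have "\<dots> = 1" using f cp by simp
      finally have 1: "(\<integral>\<^sup>+ x. ennreal (f x / c) \<partial>lborel) = 1" .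
      have m: "(\<lambda>x. ennreal (f x / c)) \<in> borel_measurable lborel"
        using borel_measurable_integrable[OF f(1)] by measurable
      have "prob_space (density lborel (\<lambda>x. ennreal (f x / c)))"
        by (rule prob_spaceI) (use 1 m in \<open>simp add: emeasure_density\<close>)
      then show ?thesis by (auto simp: real_distribution_def real_distribution_axioms_def)
    qed
    have ch: "char (density lborel (\<lambda>x. ennreal (f x / c))) t = 
        (LINT x|lborel. of_real (f x) * iexp (t * x)) / of_real c"
      if f: "integrable lborel f" "\<And>x. f x \<ge> 0" for f t
    proof -
      have "char (density lborel (\<lambda>x. ennreal (f x / c))) t = (LINT x|lborel. (f x / c) *\<^sub>R iexp (t * x))"
        unfolding char_def using borel_measurable_integrable[OF f(1)] f(2) cp
        by (intro integral_density) auto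
      also have "\<dots> = (LINT x|lborel. (of_real (f x) * iexp (t * x)) / of_real c)"
        by (intro Bochner_Integration.integral_cong) (auto simp: scaleR_conv_of_real)
      finally show ?thesis by simp
    qed
    have "density lborel (\<lambda>x. ennreal (p x / c)) = density lborel (\<lambda>x. ennreal (n x / c))"
      by (intro Levy_uniqueness rd ip in' pn c c_def[symmetric] ext)
        (simp only: ch[OF ip pn(1)] ch[OF in' pn(2)] eq)
    then have "AE x in lborel. ennreal (p x / c) = ennreal (n x / c)"
      by (intro sigma_finite_measure.density_unique[OF sigma_finite_lborel]) auto
    then show ?thesis
    proof eventually_elim
      case (elim x)
      then show ?case using pn[of x] cp by (simp add: ennreal_inj)
    qed
  qed
qed

text \<open>Conjugation turns t into -t, so the conjugate of \<open>g\<close>, and with it the real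
  and imaginary parts, have vanishing transforms too.\<close>

lemma fourier_unique:
  fixes g :: "real \<Rightarrow> complex"
  assumes g: "integrable lborel g"
    and 0: "\<And>t. (LINT x|lborel. g x * iexp (t * x)) = 0"
  shows "AE x in lborel. g x = 0"
proof -
  have gm[measurable]: "g \<in> borel_measurable borel" using g by auto
  have [measurable]: "(\<lambda>x. cnj (g x)) \<in> borel_measurable borel"
    by (intro measurable_compose[OF gm] borel_measurable_continuous_onI continuous_intros)
  have I: "integrable lborel (\<lambda>x. g x * iexp (t * x))" "integrable lborel (\<lambda>x. cnj (g x) * iexp (t * x))" for t
    by (rule Bochner_Integration.integrable_bound[OF g]; simp add: norm_mult)+
  have 1: "(LINT x|lborel. cnj (g x) * iexp (t * x)) = 0" for t
  proof -
    have "(LINT x|lborel. cnj (g x) * iexp (t * x)) = (LINT x|lborel. cnj (g x * iexp (- t * x)))"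
      by (intro Bochner_Integration.integral_cong) (auto simp: exp_cnj)
    also have "\<dots> = 0" using 0[of "-t"] by (simp only: Bochner_Integration.integral_cnj complex_cnj_zero)
    finally show ?thesis .
  qed
  have Re: "complex_of_real (Re z) = (z + cnj z) / 2"
    and Im: "complex_of_real (Im z) = (z - cnj z) / (2 * \<i>)" for z
    by (simp_all add: complex_eq_iff)
  have "AE x in lborel. Re (g x) = 0"
  proof (rule fourier_unique_real)
    have "(LINT x|lborel. complex_of_real (Re (g x)) * iexp (t * x)) = 
       (LINT x|lborel. (g x * iexp (t * x) + cnj (g x) * iexp (t * x)) / 2)" for t
      by (intro Bochner_Integration.integral_cong) (simp_all only: Re distrib_right times_divide_eq_left refl)
    then show "(LINT x|lborel. complex_of_real (Re (g x)) * iexp (t * x)) = 0" for t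
      using I 0 1 by simp
  qed (use g in auto)
  moreover have "AE x in lborel. Im (g x) = 0"
  proof (rule fourier_unique_real)
    have "(LINT x|lborel. complex_of_real (Im (g x)) * iexp (t * x)) = 
       (LINT x|lborel. (g x * iexp (t * x) - cnj (g x) * iexp (t * x)) / (2 * \<i>))" for t
      by (intro Bochner_Integration.integral_cong) (simp_all only: Im left_diff_distrib times_divide_eq_left refl)
    then show "(LINT x|lborel. complex_of_real (Im (g x)) * iexp (t * x)) = 0" for t
      using I 0 1 by simp
  qed (use g in auto)
  ultimately show ?thesis by eventually_elim (simp add: complex_eq_iff)
qed

text \<open>Each Taylor polynomial of the exponential integrates to a combination of moments. The
  weight exp (|t| |x|) dominates all these polynomials at once, so the Fourier integral is a limit
  of zeros.\<close>

lemma moments_unique: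
  fixes g :: "real \<Rightarrow> complex"
  assumes g: "\<And>t. integrable lborel (\<lambda>x. exp (t * \<bar>x\<bar>) *\<^sub>R g x)"
    and 0: "\<And>k. (LINT x|lborel. of_real x ^ k * g x) = 0"
  shows "AE x in lborel. g x = 0"
proof (rule fourier_unique)
  show g0: "integrable lborel g" using g[of 0] by simp
  then have gm[measurable]: "g \<in> borel_measurable borel" by auto
  fix t :: real
  define s where "s = (\<lambda>K x. (\<Sum>k<K. (\<i> * of_real (t * x)) ^ k /\<^sub>R fact k) * g x)"
  have s_le: "norm (s K x) \<le> norm (exp (\<bar>t\<bar> * \<bar>x\<bar>) *\<^sub>R g x)" for K x
  proof -
    have "norm (\<Sum>k<K. (\<i> * complex_of_real (t * x)) ^ k /\<^sub>R fact k) \<le> (\<Sum>k<K. \<bar>t * x\<bar> ^ k /\<^sub>R fact k)"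
      by (rule order.trans[OF norm_sum]) (simp add: norm_mult norm_power abs_mult power_mult_distrib)
    also have "\<dots> \<le> exp \<bar>t * x\<bar>"
      unfolding exp_def by (rule sum_le_suminf[OF summable_exp_generic]) auto
    finally show ?thesis unfolding s_def by (simp add: norm_mult abs_mult mult_right_mono)
  qed
  have gk: "integrable lborel (\<lambda>x. of_real x ^ k * g x)" for k
  proof (rule Bochner_Integration.integrable_bound[OF g[of "real k"]])
    show "AE x in lborel. norm (complex_of_real x ^ k * g x) \<le> norm (exp (real k * \<bar>x\<bar>) *\<^sub>R g x)"
    proof (intro AE_I2)
      fix x :: real
      have "\<bar>x\<bar> ^ k \<le> exp \<bar>x\<bar> ^ k" by (intro power_mono) (use exp_ge_add_one_self[of "\<bar>x\<bar>"] in linarith)+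
      also have "\<dots> = exp (real k * \<bar>x\<bar>)" by (simp add: exp_of_nat_mult)
      finally show "norm (complex_of_real x ^ k * g x) \<le> norm (exp (real k * \<bar>x\<bar>) *\<^sub>R g x)"
        by (simp add: norm_mult norm_power mult_right_mono)
    qed
  qed measurable
  have "(LINT x|lborel. s K x) = 0" for K
  proof -
    have "(LINT x|lborel. s K x) = (LINT x|lborel. (\<Sum>k<K. (\<i> * of_real t) ^ k / fact k * (of_real x ^ k * g x)))"
      unfolding s_def sum_distrib_right
      by (intro Bochner_Integration.integral_cong sum.cong refl) 
        (simp add: power_mult_distrib scaleR_conv_of_real divide_inverse mult_ac)
    also have "\<dots> = 0" using gk by (subst Bochner_Integration.integral_sum) (auto simp: 0)
    finally show ?thesis .
  qed
  moreover have "(\<lambda>K. LINT x|lborel. s K x) \<longlonglongrightarrow> (LINT x|lborel. iexp (t * x) * g x)"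
  proof (rule integral_dominated_convergence)
    show "integrable lborel (\<lambda>x. norm (exp (\<bar>t\<bar> * \<bar>x\<bar>) *\<^sub>R g x))" using g by (rule integrable_norm)
    show "AE x in lborel. (\<lambda>K. s K x) \<longlonglongrightarrow> iexp (t * x) * g x"
    proof (intro AE_I2)
      fix x 
      have "(\<lambda>k. (\<i> * complex_of_real (t * x)) ^ k /\<^sub>R fact k) sums iexp (t * x)" by (rule exp_converges)
      then show "(\<lambda>K. s K x) \<longlonglongrightarrow> iexp (t * x) * g x"
        unfolding s_def sums_def by (intro tendsto_mult) auto
    qed
  qed (use s_le in \<open>auto simp: s_def\<close>)
  ultimately show "(LINT x|lborel. g x * iexp (t * x)) = 0"
    by (simp add: LIMSEQ_const_iff mult.commute)
qed

section \<open>Fourier coefficients on the unit interval\<close>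

definition circ :: "int \<Rightarrow> real \<Rightarrow> complex" where
  "circ n y = exp (2 * of_real pi * \<i> * of_int n * of_real y)"

lemma circ_add: "circ (m + n) y = circ m y * circ n y"
  by (simp add: circ_def algebra_simps flip: exp_add)

lemma circ_0 [simp]: "circ 0 y = 1"
  by (simp add: circ_def)

lemma norm_circ [simp]: "norm (circ n y) = 1"
proof -
  have "circ n y = cis (2 * pi * n * y)" by (simp add: circ_def cis_conv_exp mult_ac)
  then show ?thesis by simp
qed

lemma cnj_circ [simp]: "cnj (circ n y) = circ (- n) y"
  by (simp add: circ_def exp_cnj)

lemma circ_power: "circ n y ^ k = circ (int k * n) y"
  by (simp add: circ_def algebra_simps flip: exp_of_nat_mult)

lemma continuous_on_circ [continuous_intros]:
  "continuous_on A f \<Longrightarrow> continuous_on A (\<lambda>x. circ n (f x))"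
  unfolding circ_def by (intro continuous_intros)

lemma circ_measurable [measurable]: "circ n \<in> borel_measurable borel"
  unfolding circ_def by measurable

text \<open>Polar form: 1 - exp (2\<pi>\<i>y) = 2 sin (\<pi>y) exp (\<i>\<pi>(y - 1/2)). On the open
  interval the modulus is positive and the angle lies within the principal branch, so the imaginary
  part of the logarithm is a sawtooth.\<close>

lemma Im_Ln_one_minus_circ:
  assumes "0 < y" "y < 1"
  shows "Im (Ln (1 - circ 1 y)) = pi * (y - 1 / 2)"
proof -
  have s: "sin (pi * y) > 0" using assms by (intro sin_gt_zero) auto
  have "1 - circ 1 y = of_real (2 * sin (pi * y)) * cis (pi * (y - 1 / 2))"
  proof -
    have "circ 1 y = cis (2 * (pi * y))" by (simp add: circ_def cis_conv_exp mult_ac)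
    moreover have "cos (pi * (y - 1/2)) = sin (pi * y)" "sin (pi * (y - 1/2)) = - cos (pi * y)"
      using cos_diff[of "pi * y" "pi / 2"] sin_diff[of "pi * y" "pi / 2"] by (simp_all add: algebra_simps)
    moreover have "(cos (pi * y))\<^sup>2 = 1 - (sin (pi * y))\<^sup>2" by (simp add: cos_squared_eq)
    ultimately show ?thesis
      by (simp add: complex_eq_iff cos_double sin_double power2_eq_square)
  qed
  also have "\<dots> = exp (of_real (ln (2 * sin (pi * y))) + \<i> * of_real (pi * (y - 1/2)))"
    using s by (simp add: exp_add cis_conv_exp exp_of_real)
  also have "Ln \<dots> = of_real (ln (2 * sin (pi * y))) + \<i> * of_real (pi * (y - 1/2))"
  proof (rule Ln_exp)
    have "pi * (y - 1/2) > pi * (-1)" "pi * (y - 1/2) < pi * 1"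
      by (intro mult_strict_left_mono; use assms in simp)+
    then show "- pi < Im (of_real (ln (2 * sin (pi * y))) + \<i> * of_real (pi * (y - 1/2)))"
      "Im (of_real (ln (2 * sin (pi * y))) + \<i> * of_real (pi * (y - 1/2))) \<le> pi" by simp_all
  qed
  finally show ?thesis by simp
qed

text \<open>Extension by 0 puts functions on the circle onto the line, where
  \<open>moments_unique\<close> applies. The class turns out to be stable under multiplication by
  characters and by y.\<close>

definition null_coeffs :: "(real \<Rightarrow> complex) \<Rightarrow> bool" where
  "null_coeffs g \<longleftrightarrow> integrable lborel g \<and> (\<forall>y. y \<notin> {0..1} \<longrightarrow> g y = 0) \<and>
     (\<forall>n. (LINT y|lborel. circ n y * g y) = 0)"

lemma null_coeffs_circ:
  assumes "null_coeffs g"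
  shows "null_coeffs (\<lambda>y. circ m y * g y)"
proof -
  have i: "integrable lborel g" using assms by (simp add: null_coeffs_def)
  then have [measurable]: "g \<in> borel_measurable borel" by auto
  have "integrable lborel (\<lambda>y. circ m y * g y)"
    by (rule Bochner_Integration.integrable_bound[OF i]) (auto simp: norm_mult)
  then show ?thesis
    using assms by (simp add: null_coeffs_def flip: mult.assoc circ_add)
qed

lemma null_coeffs_integrable_id:
  assumes g: "null_coeffs g"
  shows "integrable lborel (\<lambda>y. of_real y * g y)"
proof (rule Bochner_Integration.integrable_bound)
  show i: "integrable lborel g" using g by (auto simp add: null_coeffs_def)
  have [measurable]: "g \<in> borel_measurable borel" using i by auto
  show "(\<lambda>y. of_real y * g y) \<in> borel_measurable lborel" by measurable
  show "AE y in lborel. norm (complex_of_real y * g y) \<le> norm (g y)"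
  proof (rule AE_I2)
    fix y
    show "norm (complex_of_real y * g y) \<le> norm (g y)"
    proof (cases "y \<in> {0..1}")
      case True
      then show ?thesis by (auto simp: norm_mult intro: mult_left_le_one_le)
    next
      case False
      then show ?thesis using g by (simp add: null_coeffs_def)
    qed
  qed
qed

text \<open>The logarithm is a power series in \<open>circ n y\<close>, each term of which
  integrates to a multiple of a Fourier coefficient of \<open>g\<close>; the factor \<open>r\<close>
  below 1 makes the series converge uniformly.\<close>

lemma null_coeffs_Ln:
  assumes g: "null_coeffs g" and r: "0 \<le> r" "r < 1"
  shows "(LINT y|lborel. Ln (1 - of_real r * circ n y) * g y) = 0"
proof -
  have i: "integrable lborel g" using g by (simp add: null_coeffs_def)
  then have [measurable]: "g \<in> borel_measurable borel" by auto
  \<comment> \<open>For \<open>k = 0\<close> the quotient is 0 by the convention for division by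
    zero, so the series effectively starts at \<open>k = 1\<close>, as the logarithm
    requires.\<close>
  define f where "f = (\<lambda>k y. - ((of_real r * circ n y) ^ k) / of_nat k * g y)"
  have fm[measurable]: "f k \<in> borel_measurable lborel" for k
    unfolding f_def by measurable
  have fle: "norm (f k y) \<le> r ^ k * norm (g y)" for k y
  proof -
    have "norm (f k y) = r ^ k / real k * norm (g y)"
      using r by (simp add: f_def norm_mult norm_divide norm_power)
    also have "\<dots> \<le> r ^ k * norm (g y)"
      by (intro mult_right_mono) (use r in \<open>auto simp: divide_le_eq mult_le_cancel_left1 zero_less_power intro: order.trans[of _ "r^k * 1"]\<close>)
    finally show ?thesis .
  qed
  have fi: "integrable lborel (f k)" for k
  proof (rule Bochner_Integration.integrable_bound)
    show "integrable lborel (\<lambda>y. r ^ k * norm (g y))" using i by simp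
  qed (use fle r in auto)
  have f0: "integral\<^sup>L lborel (f k) = 0" for k
  proof -
    have "integral\<^sup>L lborel (f k) = (LINT y|lborel. - (of_real r ^ k / of_nat k) * (circ (int k * n) y * g y))"
      by (intro Bochner_Integration.integral_cong) (simp_all add: f_def power_mult_distrib circ_power)
    also have "\<dots> = 0" 
      using g by (simp only: Bochner_Integration.integral_mult_right_zero null_coeffs_def) simp
    finally show ?thesis .
  qed
  have sums: "(\<lambda>k. f k y) sums (Ln (1 - of_real r * circ n y) * g y)" for y
  proof -
    have "(\<lambda>k. - ((- (- (of_real r * circ n y))) ^ k) / of_nat k) sums ln (1 + (- (of_real r * circ n y)))"
      by (rule Ln_series') (use r in \<open>simp add: norm_mult\<close>)
    then show ?thesis unfolding f_def by (intro sums_mult2) simp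
  qed
  have sg: "summable (\<lambda>k. r ^ k * c)" for c
    using r by (intro summable_mult2 summable_geometric) auto
  have "(LINT y|lborel. Ln (1 - of_real r * circ n y) * g y) = (LINT y|lborel. (\<Sum>k. f k y))"
    using sums by (simp add: sums_iff)
  also have "\<dots> = (\<Sum>k. integral\<^sup>L lborel (f k))"
  proof (rule integral_suminf[OF fi])
    show "AE y in lborel. summable (\<lambda>k. norm (f k y))"
      by (intro AE_I2 summable_comparison_test'[OF sg]) (use fle in auto)
    show "summable (\<lambda>k. LINT y|lborel. norm (f k y))"
    proof (rule summable_comparison_test'[OF sg])
      fix k
      have "(LINT y|lborel. norm (f k y)) \<le> (LINT y|lborel. r ^ k * norm (g y))"
        using i fle fi by (intro integral_mono) auto
      then show "norm (LINT y|lborel. norm (f k y)) \<le> r ^ k * (LINT y|lborel. norm (g y))" by simp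
    qed
  qed
  finally show ?thesis by (simp add: f0)
qed

text \<open>
  On the unit interval, \<open>\<pi>(y - 1/2)\<close> is the boundedly convergent limit, for \<open>r\<close> tending to 1, of
  \<open>Im (Ln (1 - r circ 1 y))\<close>, which is a uniform limit of trigonometric polynomials. Hence vanishing
  Fourier coefficients force all moments to vanish, and the uniqueness on the line applies.
\<close>

lemma null_coeffs_mult_id_aux:
  assumes g: "null_coeffs g"
  shows "(LINT y|lborel. of_real y * g y) = 0"
proof -
  have i: "integrable lborel g" and g0: "y \<notin> {0..1} \<Longrightarrow> g y = 0" for y 
    using g by (auto simp add: null_coeffs_def)
  have [measurable]: "g \<in> borel_measurable borel" using i by auto
  define r where "r = (\<lambda>k. real k / real (Suc k))"
  have r: "0 \<le> r k" "r k < 1" for k by (auto simp: r_def)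
  have rlim: "r \<longlonglongrightarrow> 1"
    unfolding r_def by (rule LIMSEQ_n_over_Suc_n)
  define h where "h = (\<lambda>k y. of_real (Im (Ln (1 - of_real (r k) * circ 1 y))) * g y)"
  \<comment> \<open>A positive real part keeps the argument away from the branch cut of
    \<open>Ln\<close>, so \<open>Ln\<close> is continuous there and commutes with
    conjugation.\<close>
  have one: "Re (1 - of_real (r k) * circ n y) > 0" for k n y
  proof -
    have "Re (of_real (r k) * circ n y) \<le> norm (of_real (r k) * circ n y)" by (rule complex_Re_le_cmod)
    also have "\<dots> < 1" using r[of k] by (simp add: norm_mult)
    finally show ?thesis by simp
  qed
  have Lm[measurable]: "(\<lambda>y. Ln (1 - of_real (r k) * circ n y)) \<in> borel_measurable borel" for k n
  proof (intro borel_measurable_continuous_onI continuous_intros)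
    show "1 - of_real (r k) * circ n y \<notin> \<real>\<^sub>\<le>\<^sub>0" for y
      using one[of k n y] by (auto simp: complex_nonpos_Reals_iff)
  qed
  have "integral\<^sup>L lborel (h k) = 0" for k
  proof -
    have L: "integrable lborel (\<lambda>y. Ln (1 - of_real (r k) * circ n y) * g y)" for n
    proof (rule Bochner_Integration.integrable_bound)
      show "integrable lborel (\<lambda>y. (- ln (1 - r k) + pi + ln 2) * norm (g y))" using i by simp
      show "(\<lambda>y. Ln (1 - of_real (r k) * circ n y) * g y) \<in> borel_measurable lborel"
        by measurable
      show "AE y in lborel. norm (Ln (1 - of_real (r k) * circ n y) * g y) \<le> norm ((- ln (1 - r k) + pi + ln 2) * norm (g y))"
      proof (intro AE_I2)
        fix y
        define z where "z = 1 - of_real (r k) * circ n y"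
        have "Re z \<noteq> 0" using one[of k n y] unfolding z_def by linarith
        then have z: "z \<noteq> 0" by auto
        have "1 - r k \<le> norm z"
          using norm_triangle_ineq2[of 1 "of_real (r k) * circ n y"] r[of k] by (simp add: z_def norm_mult)
        then have 1: "ln (1 - r k) \<le> ln (norm z)" using r[of k] z by simp
        have "norm z \<le> 2"
          using norm_triangle_ineq4[of 1 "of_real (r k) * circ n y"] r[of k] by (simp add: z_def norm_mult)
        then have 2: "ln (norm z) \<le> ln 2" using z by simp
        have 3: "ln (1 - r k) \<le> 0" using r[of k] by simp
        have 4: "\<bar>Im (Ln z)\<bar> \<le> pi" using z mpi_less_Im_Ln[of z] Im_Ln_le_pi[of z] by simp
        have "norm (Ln z) \<le> \<bar>Re (Ln z)\<bar> + \<bar>Im (Ln z)\<bar>" by (rule cmod_le)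
        also have "\<dots> \<le> - ln (1 - r k) + pi + ln 2"
        proof -
          have "Re (Ln z) = ln (norm z)" "ln (2::real) \<ge> 0" using z by simp_all
          then show ?thesis using 1 2 3 4 by linarith
        qed
        finally show "norm (Ln (1 - of_real (r k) * circ n y) * g y) \<le> norm ((- ln (1 - r k) + pi + ln 2) * norm (g y))"
          unfolding z_def[symmetric] by (simp add: norm_mult abs_mult mult_right_mono)
      qed
    qed
    \<comment> \<open>The conjugate of \<open>circ 1 y\<close> is \<open>circ (-1) y\<close>, so the
      imaginary part is a combination of two logarithms to which \<open>null_coeffs_Ln\<close>
      applies.\<close>
    have "integral\<^sup>L lborel (h k) = (LINT y|lborel. (Ln (1 - of_real (r k) * circ 1 y) * g y
         - Ln (1 - of_real (r k) * circ (-1) y) * g y) / (2 * \<i>))"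
    proof (intro Bochner_Integration.integral_cong refl)
      fix y
      define z where "z = 1 - of_real (r k) * circ 1 y"
      have "z \<notin> \<real>\<^sub>\<le>\<^sub>0" using one[of k 1 y] by (auto simp: z_def complex_nonpos_Reals_iff)
      then have "Ln (1 - of_real (r k) * circ (-1) y) = cnj (Ln z)"
        by (subst cnj_Ln) (simp_all add: z_def)
      moreover have "complex_of_real (Im (Ln z)) = (Ln z - cnj (Ln z)) / (2 * \<i>)" by (simp add: complex_eq_iff)
      ultimately show "h k y = (Ln (1 - of_real (r k) * circ 1 y) * g y
         - Ln (1 - of_real (r k) * circ (-1) y) * g y) / (2 * \<i>)"
        by (simp add: h_def z_def[symmetric] left_diff_distrib[symmetric])
    qed
    also have "\<dots> = 0"
      using null_coeffs_Ln[OF g r, of k] by (simp add: Bochner_Integration.integral_diff[OF L L])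
    finally show ?thesis .
  qed
  moreover have "(\<lambda>k. integral\<^sup>L lborel (h k)) \<longlonglongrightarrow> (LINT y|lborel. of_real (pi * (y - 1/2)) * g y)"
  proof (rule integral_dominated_convergence)
    show "integrable lborel (\<lambda>y. pi * norm (g y))" using i by simp
    show "h k \<in> borel_measurable lborel" for k unfolding h_def by measurable
    show "(\<lambda>y. of_real (pi * (y - 1/2)) * g y) \<in> borel_measurable lborel" by measurable
    show "AE y in lborel. norm (h k y) \<le> pi * norm (g y)" for k
    proof (intro AE_I2)
      fix y
      have z: "1 - of_real (r k) * circ 1 y \<noteq> 0"
      proof
        assume "1 - of_real (r k) * circ 1 y = 0"
        then show False using one[of k 1 y] by (metis less_irrefl zero_complex.sel(1))
      qed
      then have "\<bar>Im (Ln (1 - of_real (r k) * circ 1 y))\<bar> \<le> pi"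
        using mpi_less_Im_Ln[OF z] Im_Ln_le_pi[OF z] by simp
      then show "norm (h k y) \<le> pi * norm (g y)" by (simp add: h_def norm_mult mult_right_mono)
    qed
    \<comment> \<open>At the endpoints \<open>circ 1 y\<close> is 1: the limiting logarithm is
      singular and the sawtooth jumps.\<close>
    have "AE y in lborel. y \<noteq> (0::real)" "AE y in lborel. y \<noteq> (1::real)" by (rule AE_lborel_singleton)+
    then show "AE y in lborel. (\<lambda>k. h k y) \<longlonglongrightarrow> of_real (pi * (y - 1/2)) * g y"
    proof eventually_elim
      case (elim y)
      show ?case
      proof (cases "y \<in> {0..1}")
        case True
        with elim have y: "0 < y" "y < 1" by auto
        have "1 - circ 1 y \<notin> \<real>\<^sub>\<le>\<^sub>0"
        proof
          assume "1 - circ 1 y \<in> \<real>\<^sub>\<le>\<^sub>0"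
          then have "Im (circ 1 y) = 0" "Re (circ 1 y) \<ge> 1" by (auto simp: complex_nonpos_Reals_iff)
          moreover have "circ 1 y = cis (2 * (pi * y))" by (simp add: circ_def cis_conv_exp mult_ac)
          moreover have "sin (pi * y) > 0" using y by (intro sin_gt_zero) auto
          ultimately show False by (simp add: cos_double_sin power2_eq_square mult_le_0_iff)
        qed
        then have "(\<lambda>k. Ln (1 - of_real (r k) * circ 1 y)) \<longlonglongrightarrow> Ln (1 - of_real 1 * circ 1 y)"
          by (intro tendsto_Ln tendsto_intros rlim) simp
        then have "(\<lambda>k. h k y) \<longlonglongrightarrow> of_real (Im (Ln (1 - of_real 1 * circ 1 y))) * g y"
          unfolding h_def by (intro tendsto_mult tendsto_of_real tendsto_Im) auto
        then show ?thesis using Im_Ln_one_minus_circ[OF y] by simp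
      qed (simp add: h_def g0)
    qed
  qed
  ultimately have "(LINT y|lborel. of_real (pi * (y - 1/2)) * g y) = 0"
    by (simp add: LIMSEQ_const_iff)
  moreover have iy: "integrable lborel (\<lambda>y. of_real y * g y)"
    by (rule null_coeffs_integrable_id[OF g])
  have "(LINT y|lborel. of_real (pi * (y - 1/2)) * g y) = 
      (LINT y|lborel. of_real pi * (of_real y * g y) - of_real (pi / 2) * g y)"
    by (intro Bochner_Integration.integral_cong) (auto simp: algebra_simps)
  also have "\<dots> = of_real pi * (LINT y|lborel. of_real y * g y) - of_real (pi / 2) * (LINT y|lborel. g y)"
    using i iy by simp
  also have "(LINT y|lborel. g y) = 0" using g unfolding null_coeffs_def by (metis (no_types, lifting) Bochner_Integration.integral_cong circ_0 mult_1)
  ultimately show ?thesis by simp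
qed

text \<open>The vanishing of one mean suffices: replacing \<open>g y\<close> by
  \<open>circ m y * g y\<close>, again in the class, turns the m-th coefficient into such a
  mean.\<close>

lemma null_coeffs_mult_id:
  assumes g: "null_coeffs g"
  shows "null_coeffs (\<lambda>y. of_real y * g y)"
proof -
  have g0: "y \<notin> {0..1} \<Longrightarrow> g y = 0" for y 
    using g by (auto simp add: null_coeffs_def)
  show ?thesis
    using null_coeffs_integrable_id[OF g]
    using g0 null_coeffs_mult_id_aux[OF null_coeffs_circ[OF g]]
    by (auto simp: null_coeffs_def mult_ac)
qed

text \<open>Multiplication by powers of y keeps all coefficients zero, hence all moments vanish;
  bounded support supplies the exponential integrability required by
  \<open>moments_unique\<close>.\<close>

lemma circle_unique:
  fixes f :: "real \<Rightarrow> complex"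
  assumes "set_integrable lborel {0..1} f"
    and "\<And>n. (LINT y:{0..1}|lborel. circ n y * f y) = 0"
  shows "AE y in lborel. y \<in> {0..1} \<longrightarrow> f y = 0"
proof -
  define g where "g = (\<lambda>y. indicator {0..1} y *\<^sub>R f y)"
  have i: "integrable lborel g" using assms(1) by (simp add: g_def set_integrable_def)
  then have [measurable]: "g \<in> borel_measurable borel" by auto
  have "null_coeffs g"
    using assms i by (simp add: null_coeffs_def g_def set_lebesgue_integral_def)
  then have nk: "null_coeffs (\<lambda>y. of_real y ^ k * g y)" for k
  proof (induction k)
    case (Suc k)
    then show ?case using null_coeffs_mult_id[of "\<lambda>y. of_real y ^ k * g y"] by (simp add: mult.assoc)
  qed simp
  have "AE y in lborel. g y = 0"
  proof (rule moments_unique)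
    fix t :: real
    show "integrable lborel (\<lambda>x. exp (t * \<bar>x\<bar>) *\<^sub>R g x)"
    proof (rule Bochner_Integration.integrable_bound)
      show "integrable lborel (\<lambda>x. exp \<bar>t\<bar> * norm (g x))" using i by simp
      show "AE x in lborel. norm (exp (t * \<bar>x\<bar>) *\<^sub>R g x) \<le> norm (exp \<bar>t\<bar> * norm (g x))"
      proof (rule AE_I2)
        fix x :: real
        have "t * \<bar>x\<bar> \<le> \<bar>t\<bar>" if "x \<in> {0..1}"
        proof -
          have "t * \<bar>x\<bar> \<le> \<bar>t\<bar> * 1" by (intro mult_mono) (use that in auto)
          then show ?thesis by simp
        qed
        then show "norm (exp (t * \<bar>x\<bar>) *\<^sub>R g x) \<le> norm (exp \<bar>t\<bar> * norm (g x))"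
          by (auto simp: g_def indicator_def mult_right_mono)
      qed
    qed measurable
    show "(LINT x|lborel. of_real x ^ k * g x) = 0" for k
    proof -
      have "(LINT x|lborel. circ 0 x * (of_real x ^ k * g x)) = 0"
        using nk[of k] by (simp only: null_coeffs_def)
      then show ?thesis by simp
    qed
  qed
  then show ?thesis by (rule AE_mp) (auto simp: g_def indicator_def)
qed

section \<open>Theta sections\<close>

text \<open>With B = 2\<pi>N the exponential is exp (- B x^2 / 2), the ground state of - d^2/dx^2 +
  B^2 x^2. Such functions are closed under differentiation and multiplication by x, so both become
  operations on polynomials.\<close>

definition gauss_poly :: "nat \<Rightarrow> complex poly \<Rightarrow> real \<Rightarrow> complex" where
  "gauss_poly N p x = poly p (of_real x) * of_real (exp (- (pi * real N * x\<^sup>2)))"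

lemma gauss_poly_add: "gauss_poly N (p + q) x = gauss_poly N p x + gauss_poly N q x"
  and gauss_poly_smult: "gauss_poly N (smult c p) x = c * gauss_poly N p x"
  and gauss_poly_mult_X: "gauss_poly N ([:0, 1:] * p) x = of_real x * gauss_poly N p x"
  by (simp_all add: gauss_poly_def algebra_simps)

lemma norm_gauss_poly: "norm (gauss_poly N p x) = norm (poly p (of_real x)) * exp (- (pi * real N * x\<^sup>2))"
  by (simp only: gauss_poly_def norm_mult norm_of_real abs_exp_cancel)

lemma continuous_on_gauss_poly [continuous_intros]:
  "continuous_on A f \<Longrightarrow> continuous_on A (\<lambda>x. gauss_poly N p (f x))"
  unfolding gauss_poly_def by (intro continuous_intros)

lemma gauss_poly_measurable [measurable]: "gauss_poly N p \<in> borel_measurable borel"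
  by (intro borel_measurable_continuous_onI continuous_intros)

lemma poly_exp_bound:
  obtains K k where "K \<ge> 0" "k \<ge> 0" "\<And>x::real. norm (poly p (of_real x :: complex)) \<le> K * exp (k * \<bar>x\<bar>)"
proof -
  have "\<exists>K k. K \<ge> 0 \<and> k \<ge> 0 \<and> (\<forall>x::real. norm (poly p (of_real x :: complex)) \<le> K * exp (k * \<bar>x\<bar>))"
  proof (induction p)
    case 0
    show ?case by (intro exI[of _ 0]) simp
  next
    case (pCons a p)
    then obtain K k where K: "K \<ge> 0" "k \<ge> 0" "\<And>x::real. norm (poly p (of_real x :: complex)) \<le> K * exp (k * \<bar>x\<bar>)"
      by blast
    have "norm (poly (pCons a p) (of_real x :: complex)) \<le> (norm a + K) * exp ((1 + k) * \<bar>x\<bar>)" for x :: real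
    proof -
      have "norm (poly (pCons a p) (of_real x :: complex)) \<le> norm a + \<bar>x\<bar> * norm (poly p (of_real x :: complex))"
        by (simp add: norm_triangle_le norm_mult)
      also have "\<dots> \<le> norm a * exp ((1 + k) * \<bar>x\<bar>) + exp \<bar>x\<bar> * (K * exp (k * \<bar>x\<bar>))"
      proof (intro add_mono mult_mono K)
        have "1 \<le> exp ((1 + k) * \<bar>x\<bar>)" using K by simp
        then show "norm a \<le> norm a * exp ((1 + k) * \<bar>x\<bar>)" by (simp add: mult_le_cancel_left1)
        show "\<bar>x\<bar> \<le> exp \<bar>x\<bar>" using exp_ge_add_one_self[of "\<bar>x\<bar>"] by linarith
      qed auto
      finally show ?thesis by (simp add: algebra_simps exp_add)
    qed
    then show ?case using K by (intro exI[of _ "norm a + K"] exI[of _ "1 + k"]) auto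
  qed
  then show ?thesis using that by blast
qed

lemma gauss_poly_decay:
  assumes N: "N \<ge> 1"
  obtains C where "C \<ge> 0" "\<And>x. norm (gauss_poly N p x) * exp (t * \<bar>x\<bar>) \<le> C / (1 + x\<^sup>2)"
proof -
  obtain K k where K: "K \<ge> 0" "k \<ge> 0" "\<And>x::real. norm (poly p (of_real x :: complex)) \<le> K * exp (k * \<bar>x\<bar>)"
    using poly_exp_bound by blast
  define B where "B = pi * real N"
  have B: "B > 0" using N by (simp add: B_def)
  \<comment> \<open>The summand 2 accounts for 1 + x^2, \<open>k\<close> for the polynomial and
    \<open>t\<close> for the exponential weight.\<close>
  define c where "c = 2 + k + t"
  define C where "C = 2 * K * exp (c\<^sup>2 / (4 * B))"
  have "norm (gauss_poly N p x) * exp (t * \<bar>x\<bar>) \<le> C / (1 + x\<^sup>2)" for x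
  proof -
    have "\<bar>x\<bar> \<le> exp \<bar>x\<bar>" using exp_ge_add_one_self[of "\<bar>x\<bar>"] by linarith
    then have "\<bar>x\<bar> ^ 2 \<le> exp \<bar>x\<bar> ^ 2" by (intro power_mono) auto
    then have x2: "x\<^sup>2 \<le> exp (2 * \<bar>x\<bar>)" by (simp flip: exp_of_nat_mult)
    have "1 \<le> exp (2 * \<bar>x\<bar>)" by simp
    with x2 have x3: "1 + x\<^sup>2 \<le> 2 * exp (2 * \<bar>x\<bar>)" by linarith
    \<comment> \<open>Completing the square bounds c |x| - B x^2 by c^2 / (4B).\<close>
    have "0 \<le> B * (\<bar>x\<bar> - c / (2 * B))\<^sup>2" using B by simp
    also have "\<dots> = B * x\<^sup>2 - c * \<bar>x\<bar> + c\<^sup>2 / (4 * B)"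
      using B by (simp add: power2_eq_square field_simps)
    finally have e: "c * \<bar>x\<bar> - B * x\<^sup>2 \<le> c\<^sup>2 / (4 * B)" by simp
    have "(1 + x\<^sup>2) * (norm (gauss_poly N p x) * exp (t * \<bar>x\<bar>)) = 
      (1 + x\<^sup>2) * norm (poly p (of_real x :: complex)) * exp (- B * x\<^sup>2 + t * \<bar>x\<bar>)"
      unfolding norm_gauss_poly exp_add B_def by simp
    also have "\<dots> \<le> (2 * exp (2 * \<bar>x\<bar>)) * (K * exp (k * \<bar>x\<bar>)) * exp (- B * x\<^sup>2 + t * \<bar>x\<bar>)"
      by (intro mult_mono K) (use x3 K in auto)
    also have "\<dots> = 2 * K * exp (c * \<bar>x\<bar> - B * x\<^sup>2)"
      by (simp add: c_def algebra_simps exp_add exp_diff exp_minus)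
    also have "\<dots> \<le> C" unfolding C_def using e K by (intro mult_left_mono) auto
    finally show ?thesis by (simp add: pos_le_divide_eq add_pos_nonneg mult_ac)
  qed
  moreover have "C \<ge> 0" using K by (simp add: C_def)
  ultimately show ?thesis using that by blast
qed

definition gauss_poly_deriv :: "nat \<Rightarrow> complex poly \<Rightarrow> complex poly" where
  "gauss_poly_deriv N p = pderiv p - smult (of_real (2 * pi * real N)) ([:0, 1:] * p)"

lemma gauss_poly_has_vector_derivative:
  "(gauss_poly N p has_vector_derivative gauss_poly N (gauss_poly_deriv N p) x) (at x)"
proof -
  have "((\<lambda>z. poly p z * exp (- (of_real (pi * real N) * z\<^sup>2))) has_field_derivative
      (poly (pderiv p) (of_real x) - 2 * of_real (pi * real N) * of_real x * poly p (of_real x)) * exp (- (of_real (pi * real N) * (of_real x)\<^sup>2))) (at (of_real x))"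
    by (auto intro!: derivative_eq_intros simp: algebra_simps)
  from has_vector_derivative_real_field[OF this] show ?thesis
    by (simp add: gauss_poly_def[abs_def] gauss_poly_deriv_def algebra_simps exp_of_real[symmetric])
qed

text \<open>The Gaussian is centred at n / N, where the potential 2\<pi>Nx equals the frequency
  2\<pi>n of the character and the covariant y-derivative vanishes.\<close>

definition mode :: "nat \<Rightarrow> complex poly \<Rightarrow> int \<Rightarrow> real \<times> real \<Rightarrow> complex" where
  "mode N p n = (\<lambda>(x, y). gauss_poly N p (x - of_int n / real N) * circ n y)"

text \<open>Writing n = N(x - (x - n/N)) trades the factor n, different in every mode, for the
  global coordinate x and a multiplication by the polynomial variable. Derivatives of modes are then
  expressed by modes with the same index, and can be summed.\<close>

lemma mode_has_derivative:
  assumes N: "N \<ge> 1"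
  shows "(mode N p n has_derivative (\<lambda>h. of_real (fst h) * mode N (gauss_poly_deriv N p) n (x, y) +
     of_real (snd h) * (\<i> * of_real (2 * pi * real N) * 
        (of_real x * mode N p n (x, y) - mode N ([:0, 1:] * p) n (x, y))))) (at (x, y))"
proof -
  define a where "a = of_int n / real N"
  have "((\<lambda>z. exp (2 * of_real pi * \<i> * of_int n * z)) has_field_derivative 
     (2 * of_real pi * \<i> * of_int n) * circ n y) (at (of_real y))"
    by (auto intro!: derivative_eq_intros simp: circ_def)
  from has_vector_derivative_real_field[OF this]
  have c: "(circ n has_vector_derivative (2 * of_real pi * \<i> * of_int n) * circ n y) (at y)"
    by (simp add: circ_def[abs_def])
  have n: "complex_of_int n = of_real (real N * (x - (x - a)))" using N by (simp add: a_def)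
  have 1: "((\<lambda>z. circ n (snd z)) has_derivative (\<lambda>h. snd h *\<^sub>R ((2 * of_real pi * \<i> * of_int n) * circ n y))) (at (x, y))"
    using has_derivative_compose[OF has_derivative_snd[OF has_derivative_ident], of "circ n" _ "(x, y)" UNIV] c
    by (simp add: has_vector_derivative_def)
  have 2: "((\<lambda>z. gauss_poly N p (fst z - a)) has_derivative (\<lambda>h. fst h *\<^sub>R gauss_poly N (gauss_poly_deriv N p) (x - a))) (at (x, y))"
  proof (rule has_derivative_compose[where f = "\<lambda>z. fst z - a" and f' = fst and g = "gauss_poly N p"
        and g' = "\<lambda>h. h *\<^sub>R gauss_poly N (gauss_poly_deriv N p) (x - a)"])
    show "((\<lambda>z. fst z - a) has_derivative fst) (at (x, y))" by (auto intro!: derivative_eq_intros)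
    show "(gauss_poly N p has_derivative (\<lambda>h. h *\<^sub>R gauss_poly N (gauss_poly_deriv N p) (x - a))) (at (fst (x, y) - a))"
      using gauss_poly_has_vector_derivative[of N p "x - a"] by (simp add: has_vector_derivative_def)
  qed
  have "((\<lambda>z. gauss_poly N p (fst z - a) * circ n (snd z)) has_derivative (\<lambda>h. of_real (fst h) * mode N (gauss_poly_deriv N p) n (x, y) +
     of_real (snd h) * (\<i> * of_real (2 * pi * real N) * 
        (of_real x * mode N p n (x, y) - mode N ([:0, 1:] * p) n (x, y))))) (at (x, y))"
    by (rule has_derivative_eq_rhs[OF has_derivative_mult[OF 2 1]], rule ext)
      (unfold n, simp add: mode_def gauss_poly_mult_X a_def[symmetric] scaleR_conv_of_real del: mult_pCons_left, simp_all add: algebra_simps)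
  then show ?thesis by (simp add: mode_def case_prod_unfold a_def)
qed

section \<open>Convergence of sums of modes\<close>

lemma int_decode_ge: "real i \<le> 2 * \<bar>of_int (int_decode i)\<bar>"
proof -
  obtain j where i: "i = int_encode j" by (metis int_decode_inverse)
  have "int i \<le> 2 * \<bar>j\<bar>" by (simp add: i int_encode_def sum_encode_def)
  then show ?thesis by (simp add: i)
qed

text \<open>
  Sums over the integers are enumerated by \<^const>\<open>int_decode\<close>, since the differentiation theorem for
  series is stated for sums over the natural numbers.
\<close>

definition cell_weight :: "nat \<Rightarrow> real" where
  "cell_weight i = 1 / (1 + (of_int (int_decode i))\<^sup>2)"

lemma cell_weight_pos: "cell_weight i > 0"
  by (simp add: cell_weight_def add_pos_nonneg)

lemma summable_cell_weight: "summable cell_weight"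
proof -
  have "summable (\<lambda>n. inverse (real (Suc n) ^ 2))"
    using inverse_power_summable[of 2, where 'a = real] by (subst summable_Suc_iff) simp
  then have s: "summable (\<lambda>k. 8 * inverse (real (Suc k) ^ 2))" by (rule summable_mult)
  show ?thesis
  proof (rule summable_comparison_test'[OF s])
    fix i
    have "(real i)\<^sup>2 \<le> (2 * \<bar>of_int (int_decode i)\<bar>)\<^sup>2" by (intro power_mono int_decode_ge) simp
    then have "(real i)\<^sup>2 \<le> 4 * (of_int (int_decode i))\<^sup>2" by (simp add: power_mult_distrib)
    moreover have "(real (Suc i))\<^sup>2 \<le> 2 * (real i)\<^sup>2 + 2"
      using zero_le_power2[of "real i - 1"] by (simp add: power2_eq_square algebra_simps)
    ultimately have "(real (Suc i))\<^sup>2 \<le> 8 * (1 + (of_int (int_decode i))\<^sup>2)"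
      by (elim order.trans) simp
    then have "cell_weight i \<le> 8 * inverse (real (Suc i) ^ 2)" unfolding cell_weight_def
      by (simp add: field_simps add_pos_nonneg)
    then show "norm (cell_weight i) \<le> 8 * inverse (real (Suc i) ^ 2)" using cell_weight_pos[of i] by simp
  qed
qed

definition mode_index :: "nat \<Rightarrow> int \<Rightarrow> nat \<Rightarrow> int" where
  "mode_index N m i = m + int_decode i * int N"

text \<open>A Peetre-type inequality: a translation by at most \<open>R\<close> costs only a
  constant factor, because j^2 \<le> 2s^2 + 2(s - j)^2.\<close>

lemma decay_shift_le:
  fixes s j R :: real
  assumes "\<bar>s\<bar> \<le> R"
  shows "1 / (1 + (s - j)\<^sup>2) \<le> 2 * (1 + R\<^sup>2) / (1 + j\<^sup>2)"
proof -
  have s: "s\<^sup>2 \<le> R\<^sup>2" using assms by (rule abs_le_square_iff[THEN iffD1, OF order.trans]) simp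
  have "j\<^sup>2 \<le> 2 * s\<^sup>2 + 2 * (s - j)\<^sup>2"
    using zero_le_power2[of "2 * s - j"] by (simp add: power2_eq_square algebra_simps)
  then have "1 + j\<^sup>2 \<le> 2 * (1 + R\<^sup>2) * 1 + 2 * (s - j)\<^sup>2" using s by simp
  also have "\<dots> \<le> 2 * (1 + R\<^sup>2) * 1 + 2 * (1 + R\<^sup>2) * (s - j)\<^sup>2"
    by (intro add_left_mono mult_right_mono) auto
  finally have "1 + j\<^sup>2 \<le> 2 * (1 + R\<^sup>2) * (1 + (s - j)\<^sup>2)" by (simp add: algebra_simps)
  then show ?thesis by (simp add: divide_simps add_pos_nonneg mult_ac)
qed

text \<open>The character has modulus 1 and the mode is centred at m/N + j with j =
  \<open>int_decode i\<close>, so its decay gives a summable weight that is uniform on vertical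
  strips.\<close>

lemma mode_bound:
  assumes N: "N \<ge> 1"
  obtains C where "C \<ge> 0" "\<And>x y i. \<bar>x\<bar> \<le> R \<Longrightarrow> norm (mode N p (mode_index N m i) (x, y)) \<le> C * cell_weight i"
proof -
  obtain C where C: "C \<ge> 0" "\<And>x. norm (gauss_poly N p x) * exp (0 * \<bar>x\<bar>) \<le> C / (1 + x\<^sup>2)"
    using gauss_poly_decay[OF N] by blast
  define R' where "R' = R + \<bar>of_int m / real N\<bar>"
  have "norm (mode N p (mode_index N m i) (x, y)) \<le> C * (2 * (1 + R'\<^sup>2)) * cell_weight i" if "\<bar>x\<bar> \<le> R" for x y i
  proof -
    define s where "s = x - of_int m / real N"
    have "x - of_int (mode_index N m i) / real N = s - of_int (int_decode i)"
      using N by (simp add: mode_index_def s_def field_simps)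
    then have "norm (mode N p (mode_index N m i) (x, y)) = norm (gauss_poly N p (s - of_int (int_decode i)))"
      by (simp add: mode_def norm_mult)
    also have "\<dots> \<le> C * (1 / (1 + (s - of_int (int_decode i))\<^sup>2))" using C(2) by simp
    also have "\<dots> \<le> C * (2 * (1 + R'\<^sup>2) / (1 + (of_int (int_decode i))\<^sup>2))"
      using that abs_triangle_ineq4[of x "of_int m / real N"]
      by (intro mult_left_mono decay_shift_le C(1)) (simp add: s_def R'_def)
    finally show ?thesis by (simp add: cell_weight_def)
  qed
  moreover have "C * (2 * (1 + R'\<^sup>2)) \<ge> 0" using C(1) by simp
  ultimately show ?thesis using that by blast
qed

text \<open>For constant \<open>p\<close> this is, up to a Gaussian factor in x, a theta function of
  level \<open>N\<close> with characteristic m / N. The unordered sum over the integers makes index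
  shifts immediate, which gives quasi-periodicity and dependence on \<open>m\<close> modulo
  \<open>N\<close> only.\<close>

definition theta :: "nat \<Rightarrow> complex poly \<Rightarrow> int \<Rightarrow> real \<times> real \<Rightarrow> complex" where
  "theta N p m z = (\<Sum>\<^sub>\<infinity>j. mode N p (m + j * int N) z)"

lemma theta_summable:
  assumes N: "N \<ge> 1"
  shows "summable (\<lambda>i. norm (mode N p (mode_index N m i) z))"
proof -
  obtain C where "C \<ge> 0" "\<And>x y i. \<bar>x\<bar> \<le> \<bar>fst z\<bar> \<Longrightarrow> norm (mode N p (mode_index N m i) (x, y)) \<le> C * cell_weight i"
    using mode_bound[OF N] by blast
  then have "norm (norm (mode N p (mode_index N m i) z)) \<le> C * cell_weight i" for i
    by (cases z) simp
  then show ?thesis by (intro summable_comparison_test'[OF summable_mult[OF summable_cell_weight]])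
qed

lemma theta_sums:
  assumes N: "N \<ge> 1"
  shows "(\<lambda>i. mode N p (mode_index N m i) z) sums theta N p m z"
proof -
  have s: "(\<lambda>i. mode N p (mode_index N m i) z) sums (\<Sum>i. mode N p (mode_index N m i) z)"
    by (rule summable_sums[OF summable_norm_cancel[OF theta_summable[OF N]]])
  then have "((\<lambda>i. mode N p (mode_index N m i) z) has_sum (\<Sum>i. mode N p (mode_index N m i) z)) UNIV"
    by (intro norm_summable_imp_has_sum theta_summable N)
  then have "((\<lambda>j. mode N p (m + j * int N) z) has_sum (\<Sum>i. mode N p (mode_index N m i) z)) UNIV"
    unfolding mode_index_def 
    by (subst (asm) has_sum_reindex_bij_betw[OF bij_int_decode, of "\<lambda>j. mode N p (m + j * int N) z"])
  with s show ?thesis unfolding theta_def by (metis infsumI)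
qed

lemma theta_uniform_limit:
  fixes R :: real
  assumes N: "N \<ge> 1"
  shows "uniform_limit ({- R .. R} \<times> UNIV) (\<lambda>n z. \<Sum>i<n. mode N p (mode_index N m i) z) (theta N p m) sequentially"
proof -
  obtain C where C: "C \<ge> 0" "\<And>x y i. \<bar>x\<bar> \<le> R \<Longrightarrow> norm (mode N p (mode_index N m i) (x, y)) \<le> C * cell_weight i"
    using mode_bound[OF N, where R = R and p = p and m = m] by blast
  have "uniform_limit ({- R .. R} \<times> UNIV) (\<lambda>n z. \<Sum>i<n. mode N p (mode_index N m i) z) (\<lambda>z. \<Sum>i. mode N p (mode_index N m i) z) sequentially"
    by (rule Weierstrass_m_test[OF _ summable_mult[OF summable_cell_weight, of C]]) (auto intro!: C(2))
  moreover have "(\<lambda>z. \<Sum>i. mode N p (mode_index N m i) z) = theta N p m"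
    using sums_unique[OF theta_sums[OF N]] by (intro ext) simp
  ultimately show ?thesis by simp
qed

lemma theta_has_derivative:
  assumes N: "N \<ge> 1"
  shows "(theta N p m has_derivative (\<lambda>h. of_real (fst h) * theta N (gauss_poly_deriv N p) m z +
     of_real (snd h) * (\<i> * of_real (2 * pi * real N) * 
        (of_real (fst z) * theta N p m z - theta N ([:0, 1:] * p) m z)))) (at z)"
proof -
  \<comment> \<open>The derivative contains x as a factor, so convergence is controlled on vertical
    strips; this one is an open convex neighbourhood of \<open>z\<close>.\<close>
  define R where "R = \<bar>fst z\<bar> + 1"
  define S :: "(real \<times> real) set" where "S = {- R <..< R} \<times> UNIV"
  define f' where "f' = (\<lambda>i z h. of_real (fst h) * mode N (gauss_poly_deriv N p) (mode_index N m i) z +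
     of_real (snd h) * (\<i> * of_real (2 * pi * real N) * 
        (of_real (fst z) * mode N p (mode_index N m i) z - mode N ([:0, 1:] * p) (mode_index N m i) z)))"
  define g' where "g' = (\<lambda>z h. of_real (fst h) * theta N (gauss_poly_deriv N p) m z +
     of_real (snd h) * (\<i> * of_real (2 * pi * real N) * 
        (of_real (fst z) * theta N p m z - theta N ([:0, 1:] * p) m z)))"
  have zS: "z \<in> S" by (cases z) (auto simp: S_def R_def)
  have oS: "open S" unfolding S_def by (intro open_Times) auto
  have "\<exists>g. \<forall>z\<in>S. (\<lambda>i. mode N p (mode_index N m i) z) sums g z \<and> (g has_derivative g' z) (at z within S)"
  proof (rule has_derivative_series[OF _ _ _ zS theta_sums[OF N]])
    show "convex S" unfolding S_def by (intro convex_Times) auto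
    show "(mode N p (mode_index N m i) has_derivative f' i z) (at z within S)" for i z
      using mode_has_derivative[OF N, of p "mode_index N m i" "fst z" "snd z"]
      by (simp add: f'_def has_derivative_at_withinI)
    fix e :: real assume e: "e > 0"
    \<comment> \<open>The sum of the bounds 1, 2\<pi>NR and 2\<pi>N for the coefficients with which
      the errors of the three series enter the derivative.\<close>
    define K where "K = 1 + 2 * pi * real N * R + 2 * pi * real N"
    have K: "K > 0" unfolding K_def R_def by (intro add_pos_nonneg) auto
    have ev: "\<forall>\<^sub>F n in sequentially. \<forall>w\<in>{- R..R} \<times> UNIV. 
       dist (\<Sum>i<n. mode N q (mode_index N m i) w) (theta N q m w) < e / K" for q
      using theta_uniform_limit[OF N, where R = R and p = q and m = m] e K unfolding uniform_limit_iff by auto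
    show "\<forall>\<^sub>F n in sequentially. \<forall>w\<in>S. \<forall>h. norm ((\<Sum>i<n. f' i w h) - g' w h) \<le> e * norm h"
      using ev[of "gauss_poly_deriv N p"] ev[of p] ev[of "[:0, 1:] * p"]
    proof eventually_elim
      case (elim n)
      show ?case
      proof (intro ballI allI)
        fix w h assume w: "w \<in> S"
        define d where "d = (\<lambda>q. (\<Sum>i<n. mode N q (mode_index N m i) w) - theta N q m w)"
        have wR: "w \<in> {- R..R} \<times> UNIV" and w1: "\<bar>fst w\<bar> \<le> R" using w by (auto simp: S_def)
        have d: "norm (d (gauss_poly_deriv N p)) \<le> e / K" "norm (d p) \<le> e / K" "norm (d ([:0, 1:] * p)) \<le> e / K"
          using elim wR unfolding d_def by (auto simp: dist_norm intro: less_imp_le)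
        have h: "\<bar>fst h\<bar> \<le> norm h" "\<bar>snd h\<bar> \<le> norm h"
          using norm_fst_le[of h] norm_snd_le[of h] by (simp_all add: norm_prod_def)
        have "(\<Sum>i<n. f' i w h) - g' w h = of_real (fst h) * d (gauss_poly_deriv N p) +
          of_real (snd h) * (\<i> * of_real (2 * pi * real N) * (of_real (fst w) * d p - d ([:0, 1:] * p)))"
          by (simp only: f'_def g'_def d_def sum.distrib sum_subtractf sum_distrib_left[symmetric])
             (simp only: algebra_simps)
        also have "norm \<dots> \<le> \<bar>fst h\<bar> * norm (d (gauss_poly_deriv N p)) +
           \<bar>snd h\<bar> * (2 * pi * real N * (\<bar>fst w\<bar> * norm (d p) + norm (d ([:0, 1:] * p))))"
          using norm_triangle_ineq4[of "of_real (fst w) * d p" "d ([:0, 1:] * p)"]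
          by (intro order.trans[OF norm_triangle_ineq])
             (simp add: norm_mult mult_left_mono mult.assoc del: mult_pCons_left)
        also have "\<dots> \<le> norm h * (e / K) + norm h * (2 * pi * real N * (R * (e / K) + e / K))"
          using h d w1 by (intro add_mono mult_mono) (auto simp: R_def)
        also have "norm h * q + norm h * (2 * pi * real N * (R * q + q)) = norm h * q * K" for q
          unfolding K_def by (simp add: algebra_simps)
        finally show "norm ((\<Sum>i<n. f' i w h) - g' w h) \<le> e * norm h" using K by (simp add: mult.commute)
      qed
    qed
  qed
  then obtain g where g: "\<And>z. z \<in> S \<Longrightarrow> (\<lambda>i. mode N p (mode_index N m i) z) sums g z"
     "\<And>z. z \<in> S \<Longrightarrow> (g has_derivative g' z) (at z within S)" by blast
  have eq: "g w = theta N p m w" if "w \<in> S" for w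
    by (rule sums_unique2[OF g(1)[OF that] theta_sums[OF N]])
  have "(g has_derivative g' z) (at z)" using g(2)[OF zS] by (simp only: at_within_open[OF zS oS])
  then have "(theta N p m has_derivative g' z) (at z)"
    by (rule has_derivative_transform_within_open[OF _ oS zS]) (use eq in auto)
  then show ?thesis by (simp add: g'_def)
qed

lemma theta_smult:
  assumes N: "N \<ge> 1"
  shows "theta N (smult c p) m z = c * theta N p m z"
proof -
  have "(\<lambda>i. c * mode N p (mode_index N m i) z) sums (c * theta N p m z)"
    by (rule sums_mult[OF theta_sums[OF N]])
  moreover have "(\<lambda>i. c * mode N p (mode_index N m i) z) = (\<lambda>i. mode N (smult c p) (mode_index N m i) z)"
    by (cases z) (simp add: mode_def gauss_poly_smult mult.assoc)
  ultimately show ?thesis using sums_unique2[OF theta_sums[OF N]] by metis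
qed

lemma theta_add:
  assumes N: "N \<ge> 1"
  shows "theta N (p + q) m z = theta N p m z + theta N q m z"
proof -
  have "(\<lambda>i. mode N p (mode_index N m i) z + mode N q (mode_index N m i) z) sums (theta N p m z + theta N q m z)"
    by (rule sums_add[OF theta_sums[OF N] theta_sums[OF N]])
  moreover have "(\<lambda>i. mode N p (mode_index N m i) z + mode N q (mode_index N m i) z) = (\<lambda>i. mode N (p + q) (mode_index N m i) z)"
    by (cases z) (simp add: mode_def gauss_poly_add distrib_right)
  ultimately show ?thesis using sums_unique2[OF theta_sums[OF N]] by metis
qed

section \<open>Smoothness of theta sections\<close>

lemma partials:
  assumes "(u has_derivative (\<lambda>h. of_real (fst h) * a + of_real (snd h) * b)) (at (x, y))"
  shows "((\<lambda>s. u (s, y)) has_vector_derivative a) (at x)"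
    and "((\<lambda>s. u (x, s)) has_vector_derivative b) (at y)"
    and "partial_x u (x, y) = a" and "partial_y u (x, y) = b"
proof -
  have "((\<lambda>s. (s, y)) has_derivative (\<lambda>h. (h, 0))) (at x)"
    by (intro has_derivative_Pair has_derivative_ident has_derivative_const)
  from has_derivative_compose[OF this assms]
  show 1: "((\<lambda>s. u (s, y)) has_vector_derivative a) (at x)"
    by (simp add: has_vector_derivative_def scaleR_conv_of_real)
  have "((\<lambda>s. (x, s)) has_derivative (\<lambda>h. (0, h))) (at y)"
    by (intro has_derivative_Pair has_derivative_ident has_derivative_const)
  from has_derivative_compose[OF this assms]
  show 2: "((\<lambda>s. u (x, s)) has_vector_derivative b) (at y)"
    by (simp add: has_vector_derivative_def scaleR_conv_of_real)
  show "partial_x u (x, y) = a" "partial_y u (x, y) = b"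
    using vector_derivative_at[OF 1] vector_derivative_at[OF 2] by (simp_all add: partial_x_def partial_y_def)
qed

text \<open>Smoothness without formulas for higher derivatives: the partial derivatives stay in
  \<open>S\<close>, so each order follows from the previous one for the whole class at once.\<close>

lemma Ck_derivative_closed:
  assumes S: "\<And>f. f \<in> S \<Longrightarrow> \<exists>a\<in>S. \<exists>b\<in>S. \<forall>z. (f has_derivative (\<lambda>h. of_real (fst h) * a z + of_real (snd h) * b z)) (at z)"
    and f: "f \<in> S"
  shows "Ck k f"
  using f
proof (induction k arbitrary: f)
  case 0
  then obtain a b where "\<And>z. (f has_derivative (\<lambda>h. of_real (fst h) * a z + of_real (snd h) * b z)) (at z)"
    using S by meson
  then show ?case
    by (auto intro!: continuous_at_imp_continuous_on has_derivative_continuous)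
next
  case (Suc k)
  then obtain a b where ab: "a \<in> S" "b \<in> S" 
    and d: "\<And>z. (f has_derivative (\<lambda>h. of_real (fst h) * a z + of_real (snd h) * b z)) (at z)"
    using S by meson
  have "f differentiable_on UNIV"
    unfolding differentiable_on_def differentiable_def using d by blast
  moreover have "partial_x f = a" "partial_y f = b"
    using partials(3,4)[OF d] by (auto simp: fun_eq_iff)
  ultimately show ?case using Suc.IH ab by simp
qed

text \<open>The y-derivative of a theta section contains x times a theta section. Closing under
  multiplication by x gives a class stable under both partial derivatives.\<close>

inductive_set theta_span :: "nat \<Rightarrow> int \<Rightarrow> (real \<times> real \<Rightarrow> complex) set" for N m where
  theta: "theta N p m \<in> theta_span N m"
| add: "f \<in> theta_span N m \<Longrightarrow> g \<in> theta_span N m \<Longrightarrow> (\<lambda>z. f z + g z) \<in> theta_span N m"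
| fst_mult: "f \<in> theta_span N m \<Longrightarrow> (\<lambda>z. of_real (fst z) * f z) \<in> theta_span N m"

lemma theta_span_cmult: 
  assumes N: "N \<ge> 1" and "f \<in> theta_span N m"
  shows "(\<lambda>z. c * f z) \<in> theta_span N m"
  using assms(2)
proof induction
  case (theta p)
  then show ?case using theta_span.theta[of N "smult c p" m] theta_smult[OF N] 
    by (metis (no_types, lifting) ext)
next
  case (add f g)
  then show ?case using theta_span.add[of "\<lambda>z. c * f z" N m "\<lambda>z. c * g z"] by (simp add: distrib_left)
next
  case (fst_mult f)
  then show ?case using theta_span.fst_mult[of "\<lambda>z. c * f z" N m] by (simp add: mult.left_commute)
qed

lemma theta_span_derivative:
  assumes N: "N \<ge> 1" and "f \<in> theta_span N m"
  shows "\<exists>a\<in>theta_span N m. \<exists>b\<in>theta_span N m. \<forall>z. (f has_derivative (\<lambda>h. of_real (fst h) * a z + of_real (snd h) * b z)) (at z)"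
  using assms(2)
proof induction
  case (theta p)
  let ?b = "\<lambda>z. \<i> * of_real (2 * pi * real N) * (of_real (fst z) * theta N p m z) +
     (- (\<i> * of_real (2 * pi * real N))) * theta N ([:0, 1:] * p) m z"
  have b: "?b \<in> theta_span N m"
    by (intro theta_span.add theta_span_cmult N theta_span.theta theta_span.fst_mult)
  have "(theta N p m has_derivative (\<lambda>h. of_real (fst h) * theta N (gauss_poly_deriv N p) m z + of_real (snd h) * ?b z)) (at z)" for z
    using theta_has_derivative[OF N, of p m z] by (simp only: right_diff_distrib mult_minus_left add_uminus_conv_diff)
  then show ?case
    by (intro bexI[OF _ theta_span.theta[of N "gauss_poly_deriv N p" m]] bexI[OF _ b] allI)
next
  case (add f g)
  then obtain a b a' b' where ab: "a \<in> theta_span N m" "b \<in> theta_span N m" "a' \<in> theta_span N m" "b' \<in> theta_span N m"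
    and d: "\<And>z. (f has_derivative (\<lambda>h. of_real (fst h) * a z + of_real (snd h) * b z)) (at z)"
     "\<And>z. (g has_derivative (\<lambda>h. of_real (fst h) * a' z + of_real (snd h) * b' z)) (at z)"
    by meson
  have "((\<lambda>z. f z + g z) has_derivative (\<lambda>h. of_real (fst h) * (a z + a' z) + of_real (snd h) * (b z + b' z))) (at z)" for z
    by (rule has_derivative_eq_rhs[OF has_derivative_add[OF d]]) (simp add: algebra_simps)
  then show ?case
    by (intro bexI[OF _ theta_span.add[OF ab(1,3)]] bexI[OF _ theta_span.add[OF ab(2,4)]] allI)
next
  case (fst_mult f)
  then obtain a b where ab: "a \<in> theta_span N m" "b \<in> theta_span N m"
    and d: "\<And>z. (f has_derivative (\<lambda>h. of_real (fst h) * a z + of_real (snd h) * b z)) (at z)"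
    by meson
  have f: "((\<lambda>z. of_real (fst z)) has_derivative (\<lambda>h. complex_of_real (fst h))) (at z)" for z :: "real \<times> real"
    by (intro has_derivative_of_real has_derivative_fst has_derivative_ident)
  have "((\<lambda>z. of_real (fst z) * f z) has_derivative (\<lambda>h. of_real (fst h) * (f z + of_real (fst z) * a z) + of_real (snd h) * (of_real (fst z) * b z))) (at z)" for z
    by (rule has_derivative_eq_rhs[OF has_derivative_mult[OF f d]]) (simp add: algebra_simps)
  then show ?case
    by (intro bexI[OF _ theta_span.add[OF fst_mult.hyps theta_span.fst_mult[OF ab(1)]]]
        bexI[OF _ theta_span.fst_mult[OF ab(2)]] allI)
qed

lemma theta_smooth: "N \<ge> 1 \<Longrightarrow> smooth (theta N p m)"
  unfolding smooth_def
  by (rule allI, rule Ck_derivative_closed[where S = "theta_span N m"])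
    (rule theta_span_derivative theta_span.theta; assumption)+

section \<open>Quasi-periodicity\<close>

lemma infsum_int_shift: "(\<Sum>\<^sub>\<infinity>j. f (j + l)) = (\<Sum>\<^sub>\<infinity>j::int. f j)"
proof (rule infsum_reindex_bij_betw)
  show "bij_betw (\<lambda>j::int. j + l) UNIV UNIV"
    by (rule bij_betw_byWitness[where f' = "\<lambda>j. j - l"]) auto
qed

lemma theta_index_shift: "theta N p (m + l * int N) z = theta N p m z"
  using infsum_int_shift[of "\<lambda>j. mode N p (m + j * int N) z" l]
  by (simp add: theta_def algebra_simps)

text \<open>Shifting the index by a multiple of \<open>N\<close> is a magnetic translation: a move
  by whole cells combined with a phase.\<close>

lemma mode_shift:
  assumes N: "N \<ge> 1"
  shows "mode N p (n + l * int N) (x, y) = circ (l * int N) y * mode N p n (x - of_int l, y)"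
  using N by (simp add: mode_def circ_add field_simps)

lemma theta_quasiperiodic:
  assumes N: "N \<ge> 1"
  shows "quasiperiodic N (theta N p m)"
  unfolding quasiperiodic_def
proof (intro conjI allI)
  fix x y
  have "mode N p (m + j * int N) (x + 1, y) = circ (int N) y * mode N p (m + (j + - 1) * int N) (x, y)" for j
    using mode_shift[OF N, of p "m + (j - 1) * int N" 1 "x + 1" y] by (simp add: algebra_simps)
  then have "theta N p m (x + 1, y) = circ (int N) y * (\<Sum>\<^sub>\<infinity>j. mode N p (m + (j + - 1) * int N) (x, y))"
    by (simp only: theta_def infsum_cmult_right')
  also have "(\<Sum>\<^sub>\<infinity>j. mode N p (m + (j + - 1) * int N) (x, y)) = theta N p m (x, y)"
    unfolding theta_def by (rule infsum_int_shift)
  finally show "theta N p m (x + 1, y) = exp (2 * of_real pi * \<i> * of_nat N * of_real y) * theta N p m (x, y)"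
    by (simp add: circ_def)
  have "circ n (y + 1) = circ n y" for n
  proof -
    have "circ n (y + 1) = circ n y * exp (2 * of_real pi * \<i> * of_int n)"
      by (simp add: circ_def algebra_simps exp_add)
    also have "exp (2 * of_real pi * \<i> * of_int n) = 1" 
      using exp_integer_2pi[of "of_int n"] by (simp add: mult_ac)
    finally show ?thesis by simp
  qed
  then show "theta N p m (x, y + 1) = theta N p m (x, y)"
    by (simp add: theta_def mode_def)
qed

lemma theta_smooth_section: "N \<ge> 1 \<Longrightarrow> theta N p m \<in> smooth_sections N"
  by (simp add: smooth_sections_def theta_smooth theta_quasiperiodic)

section \<open>The oscillator and Hermite functions\<close>

lemma partial_x_theta:
  assumes N: "N \<ge> 1"
  shows "partial_x (theta N p m) = theta N (gauss_poly_deriv N p) m"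
  using partials(3)[OF theta_has_derivative[OF N]] by (auto simp: fun_eq_iff)

text \<open>Mode by mode the covariant derivative is -2\<pi>\<i>N times the centred coordinate x -
  n/N; the uncentred x of the connection cancels.\<close>

lemma nabla_y_theta:
  assumes N: "N \<ge> 1"
  shows "nabla_y N (theta N p m) = theta N (smult (- \<i> * of_real (2 * pi * real N)) ([:0, 1:] * p)) m"
proof (rule ext)
  fix z :: "real \<times> real"
  obtain x y where z: "z = (x, y)" by (cases z)
  have "partial_y (theta N p m) (x, y) = \<i> * of_real (2 * pi * real N) * 
        (of_real x * theta N p m (x, y) - theta N ([:0, 1:] * p) m (x, y))"
    using partials(4)[OF theta_has_derivative[OF N, of p m "(x, y)"]] by simp
  then show "nabla_y N (theta N p m) z = theta N (smult (- \<i> * of_real (2 * pi * real N)) ([:0, 1:] * p)) m z"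
    unfolding theta_smult[OF N] z nabla_y_def by (simp add: algebra_simps del: mult_pCons_left)
qed

text \<open>The operator - d^2/dx^2 + B^2 x^2 with B = 2\<pi>N, conjugated by the Gaussian, is 2B x
  d/dx - d^2/dx^2 + B.\<close>

definition osc_poly :: "nat \<Rightarrow> complex poly \<Rightarrow> complex poly" where
  "osc_poly N p = smult (of_real (4 * pi * real N)) ([:0, 1:] * pderiv p) - pderiv (pderiv p)
     + smult (of_real (2 * pi * real N)) p"

lemma magnetic_laplacian_theta:
  assumes N: "N \<ge> 1"
  shows "magnetic_laplacian N (theta N p m) = theta N (osc_poly N p) m"
proof -
  let ?c = "complex_of_real (2 * pi * real N)"
  let ?n = "\<lambda>p. smult (- \<i> * ?c) ([:0, 1:] * p)"
  have "magnetic_laplacian N (theta N p m) z = theta N (smult (-1) (gauss_poly_deriv N (gauss_poly_deriv N p)) + smult (-1) (?n (?n p))) m z" for z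
    unfolding magnetic_laplacian_def partial_x_theta[OF N] nabla_y_theta[OF N] theta_add[OF N] theta_smult[OF N] by simp
  moreover have "smult (-1) (gauss_poly_deriv N (gauss_poly_deriv N p)) + smult (-1) (?n (?n p)) = osc_poly N p"
  proof -
    have c2: "complex_of_real (4 * pi * real N) = 2 * ?c" by simp
    have "poly (smult (-1) (gauss_poly_deriv N (gauss_poly_deriv N p)) + smult (-1) (?n (?n p))) x = poly (osc_poly N p) x" for x
      unfolding gauss_poly_deriv_def osc_poly_def c2 by (simp add: pderiv_diff pderiv_smult pderiv_pCons algebra_simps)
    then show ?thesis by (intro iffD1[OF poly_eq_poly_eq_iff] ext)
  qed
  ultimately show ?thesis by auto
qed

text \<open>Hermite polynomials scaled to B = 2\<pi>N: the recursion is the creation operator B x -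
  d/dx conjugated by the Gaussian.\<close>

primrec herm_poly :: "nat \<Rightarrow> nat \<Rightarrow> complex poly" where
  "herm_poly N 0 = 1"
| "herm_poly N (Suc k) = smult (of_real (4 * pi * real N)) ([:0, 1:] * herm_poly N k) - pderiv (herm_poly N k)"

text \<open>The induction runs on Hermite's equation 2B x h' - h'' = 2B k h, and adding B h gives
  the eigenvalue B(2k + 1). The third derivatives in the step come from differentiating the equation
  for \<open>k\<close>.\<close>

lemma osc_herm_poly: "osc_poly N (herm_poly N k) = smult (of_real (2 * pi * real N * (2 * real k + 1))) (herm_poly N k)"
proof -
  let ?c = "complex_of_real (4 * pi * real N)"
  have X: "pderiv ([:0, 1:] * q) = q + [:0, 1:] * pderiv q" for q :: "complex poly"
    by (simp add: pderiv_mult pderiv_pCons del: mult_pCons_left)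
  have "smult ?c ([:0, 1:] * pderiv (herm_poly N k)) - pderiv (pderiv (herm_poly N k)) = smult (?c * of_nat k) (herm_poly N k)"
  proof (induction k)
    case 0
    show ?case by simp
  next
    case (Suc k)
    let ?h = "herm_poly N k"
    have IH: "pderiv (pderiv ?h) = smult ?c ([:0, 1:] * pderiv ?h) - smult (?c * of_nat k) ?h"
      using Suc by (simp add: algebra_simps del: mult_pCons_left)
    have IH': "pderiv (pderiv (pderiv ?h)) = smult ?c (pderiv ?h + [:0, 1:] * pderiv (pderiv ?h)) - smult (?c * of_nat k) (pderiv ?h)"
      by (subst IH) (simp only: pderiv_diff pderiv_smult X)
    have "poly (smult ?c ([:0, 1:] * pderiv (herm_poly N (Suc k))) - pderiv (pderiv (herm_poly N (Suc k)))) x =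
        poly (smult (?c * of_nat (Suc k)) (herm_poly N (Suc k))) x" for x
      unfolding herm_poly.simps pderiv_diff pderiv_smult X pderiv_add IH' unfolding IH
      by (simp add: algebra_simps)
    then show ?case by (intro iffD1[OF poly_eq_poly_eq_iff] ext)
  qed
  then show ?thesis unfolding osc_poly_def
    by (simp only: smult_add_left[symmetric]) (simp add: algebra_simps)
qed

lemma magnetic_laplacian_herm_poly:
  assumes N: "N \<ge> 1"
  shows "magnetic_laplacian N (theta N (herm_poly N k) m) = 
    (\<lambda>z. of_real (2 * pi * real N * (2 * real k + 1)) * theta N (herm_poly N k) m z)"
  unfolding magnetic_laplacian_theta[OF N] osc_herm_poly theta_smult[OF N, abs_def] ..

lemma degree_herm_poly:
  assumes N: "N \<ge> 1"
  shows "degree (herm_poly N k) = k" "herm_poly N k \<noteq> 0"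
proof -
  have "degree (herm_poly N k) = k \<and> herm_poly N k \<noteq> 0"
  proof (induction k)
    case (Suc k)
    let ?c = "complex_of_real (4 * pi * real N)"
    have c: "?c \<noteq> 0" using N by simp
    have 1: "degree (smult ?c ([:0, 1:] * herm_poly N k)) = Suc k"
      using Suc c by (simp add: degree_pCons_eq)
    have "degree (pderiv (herm_poly N k)) \<le> k - 1" using Suc degree_pderiv[of "herm_poly N k"] by simp
    then have 2: "degree (pderiv (herm_poly N k)) < degree (smult ?c ([:0, 1:] * herm_poly N k))" using 1 by simp
    have "degree (herm_poly N (Suc k)) = Suc k"
      using degree_add_eq_left[of "- pderiv (herm_poly N k)" "smult ?c ([:0, 1:] * herm_poly N k)"] 1 2 by simp
    then show ?case by auto
  qed simp
  then show "degree (herm_poly N k) = k" "herm_poly N k \<noteq> 0" by auto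
qed

text \<open>Since \<open>herm_poly N k\<close> has degree exactly \<open>k\<close>, subtracting a
  multiple of one of them cancels any leading term. Linear properties therefore need checking on
  Hermite polynomials only.\<close>

lemma herm_poly_induct:
  assumes N: "N \<ge> 1"
    and herm_poly: "\<And>k. P (herm_poly N k)" and add: "\<And>p q. P p \<Longrightarrow> P q \<Longrightarrow> P (p + q)" and smult: "\<And>c p. P p \<Longrightarrow> P (smult c p)"
  shows "P q"
proof (induction "degree q" arbitrary: q rule: less_induct)
  case less
  show ?case
  proof (cases "degree q = 0")
    case True
    then obtain c where q: "q = [:c:]" by (metis degree_eq_zeroE)
    have "P (smult c (herm_poly N 0))" using smult herm_poly by blast
    then show ?thesis by (simp add: q)
  next
    case False
    define c where "c = lead_coeff q / lead_coeff (herm_poly N (degree q))"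
    define r where "r = q - smult c (herm_poly N (degree q))"
    have d: "degree (herm_poly N (degree q)) = degree q" by (rule degree_herm_poly[OF N])
    have c0: "lead_coeff (herm_poly N (degree q)) \<noteq> 0"
      using degree_herm_poly(2)[OF N] by (simp only: leading_coeff_0_iff not_False_eq_True)
    have "degree r \<le> degree q" unfolding r_def
      by (rule degree_diff_le) (auto simp: d intro: order.trans[OF degree_smult_le])
    moreover have "coeff r (degree q) = 0" using c0 by (simp add: r_def c_def d)
    ultimately have "degree r < degree q"
      using False by (metis leading_coeff_0_iff degree_0 le_neq_implies_less neq0_conv)
    then have "P r" by (rule less)
    moreover have "q = r + smult c (herm_poly N (degree q))" by (simp add: r_def)
    ultimately show ?thesis using add smult herm_poly by metis
  qed
qed

section \<open>Symmetry of the magnetic Laplacian\<close>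

lemma differentiable_partials:
  assumes "u differentiable_on UNIV"
  shows "((\<lambda>s. u (s, y)) has_vector_derivative partial_x u (x, y)) (at x)"
    and "((\<lambda>s. u (x, s)) has_vector_derivative partial_y u (x, y)) (at y)"
proof -
  obtain u' where u: "(u has_derivative u') (at (x, y))"
    using assms unfolding differentiable_on_def differentiable_def by auto
  have "((\<lambda>s. (s, y)) has_derivative (\<lambda>h. (h, 0))) (at x)"
    by (intro has_derivative_Pair has_derivative_ident has_derivative_const)
  from has_derivative_compose[OF this u] have "(\<lambda>s. u (s, y)) differentiable (at x)"
    by (rule differentiableI)
  then show "((\<lambda>s. u (s, y)) has_vector_derivative partial_x u (x, y)) (at x)"
    by (simp add: vector_derivative_works partial_x_def)
  have "((\<lambda>s. (x, s)) has_derivative (\<lambda>h. (0, h))) (at y)"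
    by (intro has_derivative_Pair has_derivative_ident has_derivative_const)
  from has_derivative_compose[OF this u] have "(\<lambda>s. u (x, s)) differentiable (at y)"
    by (rule differentiableI)
  then show "((\<lambda>s. u (x, s)) has_vector_derivative partial_y u (x, y)) (at y)"
    by (simp add: vector_derivative_works partial_y_def)
qed

lemma smooth_differentiable: "smooth u \<Longrightarrow> u differentiable_on UNIV"
  unfolding smooth_def by (metis Ck.simps(2))

lemma smooth_continuous: "smooth u \<Longrightarrow> continuous_on A u"
  unfolding smooth_def by (metis Ck.simps(1) continuous_on_subset subset_UNIV)

lemma smooth_partial_x: "smooth u \<Longrightarrow> smooth (partial_x u)"
  and smooth_partial_y: "smooth u \<Longrightarrow> smooth (partial_y u)"
  unfolding smooth_def by (metis Ck.simps(2))+

lemma quasiperiodic_x: "quasiperiodic N u \<Longrightarrow> u (x + 1, y) = circ (int N) y * u (x, y)"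
  by (simp add: quasiperiodic_def circ_def)

lemma quasiperiodic_y: "quasiperiodic N u \<Longrightarrow> u (x, y + 1) = u (x, y)"
  by (simp add: quasiperiodic_def)

lemma has_vector_derivative_shift1:
  fixes f :: "real \<Rightarrow> complex"
  assumes "(f has_vector_derivative d) (at (x + 1))"
  shows "((\<lambda>s. f (s + 1)) has_vector_derivative d) (at x)"
proof -
  have "((\<lambda>s. s + 1) has_vector_derivative 1) (at x)" by (auto intro!: derivative_eq_intros)
  from vector_diff_chain_at[OF this, of f d] assms show ?thesis by (simp add: o_def)
qed

lemma quasiperiodic_partial_x:
  assumes u: "u differentiable_on UNIV" and q: "quasiperiodic N u"
  shows "partial_x u (x + 1, y) = circ (int N) y * partial_x u (x, y)"
proof -
  have "((\<lambda>s. u (s + 1, y)) has_vector_derivative partial_x u (x + 1, y)) (at x)"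
    using has_vector_derivative_shift1[OF differentiable_partials(1)[OF u]] .
  moreover have "((\<lambda>s. circ (int N) y * u (s, y)) has_vector_derivative circ (int N) y * partial_x u (x, y)) (at x)"
    by (intro has_vector_derivative_mult_right differentiable_partials(1)[OF u])
  ultimately show ?thesis 
    unfolding quasiperiodic_x[OF q] by (rule vector_derivative_unique_at)
qed

lemma quasiperiodic_partial_y:
  assumes u: "u differentiable_on UNIV" and q: "quasiperiodic N u"
  shows "partial_y u (x, y + 1) = partial_y u (x, y)"
proof -
  have "((\<lambda>s. u (x, s + 1)) has_vector_derivative partial_y u (x, y + 1)) (at y)"
    using has_vector_derivative_shift1[OF differentiable_partials(2)[OF u]] .
  then show ?thesis 
    unfolding quasiperiodic_y[OF q] using differentiable_partials(2)[OF u] by (rule vector_derivative_unique_at)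
qed

lemma set_integrable_unit_square_continuous:
  fixes f :: "real \<times> real \<Rightarrow> 'a :: {banach, second_countable_topology}"
  assumes "continuous_on UNIV f"
  shows "set_integrable lborel unit_square f"
  unfolding set_integrable_def
  by (rule borel_integrable_compact) (auto intro: compact_Times continuous_on_subset[OF assms])

text \<open>One half of the divergence theorem on the torus: for each fixed y, the boundary values
  left by the fundamental theorem of calculus cancel by periodicity.\<close>

lemma integral_partial_x_eq_0:
  fixes F f :: "real \<times> real \<Rightarrow> complex"
  assumes F: "\<And>x y. ((\<lambda>s. F (s, y)) has_vector_derivative f (x, y)) (at x)"
    and f: "continuous_on UNIV f" and per: "\<And>y. F (1, y) = F (0, y)"
  shows "(LINT z:unit_square|lborel. f z) = 0"
proof -
  let ?g = "\<lambda>x y. indicat_real unit_square (x, y) *\<^sub>R f (x, y)"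
  have i: "integrable (lborel \<Otimes>\<^sub>M lborel) (case_prod ?g)"
    using set_integrable_unit_square_continuous[OF f] 
    by (simp add: set_integrable_def lborel_prod case_prod_unfold)
  have "(LINT x|lborel. ?g x y) = 0" for y
  proof -
    have "(LINT x|lborel. ?g x y) = (LINT x|lborel. indicat_real {0..1} y *\<^sub>R (indicat_real {0..1} x *\<^sub>R f (x, y)))"
      by (intro Bochner_Integration.integral_cong) (auto simp: indicator_def)
    also have "\<dots> = indicat_real {0..1} y *\<^sub>R (LINT x|lborel. indicat_real {0..1} x *\<^sub>R f (x, y))"
      by (rule integral_scaleR_right) 
    also have "(LINT x|lborel. indicat_real {0..1} x *\<^sub>R f (x, y)) = F (1, y) - F (0, y)"
      by (intro integral_FTC_atLeastAtMost has_vector_derivative_at_within[OF F] continuous_on_compose2[OF f] continuous_intros) auto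
    finally show ?thesis by (simp add: per)
  qed
  then have "0 = (LINT y|lborel. LINT x|lborel. ?g x y)" by simp
  also have "\<dots> = integral\<^sup>L (lborel \<Otimes>\<^sub>M lborel) (case_prod ?g)" by (rule lborel_pair.integral_snd[OF i])
  finally show ?thesis by (simp add: set_lebesgue_integral_def lborel_prod case_prod_unfold)
qed

lemma integral_partial_y_eq_0:
  fixes F f :: "real \<times> real \<Rightarrow> complex"
  assumes F: "\<And>x y. ((\<lambda>s. F (x, s)) has_vector_derivative f (x, y)) (at y)"
    and f: "continuous_on UNIV f" and per: "\<And>x. F (x, 1) = F (x, 0)"
  shows "(LINT z:unit_square|lborel. f z) = 0"
proof -
  let ?g = "\<lambda>x y. indicat_real unit_square (x, y) *\<^sub>R f (x, y)"
  have i: "integrable (lborel \<Otimes>\<^sub>M lborel) (case_prod ?g)"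
    using set_integrable_unit_square_continuous[OF f] 
    by (simp add: set_integrable_def lborel_prod case_prod_unfold)
  have "(LINT y|lborel. ?g x y) = 0" for x
  proof -
    have "(LINT y|lborel. ?g x y) = (LINT y|lborel. indicat_real {0..1} x *\<^sub>R (indicat_real {0..1} y *\<^sub>R f (x, y)))"
      by (intro Bochner_Integration.integral_cong) (auto simp: indicator_def)
    also have "\<dots> = indicat_real {0..1} x *\<^sub>R (LINT y|lborel. indicat_real {0..1} y *\<^sub>R f (x, y))"
      by (rule integral_scaleR_right) 
    also have "(LINT y|lborel. indicat_real {0..1} y *\<^sub>R f (x, y)) = F (x, 1) - F (x, 0)"
      by (intro integral_FTC_atLeastAtMost has_vector_derivative_at_within[OF F] continuous_on_compose2[OF f] continuous_intros) auto
    finally show ?thesis by (simp add: per)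
  qed
  then have "0 = (LINT x|lborel. LINT y|lborel. ?g x y)" by simp
  also have "\<dots> = integral\<^sup>L (lborel \<Otimes>\<^sub>M lborel) (case_prod ?g)" by (rule lborel_pair.integral_fst[OF i])
  finally show ?thesis by (simp add: set_lebesgue_integral_def lborel_prod case_prod_unfold)
qed

lemma unit_square_sets [measurable, simp]: "unit_square \<in> sets borel"
  by (intro borel_closed closed_Times) auto

definition sec_inner :: "(real \<times> real \<Rightarrow> complex) \<Rightarrow> (real \<times> real \<Rightarrow> complex) \<Rightarrow> complex" where
  "sec_inner u v = (LINT z:unit_square|lborel. u z * cnj (v z))"

lemma nabla_y_eq: "nabla_y N u = (\<lambda>z. partial_y u z - \<i> * of_real (2 * pi * real N) * of_real (fst z) * u z)"
  by (auto simp: nabla_y_def fun_eq_iff)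

text \<open>An ordinary y-derivative is written as a covariant one plus a connection term, the form
  in which the connection terms of two sections cancel. The expansion in the second claim shows the
  continuity of the second covariant derivative.\<close>

lemma nabla_y_has_vector_derivative:
  assumes u: "smooth u"
  shows "((\<lambda>s. nabla_y N u (x, s)) has_vector_derivative
     nabla_y N (nabla_y N u) (x, y) + \<i> * of_real (2 * pi * real N) * of_real x * nabla_y N u (x, y)) (at y)"
    and "nabla_y N (nabla_y N u) (x, y) = partial_y (partial_y u) (x, y)
      - 2 * (\<i> * of_real (2 * pi * real N) * of_real x * partial_y u (x, y))
      + (\<i> * of_real (2 * pi * real N) * of_real x)\<^sup>2 * u (x, y)"
proof -
  let ?c = "\<i> * of_real (2 * pi * real N) * of_real x"
  have d: "((\<lambda>s. nabla_y N u (x, s)) has_vector_derivative partial_y (partial_y u) (x, y) - ?c * partial_y u (x, y)) (at y)"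
    unfolding nabla_y_eq fst_conv
    by (intro has_vector_derivative_diff has_vector_derivative_mult_right differentiable_partials(2) smooth_differentiable u smooth_partial_y)
  then have "partial_y (nabla_y N u) (x, y) = partial_y (partial_y u) (x, y) - ?c * partial_y u (x, y)"
    by (simp add: partial_y_def vector_derivative_at)
  then have e: "nabla_y N (nabla_y N u) (x, y) = partial_y (partial_y u) (x, y) - ?c * partial_y u (x, y) - ?c * nabla_y N u (x, y)"
    by (subst nabla_y_eq) simp
  then show "((\<lambda>s. nabla_y N u (x, s)) has_vector_derivative
     nabla_y N (nabla_y N u) (x, y) + ?c * nabla_y N u (x, y)) (at y)"
    using d by simp
  show "nabla_y N (nabla_y N u) (x, y) = partial_y (partial_y u) (x, y)
      - 2 * (?c * partial_y u (x, y)) + ?c\<^sup>2 * u (x, y)"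
    unfolding e unfolding nabla_y_eq by (simp add: power2_eq_square algebra_simps)
qed

lemma continuous_nabla_y:
  assumes u: "smooth u"
  shows "continuous_on A (nabla_y N u)" "continuous_on A (nabla_y N (nabla_y N u))"
proof -
  show "continuous_on A (nabla_y N u)" unfolding nabla_y_eq
    by (intro continuous_intros smooth_continuous u smooth_partial_y)
  have "nabla_y N (nabla_y N u) = (\<lambda>z. partial_y (partial_y u) z
      - 2 * (\<i> * of_real (2 * pi * real N) * of_real (fst z) * partial_y u z)
      + (\<i> * of_real (2 * pi * real N) * of_real (fst z))\<^sup>2 * u z)"
    using nabla_y_has_vector_derivative(2)[OF u] by (auto simp: fun_eq_iff)
  then show "continuous_on A (nabla_y N (nabla_y N u))"
    by (simp only:) (intro continuous_intros smooth_continuous u smooth_partial_y)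
qed

lemma continuous_magnetic_laplacian:
  assumes u: "smooth u"
  shows "continuous_on A (magnetic_laplacian N u)"
  unfolding magnetic_laplacian_def
  by (intro continuous_intros continuous_nabla_y smooth_continuous u smooth_partial_x)

lemma circ_mult_cnj: "circ n y * a * cnj (circ n y * b) = a * cnj b"
proof -
  have "circ n y * circ (- n) y = 1" using circ_add[of n "- n" y] by simp
  then show ?thesis by (simp add: mult_ac)
qed

text \<open>Green's identity: the difference of the integrands is minus the divergence of a current
  with components (Du) conj v - u conj (Dv). The phases of the two sections cancel in these
  products, so the current is periodic and its divergence integrates to 0.\<close>

theorem magnetic_laplacian_symmetric:
  assumes u: "u \<in> smooth_sections N" and v: "v \<in> smooth_sections N"
  shows "sec_inner (magnetic_laplacian N u) v = sec_inner u (magnetic_laplacian N v)"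
proof -
  have su: "smooth u" and qu: "quasiperiodic N u" and sv: "smooth v" and qv: "quasiperiodic N v"
    using u v by (auto simp: smooth_sections_def)
  note du = smooth_differentiable[OF su] and dv = smooth_differentiable[OF sv]
  note sm = su sv smooth_partial_x smooth_partial_y
  define fx where "fx = (\<lambda>z. partial_x (partial_x u) z * cnj (v z) - u z * cnj (partial_x (partial_x v) z))"
  define fy where "fy = (\<lambda>z. nabla_y N (nabla_y N u) z * cnj (v z) - u z * cnj (nabla_y N (nabla_y N v) z))"
  have cfx: "continuous_on UNIV fx" unfolding fx_def by (intro continuous_intros smooth_continuous sm)
  have cfy: "continuous_on UNIV fy" unfolding fy_def by (intro continuous_intros continuous_nabla_y smooth_continuous sm)
  have "(LINT z:unit_square|lborel. fx z) = 0"
  proof (rule integral_partial_x_eq_0[OF _ cfx])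
    let ?F = "\<lambda>z. partial_x u z * cnj (v z) - u z * cnj (partial_x v z)"
    show "((\<lambda>s. ?F (s, y)) has_vector_derivative fx (x, y)) (at x)" for x y
    proof (rule has_vector_derivative_eq_rhs)
      show "((\<lambda>s. ?F (s, y)) has_vector_derivative
         (partial_x u (x, y) * cnj (partial_x v (x, y)) + partial_x (partial_x u) (x, y) * cnj (v (x, y)))
         - (u (x, y) * cnj (partial_x (partial_x v) (x, y)) + partial_x u (x, y) * cnj (partial_x v (x, y)))) (at x)"
        by (intro has_vector_derivative_diff has_vector_derivative_mult has_vector_derivative_cnj
          differentiable_partials(1) smooth_differentiable sm)
    qed (simp add: fx_def)
    show "?F (1, y) = ?F (0, y)" for y
      using quasiperiodic_x[OF qu, of 0 y] quasiperiodic_x[OF qv, of 0 y]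
        quasiperiodic_partial_x[OF du qu, of 0 y] quasiperiodic_partial_x[OF dv qv, of 0 y]
      by (simp only: add_0 circ_mult_cnj)
  qed
  moreover have "(LINT z:unit_square|lborel. fy z) = 0"
  proof (rule integral_partial_y_eq_0[OF _ cfy])
    let ?F = "\<lambda>z. nabla_y N u z * cnj (v z) - u z * cnj (nabla_y N v z)"
    show "((\<lambda>s. ?F (x, s)) has_vector_derivative fy (x, y)) (at y)" for x y
    proof (rule has_vector_derivative_eq_rhs)
      show "((\<lambda>s. ?F (x, s)) has_vector_derivative
       (nabla_y N u (x, y) * cnj (partial_y v (x, y)) + 
         (nabla_y N (nabla_y N u) (x, y) + \<i> * of_real (2 * pi * real N) * of_real x * nabla_y N u (x, y)) * cnj (v (x, y)))
       - (u (x, y) * cnj (nabla_y N (nabla_y N v) (x, y) + \<i> * of_real (2 * pi * real N) * of_real x * nabla_y N v (x, y))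
          + partial_y u (x, y) * cnj (nabla_y N v (x, y)))) (at y)"
        by (intro has_vector_derivative_diff has_vector_derivative_mult has_vector_derivative_cnj
          differentiable_partials(2) nabla_y_has_vector_derivative(1) smooth_differentiable sm)
      \<comment> \<open>With ordinary derivatives replaced by covariant ones the connection terms
        cancel, since their coefficient is purely imaginary and changes sign under
        conjugation.\<close>
      have p: "partial_y w (x, y) = nabla_y N w (x, y) + \<i> * of_real (2 * pi * real N) * of_real x * w (x, y)" for w
        by (simp add: nabla_y_eq)
      show "(nabla_y N u (x, y) * cnj (partial_y v (x, y)) + 
         (nabla_y N (nabla_y N u) (x, y) + \<i> * of_real (2 * pi * real N) * of_real x * nabla_y N u (x, y)) * cnj (v (x, y)))
       - (u (x, y) * cnj (nabla_y N (nabla_y N v) (x, y) + \<i> * of_real (2 * pi * real N) * of_real x * nabla_y N v (x, y))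
          + partial_y u (x, y) * cnj (nabla_y N v (x, y))) = fy (x, y)"
        unfolding fy_def p by (simp add: algebra_simps)
    qed
    show "?F (x, 1) = ?F (x, 0)" for x
      using quasiperiodic_y[OF qu, of x 0] quasiperiodic_y[OF qv, of x 0]
        quasiperiodic_partial_y[OF du qu, of x 0] quasiperiodic_partial_y[OF dv qv, of x 0]
      by (simp add: nabla_y_eq)
  qed
  ultimately have 0: "(LINT z:unit_square|lborel. - fx z - fy z) = 0"
    using set_integrable_unit_square_continuous[OF cfx] set_integrable_unit_square_continuous[OF cfy]
    by (simp add: set_lebesgue_integral_def set_integrable_def scaleR_diff_right)
  have cuv: "continuous_on UNIV (\<lambda>z. magnetic_laplacian N u z * cnj (v z))"
     "continuous_on UNIV (\<lambda>z. u z * cnj (magnetic_laplacian N v z))"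
    by (intro continuous_intros continuous_magnetic_laplacian smooth_continuous sm)+
  have "sec_inner (magnetic_laplacian N u) v - sec_inner u (magnetic_laplacian N v) = 
     (LINT z:unit_square|lborel. magnetic_laplacian N u z * cnj (v z) - u z * cnj (magnetic_laplacian N v z))"
    unfolding sec_inner_def by (intro set_integral_diff(2)[symmetric] set_integrable_unit_square_continuous cuv)
  also have "\<dots> = (LINT z:unit_square|lborel. - fx z - fy z)"
    by (intro set_lebesgue_integral_cong) (auto simp: magnetic_laplacian_def fx_def fy_def algebra_simps)
  finally show ?thesis using 0 by simp
qed

section \<open>Unfolding and completeness\<close>

lemma AE_fst_neq: "AE z in (lborel :: (real \<times> real) measure). fst z \<noteq> c"
proof (rule AE_I)
  show "{z \<in> space lborel. \<not> fst z \<noteq> c} \<subseteq> {c} \<times> (UNIV :: real set)" by auto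
  have "emeasure (lborel \<Otimes>\<^sub>M lborel) ({c} \<times> (UNIV :: real set)) = emeasure lborel {c} * emeasure lborel (UNIV :: real set)"
    by (rule lborel.emeasure_pair_measure_Times) auto
  then show "emeasure lborel ({c} \<times> (UNIV :: real set)) = 0" by (simp add: lborel_prod)
  show "{c} \<times> (UNIV :: real set) \<in> sets lborel" by (simp add: borel_closed closed_Times)
qed

lemma lborel_translate:
  fixes f :: "'a::euclidean_space \<Rightarrow> 'b::{banach, second_countable_topology}"
  assumes [measurable]: "f \<in> borel_measurable borel"
  shows "integrable lborel (\<lambda>z. f (c + z)) \<longleftrightarrow> integrable lborel f"
    and "(LINT z|lborel. f (c + z)) = integral\<^sup>L lborel f"
proof -
  have "integrable (distr lborel borel ((+) c)) f \<longleftrightarrow> integrable lborel (\<lambda>z. f (c + z))"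
    by (rule integrable_distr_eq) auto
  then show "integrable lborel (\<lambda>z. f (c + z)) \<longleftrightarrow> integrable lborel f" by (simp add: lborel_distr_plus)
  have "integral\<^sup>L (distr lborel borel ((+) c)) f = (LINT z|lborel. f (c + z))"
    by (rule integral_distr) auto
  then show "(LINT z|lborel. f (c + z)) = integral\<^sup>L lborel f" by (simp add: lborel_distr_plus)
qed

abbreviation strip :: "(real \<times> real) set" where
  "strip \<equiv> UNIV \<times> {0..1}"

lemma strip_sets [measurable, simp]: "strip \<in> sets borel"
  by (intro borel_closed closed_Times) auto

abbreviation shift :: "nat \<Rightarrow> real \<times> real \<Rightarrow> real \<times> real" where
  "shift i z \<equiv> (fst z - of_int (int_decode i), snd z)"

text \<open>Up to a null line the translated closed square is a half-open cell, and half-open cells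
  tile the strip without overlap.\<close>

lemma cell_integral:
  fixes F :: "real \<times> real \<Rightarrow> 'b::{banach, second_countable_topology}"
  assumes [measurable]: "F \<in> borel_measurable borel"
  defines "G \<equiv> \<lambda>i z. indicat_real ({- of_int (int_decode i)..<1 - of_int (int_decode i)} \<times> {0..1}) z *\<^sub>R F z"
  shows "G i \<in> borel_measurable borel"
    and "set_integrable lborel unit_square (\<lambda>z. F (shift i z)) \<longleftrightarrow> integrable lborel (G i)"
    and "(LINT z:unit_square|lborel. F (shift i z)) = integral\<^sup>L lborel (G i)"
proof -
  define c where "c = (- real_of_int (int_decode i), 0::real)"
  have [measurable]: "{- of_int (int_decode i)..<1 - of_int (int_decode i)} \<times> {0..1} \<in> sets (borel :: (real \<times> real) measure)"
    by (simp add: borel_Times)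
  show Gm[measurable]: "G i \<in> borel_measurable borel" unfolding G_def by measurable
  have [measurable]: "(\<lambda>z. F (shift i z)) \<in> borel_measurable borel"
    by (rule measurable_compose[OF _ assms(1)]) (simp add: borel_prod[symmetric])
  have [measurable]: "(\<lambda>z. G i (c + z)) \<in> borel_measurable borel"
    by (rule measurable_compose[OF _ Gm]) simp
  have ae: "AE z in lborel. indicat_real unit_square z *\<^sub>R F (shift i z) = G i (c + z)"
    using AE_fst_neq[of 1]
  proof eventually_elim
    case (elim z)
    then show ?case by (cases z) (auto simp: G_def c_def indicator_def)
  qed
  have "set_integrable lborel unit_square (\<lambda>z. F (shift i z)) \<longleftrightarrow> integrable lborel (\<lambda>z. G i (c + z))"
    unfolding set_integrable_def by (intro integrable_cong_AE ae) measurable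
  then show "set_integrable lborel unit_square (\<lambda>z. F (shift i z)) \<longleftrightarrow> integrable lborel (G i)"
    by (simp add: lborel_translate(1)[OF Gm])
  have "(LINT z:unit_square|lborel. F (shift i z)) = (LINT z|lborel. G i (c + z))"
    unfolding set_lebesgue_integral_def by (intro integral_cong_AE ae) measurable
  then show "(LINT z:unit_square|lborel. F (shift i z)) = integral\<^sup>L lborel (G i)"
    by (simp add: lborel_translate(2)[OF Gm])
qed

text \<open>Every point of the strip lies in exactly one cell, so the sum over cells has pointwise
  at most one nonzero term; summability of the integrated norms lets the integral pass through the
  sum.\<close>

lemma strip_unfold:
  fixes F :: "real \<times> real \<Rightarrow> complex"
  assumes F[measurable]: "F \<in> borel_measurable borel"
    and i: "\<And>i. set_integrable lborel unit_square (\<lambda>z. F (shift i z))"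
    and s: "summable (\<lambda>i. LINT z:unit_square|lborel. norm (F (shift i z)))"
  shows "set_integrable lborel strip F"
    and "(LINT z:strip|lborel. F z) = (\<Sum>i. LINT z:unit_square|lborel. F (shift i z))"
proof -
  define G where "G = (\<lambda>i z. indicat_real ({- of_int (int_decode i)..<1 - of_int (int_decode i)} \<times> {0..1}) z *\<^sub>R F z)"
  \<comment> \<open>The shift subtracts \<open>int_decode i\<close>, so the cell containing
    \<open>z\<close> is the one with
    \<open>int_decode i = - \<lfloor>fst z\<rfloor>\<close>.\<close>
  define i0 where "i0 = (\<lambda>z::real \<times> real. int_encode (- \<lfloor>fst z\<rfloor>))"
  have G: "G i z = (if i = i0 z then indicator strip z *\<^sub>R F z else 0)" for i z
  proof -
    have "i = i0 z \<longleftrightarrow> \<lfloor>fst z\<rfloor> = - int_decode i"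
      unfolding i0_def by (metis int_decode_inverse int_encode_inverse minus_minus)
    also have "\<dots> \<longleftrightarrow> fst z \<in> {- of_int (int_decode i)..<1 - of_int (int_decode i)}"
      by (auto simp: floor_eq_iff)
    finally show ?thesis by (cases z) (auto simp: G_def indicator_def)
  qed
  have sums: "(\<lambda>i. G i z) sums (indicator strip z *\<^sub>R F z)" for z
    unfolding G using sums_single[of "i0 z" "\<lambda>_. indicator strip z *\<^sub>R F z"] by simp
  have nsum: "AE z in lborel. summable (\<lambda>i. norm (G i z))"
  proof (rule AE_I2)
    fix z
    have "(\<lambda>i. norm (G i z)) = (\<lambda>i. if i = i0 z then norm (indicator strip z *\<^sub>R F z) else 0)"
      unfolding G by auto
    then show "summable (\<lambda>i. norm (G i z))"
      using sums_single[of "i0 z" "\<lambda>_. norm (indicator strip z *\<^sub>R F z)"] by (simp add: sums_iff)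
  qed
  have Gi: "integrable lborel (G i)" for i
    using i[of i] cell_integral(2)[OF F, of i] unfolding G_def by blast
  have nF: "(\<lambda>z. norm (F z)) \<in> borel_measurable borel" by measurable
  have "(LINT z:unit_square|lborel. norm (F (shift i z))) = (LINT z|lborel. norm (G i z))" for i
    using cell_integral(3)[OF nF, of i] unfolding G_def by simp
  with s have s': "summable (\<lambda>i. LINT z|lborel. norm (G i z))" by simp
  have eq: "(\<lambda>z. \<Sum>i. G i z) = (\<lambda>z. indicator strip z *\<^sub>R F z)"
    using sums by (simp add: sums_iff)
  show "set_integrable lborel strip F"
    using integrable_suminf[OF Gi nsum s'] unfolding eq set_integrable_def .
  have "(LINT z:strip|lborel. F z) = (\<Sum>i. integral\<^sup>L lborel (G i))"
    using integral_suminf[OF Gi nsum s'] unfolding eq set_lebesgue_integral_def .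
  also have "\<dots> = (\<Sum>i. LINT z:unit_square|lborel. F (shift i z))"
    using cell_integral(3)[OF F] unfolding G_def by simp
  finally show "(LINT z:strip|lborel. F z) = (\<Sum>i. LINT z:unit_square|lborel. F (shift i z))" .
qed

lemma quasiperiodic_shift:
  assumes q: "quasiperiodic N u"
  shows "u (x + of_int j, y) = circ (j * int N) y * u (x, y)"
proof -
  have p: "u (x + of_nat n, y) = circ (int n * int N) y * u (x, y)" for x n
  proof (induction n)
    case (Suc n)
    have "u (x + of_nat (Suc n), y) = u ((x + of_nat n) + 1, y)" by (simp add: add.commute add.left_commute)
    also have "\<dots> = circ (int N) y * (circ (int n * int N) y * u (x, y))"
      by (simp only: quasiperiodic_x[OF q] Suc)
    finally show ?case by (simp add: algebra_simps circ_add)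
  qed simp
  show ?thesis
  proof (cases j)
    case (nonneg n)
    then show ?thesis using p by simp
  next
    case (neg n)
    have "circ (j * int N) y * u (x, y) = circ (j * int N) y * u ((x + of_int j) + of_nat (Suc n), y)"
      using neg by simp
    also have "\<dots> = (circ (j * int N) y * circ (int (Suc n) * int N) y) * u (x + of_int j, y)"
      by (simp only: p mult.assoc)
    also have "circ (j * int N) y * circ (int (Suc n) * int N) y = 1"
      by (simp only: neg circ_add[symmetric] mult_minus_left left_minus circ_0)
    finally show ?thesis by simp
  qed
qed

lemma square_integrable_imp_integrable:
  fixes u :: "real \<times> real \<Rightarrow> complex"
  assumes [measurable]: "u \<in> borel_measurable borel" 
    and sq: "set_integrable lborel unit_square (\<lambda>z. (norm (u z))\<^sup>2)"
  shows "set_integrable lborel unit_square u"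
proof -
  have "set_integrable lborel unit_square (\<lambda>z. 1 + (norm (u z))\<^sup>2)"
    by (intro set_integral_add sq set_integrable_unit_square_continuous continuous_intros)
  then show "set_integrable lborel unit_square u"
    unfolding set_integrable_def
  proof (rule Bochner_Integration.integrable_bound)
    show "AE z in lborel. norm (indicat_real unit_square z *\<^sub>R u z) \<le> norm (indicat_real unit_square z *\<^sub>R (1 + (norm (u z))\<^sup>2))"
    proof (rule AE_I2)
      fix z
      have "norm (u z) \<le> 1 + (norm (u z))\<^sup>2"
        using zero_le_power2[of "norm (u z) - 1"] by (simp add: power2_eq_square algebra_simps) (smt (verit) norm_ge_zero)
      then show "norm (indicat_real unit_square z *\<^sub>R u z) \<le> norm (indicat_real unit_square z *\<^sub>R (1 + (norm (u z))\<^sup>2))"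
        by (auto simp: indicator_def)
    qed
  qed measurable
qed

lemma L2_sectionsD:
  assumes "u \<in> L2_sections N"
  shows "u \<in> borel_measurable borel" "quasiperiodic N u" 
    "set_integrable lborel unit_square (\<lambda>z. (norm (u z))\<^sup>2)"
    "set_integrable lborel unit_square (\<lambda>z. norm (u z))" "set_integrable lborel unit_square u"
proof -
  show [measurable]: "u \<in> borel_measurable borel" and "quasiperiodic N u" 
    and sq: "set_integrable lborel unit_square (\<lambda>z. (norm (u z))\<^sup>2)"
    using assms by (auto simp: L2_sections_def)
  show "set_integrable lborel unit_square u"
    by (rule square_integrable_imp_integrable) fact+
  then show "set_integrable lborel unit_square (\<lambda>z. norm (u z))"
    by (rule set_integrable_norm)
qed

text \<open>The modulus of \<open>u\<close> is periodic in x, so the decay of \<open>h\<close> alone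
  supplies the summable weight; 4 is 2(1 + 1^2) from \<open>decay_shift_le\<close> with |x| \<le>
  1.\<close>

lemma section_shift_bound:
  assumes u: "u \<in> L2_sections N" and h: "\<And>x. norm (h x) \<le> C / (1 + x\<^sup>2)"
    and z: "z \<in> unit_square"
  shows "norm (u (shift i z) * h (fst (shift i z)) * circ n (snd z)) \<le> norm (u z) * (4 * C * cell_weight i)"
proof -
  obtain x y where [simp]: "z = (x, y)" by (cases z)
  let ?j = "real_of_int (int_decode i)"
  have x: "\<bar>x\<bar> \<le> 1" using z by auto
  have C: "0 \<le> C" using order.trans[OF norm_ge_zero h[of 0]] by simp
  have "u (x, y) = circ (int_decode i * int N) y * u (x - ?j, y)"
    using quasiperiodic_shift[OF L2_sectionsD(2)[OF u], of "x - ?j" "int_decode i" y] by simp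
  then have nu: "norm (u (x - ?j, y)) = norm (u (x, y))" by (simp add: norm_mult)
  have "norm (h (x - ?j)) \<le> C * (1 / (1 + (x - ?j)\<^sup>2))" using h[of "x - ?j"] by simp
  also have "\<dots> \<le> C * (2 * (1 + 1\<^sup>2) / (1 + ?j\<^sup>2))" by (intro mult_left_mono decay_shift_le x C)
  also have "\<dots> = 4 * C * cell_weight i" by (simp add: cell_weight_def)
  finally show ?thesis using nu by (simp add: norm_mult mult_left_mono)
qed

lemma section_strip:
  fixes n :: int
  assumes u: "u \<in> L2_sections N" and [measurable]: "h \<in> borel_measurable borel" 
    and h: "\<And>x. norm (h x) \<le> C / (1 + x\<^sup>2)"
  defines "F \<equiv> \<lambda>z. u z * h (fst z) * circ n (snd z)"
  shows "set_integrable lborel strip F"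
    and "(LINT z:strip|lborel. F z) = (LINT z:unit_square|lborel. (\<Sum>i. F (shift i z)))"
proof -
  note um[measurable] = L2_sectionsD(1)[OF u]
  have fm[measurable]: "fst \<in> borel_measurable (borel :: (real \<times> real) measure)" 
      "snd \<in> borel_measurable (borel :: (real \<times> real) measure)"
    by (intro borel_measurable_continuous_onI continuous_intros)+
  have Fm[measurable]: "F \<in> borel_measurable borel" unfolding F_def by measurable
  have sm[measurable]: "(\<lambda>z. F (shift i z)) \<in> borel_measurable borel" for i
    by (rule measurable_compose[OF _ Fm]) (simp add: borel_prod[symmetric])
  have C: "0 \<le> C" using order.trans[OF norm_ge_zero h[of 0]] by simp
  have bound: "norm (indicat_real unit_square z *\<^sub>R F (shift i z)) \<le> indicat_real unit_square z *\<^sub>R (norm (u z) * (4 * C * cell_weight i))" for i z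
    using section_shift_bound[OF u h, where z = z and i = i and n = n] by (auto simp: F_def indicator_def)
  have ui: "integrable lborel (\<lambda>z. indicat_real unit_square z *\<^sub>R (norm (u z) * (4 * C * cell_weight i)))" for i
    using set_integrable_mult_left[of "4 * C * cell_weight i" lborel unit_square "\<lambda>z. norm (u z)"] L2_sectionsD(4)[OF u]
    by (simp add: set_integrable_def)
  have Fi: "set_integrable lborel unit_square (\<lambda>z. F (shift i z))" for i
    unfolding set_integrable_def
  proof (rule Bochner_Integration.integrable_bound[OF ui[of i]])
    show "AE z in lborel. norm (indicat_real unit_square z *\<^sub>R F (shift i z)) \<le> norm (indicat_real unit_square z *\<^sub>R (norm (u z) * (4 * C * cell_weight i)))"
      by (rule AE_I2, unfold real_norm_def, rule order.trans[OF bound abs_ge_self])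
  qed measurable
  have s: "summable (\<lambda>i. c * (4 * C * cell_weight i))" for c by (intro summable_mult summable_cell_weight)
  have sF: "summable (\<lambda>i. LINT z:unit_square|lborel. norm (F (shift i z)))"
  proof (rule summable_comparison_test'[OF s])
    fix i
    have "(LINT z:unit_square|lborel. norm (F (shift i z))) \<le> (LINT z:unit_square|lborel. norm (u z) * (4 * C * cell_weight i))"
      unfolding set_lebesgue_integral_def
    proof (rule integral_mono)
      show "integrable lborel (\<lambda>z. indicat_real unit_square z *\<^sub>R norm (F (shift i z)))"
        using set_integrable_norm[OF Fi[of i]] by (simp add: set_integrable_def)
      show "indicat_real unit_square z *\<^sub>R norm (F (shift i z)) \<le> indicat_real unit_square z *\<^sub>R (norm (u z) * (4 * C * cell_weight i))" for z
        using bound[of z i] by simp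
    qed (rule ui)
    moreover have "0 \<le> (LINT z:unit_square|lborel. norm (F (shift i z)))"
      unfolding set_lebesgue_integral_def by (intro integral_nonneg_AE) auto
    ultimately show "norm (LINT z:unit_square|lborel. norm (F (shift i z))) \<le> (LINT z:unit_square|lborel. norm (u z)) * (4 * C * cell_weight i)"
      by simp
  qed
  show "set_integrable lborel strip F" by (rule strip_unfold(1)[OF Fm Fi sF])
  have "(LINT z:unit_square|lborel. (\<Sum>i. F (shift i z))) = (LINT z|lborel. (\<Sum>i. indicat_real unit_square z *\<^sub>R F (shift i z)))"
    unfolding set_lebesgue_integral_def
    by (intro Bochner_Integration.integral_cong refl) (auto simp: indicator_def)
  also have "\<dots> = (\<Sum>i. LINT z|lborel. indicat_real unit_square z *\<^sub>R F (shift i z))"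
  proof (rule integral_suminf)
    show "integrable lborel (\<lambda>z. indicat_real unit_square z *\<^sub>R F (shift i z))" for i
      using Fi[of i] by (simp add: set_integrable_def)
    show "AE z in lborel. summable (\<lambda>i. norm (indicat_real unit_square z *\<^sub>R F (shift i z)))"
    proof (rule AE_I2, rule summable_comparison_test')
      fix z show "summable (\<lambda>i. (indicat_real unit_square z * norm (u z)) * (4 * C * cell_weight i))" by (rule s)
      show "norm (norm (indicat_real unit_square z *\<^sub>R F (shift i z))) \<le> (indicat_real unit_square z * norm (u z)) * (4 * C * cell_weight i)" for i
        using bound[of z i] by (simp add: mult.assoc)
    qed
    show "summable (\<lambda>i. LINT z|lborel. norm (indicat_real unit_square z *\<^sub>R F (shift i z)))"
      using sF by (simp add: set_lebesgue_integral_def)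
  qed
  also have "\<dots> = (LINT z:strip|lborel. F z)"
    using strip_unfold(2)[OF Fm Fi sF] unfolding set_lebesgue_integral_def by simp
  finally show "(LINT z:strip|lborel. F z) = (LINT z:unit_square|lborel. (\<Sum>i. F (shift i z)))" by simp
qed

section \<open>Pairing with theta sections and completeness\<close>

lemma gauss_poly_shift_decay:
  assumes N: "N \<ge> 1"
  obtains C where "\<And>x. norm (gauss_poly N p (x - a)) * exp (t * \<bar>x\<bar>) \<le> C / (1 + x\<^sup>2)"
proof -
  obtain C where C: "C \<ge> 0" "\<And>x. norm (gauss_poly N p x) * exp (\<bar>t\<bar> * \<bar>x\<bar>) \<le> C / (1 + x\<^sup>2)"
    using gauss_poly_decay[OF N, of p "\<bar>t\<bar>"] by blast
  have "norm (gauss_poly N p (x - a)) * exp (t * \<bar>x\<bar>) \<le> (exp (\<bar>t\<bar> * \<bar>a\<bar>) * C * (2 * (1 + \<bar>a\<bar>\<^sup>2))) / (1 + x\<^sup>2)" for x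
  proof -
    have "t * \<bar>x\<bar> \<le> \<bar>t\<bar> * \<bar>x\<bar>" by (intro mult_right_mono) auto
    also have "\<dots> \<le> \<bar>t\<bar> * (\<bar>a\<bar> + \<bar>x - a\<bar>)" by (intro mult_left_mono) auto
    finally have "exp (t * \<bar>x\<bar>) \<le> exp (\<bar>t\<bar> * \<bar>a\<bar>) * exp (\<bar>t\<bar> * \<bar>x - a\<bar>)"
      by (simp add: distrib_left flip: exp_add)
    then have "norm (gauss_poly N p (x - a)) * exp (t * \<bar>x\<bar>) \<le> norm (gauss_poly N p (x - a)) * (exp (\<bar>t\<bar> * \<bar>a\<bar>) * exp (\<bar>t\<bar> * \<bar>x - a\<bar>))"
      by (rule mult_left_mono) simp
    also have "\<dots> = exp (\<bar>t\<bar> * \<bar>a\<bar>) * (norm (gauss_poly N p (x - a)) * exp (\<bar>t\<bar> * \<bar>x - a\<bar>))" by simp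
    also have "\<dots> \<le> exp (\<bar>t\<bar> * \<bar>a\<bar>) * (C * (1 / (1 + (a - x)\<^sup>2)))"
      using C(2)[of "x - a"] by (intro mult_left_mono) (auto simp: power2_commute)
    also have "\<dots> \<le> exp (\<bar>t\<bar> * \<bar>a\<bar>) * (C * (2 * (1 + \<bar>a\<bar>\<^sup>2) / (1 + x\<^sup>2)))"
      by (intro mult_left_mono decay_shift_le C(1)) auto
    finally show ?thesis by simp
  qed
  then show ?thesis using that by blast
qed

lemma mode_eq: "mode N p n z = gauss_poly N p (fst z - of_int n / real N) * circ n (snd z)"
  by (cases z) (simp add: mode_def)

text \<open>Unfolding: under integer translations in x, \<open>u\<close> and the modes acquire the
  same phase, which cancels in the product with the conjugate. Pairing with the whole sum over the
  square is therefore pairing with a single mode over the strip.\<close>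

theorem sec_inner_theta:
  assumes N: "N \<ge> 1" and u: "u \<in> L2_sections N"
  shows "set_integrable lborel strip (\<lambda>z. u z * cnj (mode N p m z))"
    and "sec_inner u (theta N p m) = (LINT z:strip|lborel. u z * cnj (mode N p m z))"
proof -
  define h where "h = (\<lambda>x. cnj (gauss_poly N p (x - of_int m / real N)))"
  have hm: "h \<in> borel_measurable borel" unfolding h_def
    by (intro borel_measurable_continuous_onI continuous_intros)
  obtain C where C: "norm (gauss_poly N p (x - of_int m / real N)) * exp (0 * \<bar>x\<bar>) \<le> C / (1 + x\<^sup>2)" for x
    using gauss_poly_shift_decay[OF N] by blast
  have h: "norm (h x) \<le> C / (1 + x\<^sup>2)" for x using C[of x] by (simp add: h_def)
  have F: "u z * cnj (mode N p m z) = u z * h (fst z) * circ (- m) (snd z)" for z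
    by (simp add: mode_eq h_def)
  show "set_integrable lborel strip (\<lambda>z. u z * cnj (mode N p m z))"
    unfolding F by (rule section_strip(1)[OF u hm h])
  have sh: "u (shift i z) * cnj (mode N p m (shift i z)) = u z * cnj (mode N p (mode_index N m i) z)" for i z
  proof -
    obtain x y where [simp]: "z = (x, y)" by (cases z)
    let ?j = "int_decode i"
    have "u (x, y) = circ (?j * int N) y * u (x - of_int ?j, y)"
      using quasiperiodic_shift[OF L2_sectionsD(2)[OF u], of "x - of_int ?j" ?j y] by simp
    moreover have "mode N p (mode_index N m i) (x, y) = circ (?j * int N) y * mode N p m (x - of_int ?j, y)"
      unfolding mode_index_def by (rule mode_shift[OF N])
    ultimately show ?thesis by (simp only: circ_mult_cnj fst_conv snd_conv \<open>z = (x, y)\<close>)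
  qed
  have "u z * cnj (theta N p m z) = (\<Sum>i. u z * cnj (mode N p (mode_index N m i) z))" for z
    by (intro sums_unique sums_mult sums_cnj[THEN iffD2] theta_sums N)
  then have "sec_inner u (theta N p m) = (LINT z:unit_square|lborel. (\<Sum>i. u (shift i z) * cnj (mode N p m (shift i z))))"
    unfolding sec_inner_def sh by simp
  also have "\<dots> = (LINT z:strip|lborel. u z * cnj (mode N p m z))"
    unfolding F using section_strip(2)[OF u hm h, of "- m"] by simp
  finally show "sec_inner u (theta N p m) = (LINT z:strip|lborel. u z * cnj (mode N p m z))" .
qed

lemma strip_fubini:
  fixes g :: "real \<times> real \<Rightarrow> complex"
  assumes g: "set_integrable lborel strip g"
  shows "(LINT z:strip|lborel. g z) = (LINT x|lborel. (LINT y:{0..1}|lborel. g (x, y)))"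
    and "integrable lborel (\<lambda>x. (LINT y:{0..1}|lborel. g (x, y)))"
    and "AE x in lborel. set_integrable lborel {0..1} (\<lambda>y. g (x, y))"
proof -
  let ?f = "\<lambda>z. indicat_real strip z *\<^sub>R g z"
  have i: "integrable (lborel \<Otimes>\<^sub>M lborel) ?f" using g by (simp add: set_integrable_def lborel_prod)
  have ind: "indicat_real strip (x, y) = indicat_real {0..1} y" for x y :: real by (simp add: indicator_def)
  show "(LINT z:strip|lborel. g z) = (LINT x|lborel. (LINT y:{0..1}|lborel. g (x, y)))"
    using lborel_pair.integral_fst'[OF i] by (simp add: set_lebesgue_integral_def lborel_prod ind)
  show "integrable lborel (\<lambda>x. (LINT y:{0..1}|lborel. g (x, y)))"
    using lborel_pair.integrable_fst'[OF i] by (simp add: set_lebesgue_integral_def ind)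
  show "AE x in lborel. set_integrable lborel {0..1} (\<lambda>y. g (x, y))"
    using lborel_pair.AE_integrable_fst'[OF i] by (simp add: set_integrable_def ind)
qed

text \<open>Integrating out y leaves the m-th coefficient \<open>a\<close> on the line. By the
  hypothesis it is orthogonal to the Gaussian centred at m / N times any polynomial, so the Gaussian
  times \<open>a\<close> has vanishing moments.\<close>

lemma L2_section_circ_coeff:
  assumes N: "N \<ge> 1" and u: "u \<in> L2_sections N" 
    and 0: "\<And>k. sec_inner u (theta N (herm_poly N k) m) = 0"
  shows "AE x in lborel. (LINT y:{0..1}|lborel. u (x, y) * circ (- m) y) = 0"
proof -
  define a where "a = (\<lambda>x. LINT y:{0..1}|lborel. u (x, y) * circ (- m) y)"
  define c where "c = real_of_int m / real N"
  \<comment> \<open>Nothing makes \<open>a\<close> itself integrable on the line, so it is always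
    accompanied by a weight of quadratic decay.\<close>
  have fub: "integrable lborel (\<lambda>x. h x * a x) \<and>
      (LINT z:strip|lborel. u z * h (fst z) * circ (- m) (snd z)) = (LINT x|lborel. h x * a x)"
    if hm: "h \<in> borel_measurable borel" and h: "\<And>x. norm (h x) \<le> C / (1 + x\<^sup>2)" for h C
  proof -
    have "(LINT y:{0..1}|lborel. u (x, y) * h x * circ (- m) y) = (LINT y:{0..1}|lborel. h x * (u (x, y) * circ (- m) y))" for x
      by (simp add: mult_ac)
    then have "(LINT y:{0..1}|lborel. u (x, y) * h x * circ (- m) y) = h x * a x" for x
      unfolding a_def by (simp only: set_integral_mult_right)
    then show ?thesis
      using strip_fubini(1,2)[OF section_strip(1)[OF u hm h, of "- m"]] by simp
  qed
  have J: "(LINT z:strip|lborel. u z * cnj (mode N q m z)) = 0" for q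
  proof (rule herm_poly_induct[OF N])
    show "(LINT z:strip|lborel. u z * cnj (mode N (herm_poly N k) m z)) = 0" for k
      using 0[of k] sec_inner_theta(2)[OF N u] by simp
  next
    fix p q assume "(LINT z:strip|lborel. u z * cnj (mode N p m z)) = 0" "(LINT z:strip|lborel. u z * cnj (mode N q m z)) = 0"
    moreover have "u z * cnj (mode N (p + q) m z) = u z * cnj (mode N p m z) + u z * cnj (mode N q m z)" for z
      by (simp add: mode_eq gauss_poly_add algebra_simps)
    ultimately show "(LINT z:strip|lborel. u z * cnj (mode N (p + q) m z)) = 0"
      using sec_inner_theta(1)[OF N u] by simp
  next
    fix d p assume "(LINT z:strip|lborel. u z * cnj (mode N p m z)) = 0"
    moreover have "u z * cnj (mode N (smult d p) m z) = cnj d * (u z * cnj (mode N p m z))" for z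
      by (simp add: mode_eq gauss_poly_smult algebra_simps)
    ultimately show "(LINT z:strip|lborel. u z * cnj (mode N (smult d p) m z)) = 0"
      by (simp only: set_integral_mult_right mult_zero_right)
  qed
  define g where "g = (\<lambda>x. gauss_poly N 1 (x - c) * a x)"
  have "AE x in lborel. g x = 0"
  proof (rule moments_unique)
    fix t
    obtain C where C: "norm (gauss_poly N 1 (x - c)) * exp (t * \<bar>x\<bar>) \<le> C / (1 + x\<^sup>2)" for x
      using gauss_poly_shift_decay[OF N] by blast
    have "integrable lborel (\<lambda>x. (of_real (exp (t * \<bar>x\<bar>)) * gauss_poly N 1 (x - c)) * a x)"
    proof (rule conjunct1[OF fub])
      show "(\<lambda>x. complex_of_real (exp (t * \<bar>x\<bar>)) * gauss_poly N 1 (x - c)) \<in> borel_measurable borel"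
        by (intro borel_measurable_continuous_onI continuous_intros)
      show "norm (complex_of_real (exp (t * \<bar>x\<bar>)) * gauss_poly N 1 (x - c)) \<le> C / (1 + x\<^sup>2)" for x
        using C[of x] by (simp add: norm_mult mult.commute)
    qed
    then show "integrable lborel (\<lambda>x. exp (t * \<bar>x\<bar>) *\<^sub>R g x)"
      by (simp add: g_def scaleR_conv_of_real mult.assoc)
  next
    fix k
    \<comment> \<open>Evaluated at x - c this polynomial is x^k, so moments about 0 are reached
      although the Gaussian is centred at \<open>c\<close>.\<close>
    define q where "q = [:complex_of_real c, 1:] ^ k"
    define h where "h = (\<lambda>x. cnj (gauss_poly N q (x - c)))"
    have hx: "h x = of_real x ^ k * gauss_poly N 1 (x - c)" for x
      by (simp add: h_def q_def gauss_poly_def poly_power)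
    obtain C where "norm (gauss_poly N q (x - c)) * exp (0 * \<bar>x\<bar>) \<le> C / (1 + x\<^sup>2)" for x
      using gauss_poly_shift_decay[OF N] by blast
    then have C: "norm (h x) \<le> C / (1 + x\<^sup>2)" for x by (simp add: h_def)
    have hm: "h \<in> borel_measurable borel"
      unfolding h_def by (intro borel_measurable_continuous_onI continuous_intros)
    have "(LINT x|lborel. h x * a x) = (LINT z:strip|lborel. u z * cnj (mode N q m z))"
      unfolding conjunct2[OF fub[OF hm C], symmetric] by (simp add: mode_eq h_def c_def mult.assoc)
    then show "(LINT x|lborel. of_real x ^ k * g x) = 0"
      by (simp add: J hx g_def mult.assoc)
  qed
  then show ?thesis
  proof eventually_elim
    case (elim x)
    have "gauss_poly N 1 (x - c) \<noteq> 0" by (simp add: gauss_poly_def)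
    with elim show ?case by (simp add: g_def a_def)
  qed
qed

text \<open>For almost every x all Fourier coefficients of \<open>u (x, y)\<close> in y vanish, so
  uniqueness on the circle makes \<open>u\<close> vanish on the strip; periodicity in y spreads this
  over the plane.\<close>

theorem theta_complete:
  assumes N: "N \<ge> 1" and u: "u \<in> L2_sections N" 
    and 0: "\<And>k m. sec_inner u (theta N (herm_poly N k) m) = 0"
  shows "AE z in lborel. u z = 0"
proof -
  note um[measurable] = L2_sectionsD(1)[OF u]
  have coeff: "AE x in lborel. \<forall>n. (LINT y:{0..1}|lborel. u (x, y) * circ n y) = 0"
    unfolding AE_all_countable using L2_section_circ_coeff[OF N u 0] by (metis minus_minus)
  \<comment> \<open>An auxiliary positive weight: it makes the section integrable over the strip and
    is divided out again once x is fixed.\<close>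
  define h where "h = (\<lambda>x::real. complex_of_real (1 / (1 + x\<^sup>2)))"
  have hm: "h \<in> borel_measurable borel" unfolding h_def
    by (intro borel_measurable_continuous_onI continuous_intros) (auto simp: add_nonneg_eq_0_iff)
  have hb: "norm (h x) \<le> 1 / (1 + x\<^sup>2)" for x
    unfolding h_def norm_of_real by (simp add: add_nonneg_nonneg)
  have h0: "h x \<noteq> 0" for x by (simp add: h_def add_nonneg_eq_0_iff del: of_real_divide) 
  have "AE x in lborel. set_integrable lborel {0..1} (\<lambda>y. u (x, y) * h x * circ 0 y)"
    using strip_fubini(3)[OF section_strip(1)[OF u hm hb, of 0]] by simp
  then have "AE x in lborel. set_integrable lborel {0..1} (\<lambda>y. u (x, y))"
  proof eventually_elim
    case (elim x)
    then show ?case using h0[of x] by simp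
  qed
  with coeff have "AE x in lborel. AE y in lborel. y \<in> {0..1} \<longrightarrow> u (x, y) = 0"
  proof eventually_elim
    case (elim x)
    then show ?case by (intro circle_unique) (simp_all add: mult.commute)
  qed
  moreover have S: "{z. snd z \<in> {0..1} \<longrightarrow> u z = 0} \<in> sets borel"
  proof -
    have "{z. snd z \<in> {0..1} \<longrightarrow> u z = 0} = - strip \<union> (u -` {0} \<inter> space borel)" by auto
    also have "\<dots> \<in> sets borel" by (intro sets.Un borel_comp measurable_sets[OF um]) auto
    finally show ?thesis .
  qed
  ultimately have "AE z in lborel \<Otimes>\<^sub>M lborel. snd z \<in> {0..1} \<longrightarrow> u z = 0"
    by (intro lborel_pair.AE_pair_measure) (simp_all only: lborel_prod space_lborel space_borel sets_lborel UNIV_I simp_thms snd_conv)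
  then have ae: "AE z in lborel. snd z \<in> {0..1} \<longrightarrow> u z = 0"
    unfolding lborel_prod .
  have per: "u (x, y + of_int n) = u (x, y)" for x y n
  proof -
    have p: "u (x, y + of_nat n) = u (x, y)" for y n
    proof (induction n)
      case (Suc n)
      have "u (x, y + of_nat (Suc n)) = u (x, (y + of_nat n) + 1)" by (simp add: add.commute add.left_commute)
      then show ?case using Suc quasiperiodic_y[OF L2_sectionsD(2)[OF u]] by metis
    qed simp
    show ?thesis
    proof (cases n rule: int_cases2)
      case (nonneg k)
      then show ?thesis using p by simp
    next
      case (nonpos k)
      then show ?thesis using p[of "y + of_int n" k] by simp
    qed
  qed
  \<comment> \<open>Translation by (0, n) preserves Lebesgue measure, so \<open>u\<close> vanishes
    almost everywhere on every translated strip; these strips cover the plane.\<close>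
  have "AE z in lborel. snd z + of_int n \<in> {0..1} \<longrightarrow> u z = 0" for n
  proof -
    have "AE z in distr lborel borel ((+) (0, real_of_int n)). snd z \<in> {0..1} \<longrightarrow> u z = 0"
      using ae unfolding lborel_distr_plus .
    then have "AE z in lborel. snd ((0, real_of_int n) + z) \<in> {0..1} \<longrightarrow> u ((0, real_of_int n) + z) = 0"
      using S by (subst (asm) AE_distr_iff) auto
    then show ?thesis
    proof eventually_elim
      case (elim z)
      then show ?case using per[of "fst z" "snd z" n] by (cases z) (simp add: add.commute)
    qed
  qed
  then have "AE z in lborel. \<forall>n::int. snd z + of_int n \<in> {0..1} \<longrightarrow> u z = 0"
    unfolding AE_all_countable by blast
  then show ?thesis
  proof eventually_elim
    case (elim z)
    have "snd z + of_int (- \<lfloor>snd z\<rfloor>) \<in> {0..1}" by (simp; linarith)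
    then show ?case using elim by blast
  qed
qed

section \<open>Orthogonality of theta sections\<close>

lemma integral_circ: "(LINT y:{0..1}|lborel. circ n y) = (if n = 0 then 1 else 0)"
proof (cases "n = 0")
  case True
  then show ?thesis by (simp add: set_lebesgue_integral_def)
next
  case False
  let ?c = "2 * of_real pi * \<i> * of_int n :: complex"
  have c: "?c \<noteq> 0" using False by simp
  have "(LINT y|lborel. indicator {0..1} y *\<^sub>R circ n y) = circ n 1 / ?c - circ n 0 / ?c"
  proof (rule integral_FTC_atLeastAtMost)
    fix y :: real
    have "((\<lambda>z. exp (?c * z) / ?c) has_field_derivative exp (?c * of_real y)) (at (of_real y))"
      using c by (auto intro!: derivative_eq_intros)
    from has_vector_derivative_real_field[OF this]
    show "((\<lambda>y. circ n y / ?c) has_vector_derivative circ n y) (at y within {0..1})"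
      by (simp add: circ_def)
    show "continuous_on {0..1} (circ n)" by (intro continuous_intros)
  qed simp
  moreover have "circ n 1 = 1" using exp_integer_2pi[of "of_int n"] by (simp add: circ_def mult_ac)
  moreover have "circ n 0 = 1" by (simp add: circ_def)
  ultimately show ?thesis using False by (simp add: set_lebesgue_integral_def)
qed

text \<open>Among the frequencies m + jN only j = 0 can give m', since |m - m'| < N. The y-integral
  thus selects at most one Gaussian from the sum.\<close>

lemma theta_circ_coeff:
  assumes N: "N \<ge> 1" and m: "\<bar>m - m'\<bar> < int N"
  shows "(LINT y:{0..1}|lborel. theta N p m (x, y) * circ (- m') y) = 
    (if m = m' then gauss_poly N p (x - of_int m / real N) else 0)"
proof -
  define f where "f = (\<lambda>i y. indicat_real {0..1} y *\<^sub>R (mode N p (mode_index N m i) (x, y) * circ (- m') y))"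
  obtain C where C: "C \<ge> 0" "\<And>x' y i. \<bar>x'\<bar> \<le> \<bar>x\<bar> \<Longrightarrow> norm (mode N p (mode_index N m i) (x', y)) \<le> C * cell_weight i"
    using mode_bound[OF N, where R = "\<bar>x\<bar>" and m = m and p = p] by blast
  have b: "norm (f i y) \<le> indicat_real {0..1} y * (C * cell_weight i)" for i y
    using C(2)[of x i y] by (simp add: f_def norm_mult mult_left_mono)
  have f_eq: "f i y = gauss_poly N p (x - of_int (mode_index N m i) / real N) * (indicat_real {0..1} y *\<^sub>R circ (mode_index N m i - m') y)" for i y
    by (simp add: f_def mode_def circ_add[symmetric] scaleR_conv_of_real mult_ac flip: diff_conv_add_uminus)
  have ci: "integrable lborel (\<lambda>y. indicat_real {0..1} y *\<^sub>R circ n y)" for n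
    by (rule borel_integrable_compact) (auto intro!: continuous_intros)
  have fi: "integrable lborel (f i)" for i
    unfolding f_eq by (intro integrable_mult_right ci)
  have If: "integral\<^sup>L lborel (f i) = (if i = int_encode 0 then (if m = m' then gauss_poly N p (x - of_int m / real N) else 0) else 0)" for i
  proof -
    have "integral\<^sup>L lborel (f i) = gauss_poly N p (x - of_int (mode_index N m i) / real N) * (LINT y:{0..1}|lborel. circ (mode_index N m i - m') y)"
      unfolding f_eq set_lebesgue_integral_def by (rule integral_mult_right_zero)
    also have "\<dots> = gauss_poly N p (x - of_int (mode_index N m i) / real N) * (if mode_index N m i = m' then 1 else 0)"
      by (simp add: integral_circ)
    finally have 1: "integral\<^sup>L lborel (f i) = gauss_poly N p (x - of_int (mode_index N m i) / real N) * (if mode_index N m i = m' then 1 else 0)" .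
    show ?thesis
    proof (cases "mode_index N m i = m'")
      case True
      then have "m - m' = - int_decode i * int N" by (simp add: mode_index_def)
      with m have "\<bar>int_decode i\<bar> * int N < 1 * int N" by (simp add: abs_mult)
      then have "int_decode i = 0" by (simp only: mult_less_cancel_right_disj) linarith
      then have "i = int_encode 0" by (metis int_decode_inverse)
      then show ?thesis using 1 True by (simp add: mode_index_def)
    next
      case False
      then have "i = int_encode 0 \<Longrightarrow> m \<noteq> m'" by (auto simp: mode_index_def)
      then show ?thesis using 1 False by auto
    qed
  qed
  have "(\<lambda>i. integral\<^sup>L lborel (f i)) sums (LINT y|lborel. (\<Sum>i. f i y))"
  proof (rule sums_integral[OF fi])
    show "AE y in lborel. summable (\<lambda>i. norm (f i y))"
    proof (rule AE_I2, rule summable_comparison_test')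
      show "summable (\<lambda>i. indicat_real {0..1} y * (C * cell_weight i))" for y by (intro summable_mult summable_cell_weight)
    qed (use b in simp)
    show "summable (\<lambda>i. LINT y|lborel. norm (f i y))"
    proof (rule summable_comparison_test')
      show "summable (\<lambda>i. C * cell_weight i)" by (intro summable_mult summable_cell_weight)
      fix i
      have "(LINT y|lborel. norm (f i y)) \<le> (LINT y|lborel. indicat_real {0..1::real} y * (C * cell_weight i))"
      proof (rule Bochner_Integration.integral_mono)
        show "integrable lborel (\<lambda>y. norm (f i y))" by (rule integrable_norm[OF fi])
      qed (use b in auto)
      then show "norm (LINT y|lborel. norm (f i y)) \<le> C * cell_weight i" by simp
    qed
  qed
  moreover have "(\<lambda>i. integral\<^sup>L lborel (f i)) sums (if m = m' then gauss_poly N p (x - of_int m / real N) else 0)"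
    unfolding If by (rule sums_single)
  ultimately have "(LINT y|lborel. (\<Sum>i. f i y)) = (if m = m' then gauss_poly N p (x - of_int m / real N) else 0)"
    by (rule sums_unique2)
  moreover have "(\<Sum>i. f i y) = indicat_real {0..1} y *\<^sub>R (theta N p m (x, y) * circ (- m') y)" for y
    unfolding f_def by (intro sums_unique[symmetric] sums_scaleR_right sums_mult2 theta_sums N)
  ultimately show ?thesis by (simp add: set_lebesgue_integral_def)
qed

lemma smooth_section_L2:
  assumes "u \<in> smooth_sections N"
  shows "u \<in> L2_sections N"
proof -
  have c: "continuous_on UNIV u" and q: "quasiperiodic N u"
    using assms by (auto simp: smooth_sections_def smooth_continuous)
  have "set_integrable lborel unit_square (\<lambda>z. (norm (u z))\<^sup>2)"
    by (intro set_integrable_unit_square_continuous continuous_intros c)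
  then show ?thesis using c q by (simp add: L2_sections_def borel_measurable_continuous_onI)
qed

lemma sec_inner_theta_theta:
  assumes N: "N \<ge> 1" and m: "\<bar>m - m'\<bar> < int N"
  shows "sec_inner (theta N p m) (theta N q m') = (if m = m' then
     (LINT x|lborel. gauss_poly N p (x - of_int m / real N) * cnj (gauss_poly N q (x - of_int m / real N))) else 0)"
    and "integrable lborel (\<lambda>x. gauss_poly N p (x - of_int m / real N) * cnj (gauss_poly N q (x - of_int m / real N)))"
proof -
  have L: "theta N p m \<in> L2_sections N" for m by (intro smooth_section_L2 theta_smooth_section N)
  have eq: "(LINT y:{0..1}|lborel. theta N p m (x, y) * cnj (mode N q m' (x, y))) =
     cnj (gauss_poly N q (x - of_int m' / real N)) * (if m = m' then gauss_poly N p (x - of_int m / real N) else 0)"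
    if "\<bar>m - m'\<bar> < int N" for x m m'
  proof -
    have "(LINT y:{0..1}|lborel. theta N p m (x, y) * cnj (mode N q m' (x, y))) =
      (LINT y:{0..1}|lborel. cnj (gauss_poly N q (x - of_int m' / real N)) * (theta N p m (x, y) * circ (- m') y))"
      by (simp add: mode_def mult_ac)
    also have "\<dots> = cnj (gauss_poly N q (x - of_int m' / real N)) * (LINT y:{0..1}|lborel. theta N p m (x, y) * circ (- m') y)"
      by (rule set_integral_mult_right)
    finally show ?thesis by (simp only: theta_circ_coeff[OF N that])
  qed
  show "sec_inner (theta N p m) (theta N q m') = (if m = m' then
     (LINT x|lborel. gauss_poly N p (x - of_int m / real N) * cnj (gauss_poly N q (x - of_int m / real N))) else 0)"
    unfolding sec_inner_theta(2)[OF N L] strip_fubini(1)[OF sec_inner_theta(1)[OF N L]] eq[OF m]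
    by (auto simp: mult.commute)
  have "\<bar>m - m\<bar> < int N" using N by simp
  from strip_fubini(2)[OF sec_inner_theta(1)[OF N L[of m], of q m]]
  show "integrable lborel (\<lambda>x. gauss_poly N p (x - of_int m / real N) * cnj (gauss_poly N q (x - of_int m / real N)))"
    unfolding eq[OF \<open>\<bar>m - m\<bar> < int N\<close>] by (simp add: mult.commute)
qed

text \<open>Vanishing would force a Gaussian times a nonzero polynomial to be 0 almost everywhere on
  the line, but it has only finitely many zeros.\<close>

lemma sec_inner_theta_self:
  assumes N: "N \<ge> 1" and p: "p \<noteq> 0"
  shows "sec_inner (theta N p m) (theta N p m) \<noteq> 0"
proof
  assume 0: "sec_inner (theta N p m) (theta N p m) = 0"
  let ?c = "of_int m / real N"
  let ?g = "\<lambda>x. (norm (gauss_poly N p (x - ?c)))\<^sup>2"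
  have m: "\<bar>m - m\<bar> < int N" using N by simp
  have eq: "gauss_poly N p (x - ?c) * cnj (gauss_poly N p (x - ?c)) = of_real (?g x)" for x
    by (rule complex_norm_square[symmetric])
  have i: "integrable lborel ?g"
    using sec_inner_theta_theta(2)[OF N m, of p p] unfolding eq by (simp only: complex_of_real_integrable_eq)
  have "complex_of_real (integral\<^sup>L lborel ?g) = 0"
    using sec_inner_theta_theta(1)[OF N m, of p p] unfolding eq 0 integral_complex_of_real if_True refl
    by (simp only: simp_thms if_True)
  then have "integral\<^sup>L lborel ?g = 0" by simp
  then have ae: "AE x in lborel. gauss_poly N p (x - ?c) = 0"
    using integral_nonneg_eq_0_iff_AE[OF i] by simp
  have "finite {z. poly p z = 0}" by (rule poly_roots_finite[OF p])
  then have "finite ((\<lambda>x. complex_of_real (x - ?c)) -` {z. poly p z = 0})"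
    by (rule finite_vimageI) (simp add: inj_on_def)
  then have "((\<lambda>x. complex_of_real (x - ?c)) -` {z. poly p z = 0}) \<in> null_sets lborel"
    by (rule finite_imp_null_set_lborel)
  then have "AE x in lborel. x \<notin> ((\<lambda>x. complex_of_real (x - ?c)) -` {z. poly p z = 0})"
    by (rule AE_not_in)
  with ae have "AE x in (lborel :: real measure). False"
    by eventually_elim (simp add: gauss_poly_def)
  then obtain M where "{x \<in> space lborel. \<not> False} \<subseteq> M" and M: "emeasure lborel M = 0" and "M \<in> sets (lborel :: real measure)"
    by (rule AE_E)
  then have "M = (UNIV :: real set)" by auto
  with M show False by simp
qed

section \<open>Eigenspaces\<close>

text \<open>Quasi-periodicity is left out so that differences of approximants and images under the
  differential operator can be estimated without showing that they are sections.\<close>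

definition square_integrable :: "(real \<times> real \<Rightarrow> complex) \<Rightarrow> bool" where
  "square_integrable g \<longleftrightarrow> g \<in> borel_measurable borel \<and> set_integrable lborel unit_square (\<lambda>z. (norm (g z))\<^sup>2)"

lemma square_integrable_continuous: "continuous_on UNIV g \<Longrightarrow> square_integrable g"
  unfolding square_integrable_def
  by (intro conjI borel_measurable_continuous_onI set_integrable_unit_square_continuous continuous_intros)

lemma L2_sections_iff: "u \<in> L2_sections N \<longleftrightarrow> square_integrable u \<and> quasiperiodic N u"
  by (auto simp: L2_sections_def square_integrable_def)

lemma square_integrable_cmult: "square_integrable g \<Longrightarrow> square_integrable (\<lambda>z. c * g z)"
  unfolding square_integrable_def by (auto simp: norm_mult power_mult_distrib)

lemma square_integrable_add:
  assumes f: "square_integrable f" and g: "square_integrable g"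
  shows "square_integrable (\<lambda>z. f z + g z)"
proof -
  have [measurable]: "f \<in> borel_measurable borel" "g \<in> borel_measurable borel" using f g by (auto simp: square_integrable_def)
  have "set_integrable lborel unit_square (\<lambda>z. 2 * (norm (f z))\<^sup>2 + 2 * (norm (g z))\<^sup>2)"
    using f g by (intro set_integral_add set_integrable_mult_right) (auto simp: square_integrable_def)
  then have "set_integrable lborel unit_square (\<lambda>z. (norm (f z + g z))\<^sup>2)"
    unfolding set_integrable_def
  proof (rule Bochner_Integration.integrable_bound)
    show "AE z in lborel. norm (indicat_real unit_square z *\<^sub>R (norm (f z + g z))\<^sup>2) \<le>
      norm (indicat_real unit_square z *\<^sub>R (2 * (norm (f z))\<^sup>2 + 2 * (norm (g z))\<^sup>2))"
    proof (rule AE_I2)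
      fix z
      have "(norm (f z + g z))\<^sup>2 \<le> (norm (f z) + norm (g z))\<^sup>2" by (intro power_mono norm_triangle_ineq) simp
      also have "\<dots> \<le> 2 * (norm (f z))\<^sup>2 + 2 * (norm (g z))\<^sup>2"
        using zero_le_power2[of "norm (f z) - norm (g z)"] by (simp add: power2_eq_square algebra_simps)
      finally show "norm (indicat_real unit_square z *\<^sub>R (norm (f z + g z))\<^sup>2) \<le>
        norm (indicat_real unit_square z *\<^sub>R (2 * (norm (f z))\<^sup>2 + 2 * (norm (g z))\<^sup>2))"
        by (auto simp: indicator_def)
    qed
  qed measurable
  then show ?thesis by (simp add: square_integrable_def)
qed

lemma square_integrable_sum: "(\<And>i. i \<in> A \<Longrightarrow> square_integrable (f i)) \<Longrightarrow> square_integrable (\<lambda>z. \<Sum>i\<in>A. f i z)"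
proof (induction A rule: infinite_finite_induct)
  case (insert i A)
  then show ?case by (simp add: square_integrable_add)
qed (simp_all add: square_integrable_continuous)

lemma square_integrable_diff: "square_integrable f \<Longrightarrow> square_integrable g \<Longrightarrow> square_integrable (\<lambda>z. f z - g z)"
  using square_integrable_add[of f "\<lambda>z. - 1 * g z"] square_integrable_cmult[of g "- 1"] by simp

lemma quasiperiodicI:
  "(\<And>x y. u (x + 1, y) = circ (int N) y * u (x, y)) \<Longrightarrow> (\<And>x y. u (x, y + 1) = u (x, y)) \<Longrightarrow> quasiperiodic N u"
  by (simp add: quasiperiodic_def circ_def)

lemma measure_unit_square: "measure lborel unit_square = 1"
proof -
  have "emeasure (lborel \<Otimes>\<^sub>M lborel) unit_square = emeasure lborel {0..1::real} * emeasure lborel {0..1::real}"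
    by (rule lborel.emeasure_pair_measure_Times) auto
  then show ?thesis by (simp add: lborel_prod measure_def)
qed

text \<open>The square has measure 1, so this is the nonnegativity of the variance of the modulus
  about its mean \<open>a\<close>.\<close>

lemma integral_norm_le_L2_norm:
  assumes g: "square_integrable g"
  shows "(LINT z:unit_square|lborel. norm (g z)) \<le> L2_norm g"
proof -
  define a where "a = (LINT z:unit_square|lborel. norm (g z))"
  have i2: "set_integrable lborel unit_square (\<lambda>z. (norm (g z))\<^sup>2)" using g by (simp add: square_integrable_def)
  have i1: "set_integrable lborel unit_square (\<lambda>z. norm (g z))"
    using g square_integrable_imp_integrable[of g] by (intro set_integrable_norm) (simp add: square_integrable_def)
  have i0: "set_integrable lborel unit_square (\<lambda>z. a\<^sup>2)"
    by (intro set_integrable_unit_square_continuous continuous_intros)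
  have i1': "set_integrable lborel unit_square (\<lambda>z. 2 * a * norm (g z))"
    by (intro set_integrable_mult_right) (rule i1)
  have "0 \<le> (LINT z:unit_square|lborel. (norm (g z) - a)\<^sup>2)"
    unfolding set_lebesgue_integral_def by (intro integral_nonneg_AE) auto
  also have "\<dots> = (LINT z:unit_square|lborel. (norm (g z))\<^sup>2 - 2 * a * norm (g z) + a\<^sup>2)"
    by (intro set_lebesgue_integral_cong) (auto simp: power2_diff)
  also have "\<dots> = (LINT z:unit_square|lborel. (norm (g z))\<^sup>2) - 2 * a * a + (LINT z:unit_square|lborel. a\<^sup>2)"
    using i0 i1' i2 set_integral_diff(1)[OF i2 i1']
    by (simp only: set_integral_add set_integral_diff set_integral_mult_right a_def[symmetric])
  also have "(LINT z:unit_square|lborel. a\<^sup>2) = a\<^sup>2"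
    by (simp add: set_lebesgue_integral_def measure_unit_square)
  finally have "a\<^sup>2 \<le> (LINT z:unit_square|lborel. (norm (g z))\<^sup>2)" by (simp add: power2_eq_square)
  then show ?thesis unfolding L2_norm_def a_def[symmetric] by (rule real_le_rsqrt)
qed

lemma continuous_bound_unit_square:
  fixes v :: "real \<times> real \<Rightarrow> complex"
  assumes "continuous_on UNIV v"
  obtains M where "M \<ge> 0" "\<And>z. z \<in> unit_square \<Longrightarrow> norm (v z) \<le> M"
proof -
  have "compact (v ` unit_square)"
    by (intro compact_continuous_image continuous_on_subset[OF assms] compact_Times) auto
  then have "bounded (v ` unit_square)" by (rule compact_imp_bounded)
  then obtain M where M: "M > 0" "\<forall>w\<in>v ` unit_square. norm w \<le> M" using bounded_pos by blast
  show ?thesis by (rule that[of M]) (use M in auto)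
qed

lemma sec_inner_integrable:
  assumes u: "square_integrable u" and v: "continuous_on UNIV v"
  shows "set_integrable lborel unit_square (\<lambda>z. u z * cnj (v z))"
proof -
  obtain M where M: "M \<ge> 0" "\<And>z. z \<in> unit_square \<Longrightarrow> norm (v z) \<le> M" using continuous_bound_unit_square[OF v] by blast
  have [measurable]: "u \<in> borel_measurable borel" "(\<lambda>z. cnj (v z)) \<in> borel_measurable borel" 
    using u v by (auto simp: square_integrable_def intro!: borel_measurable_continuous_onI continuous_intros)
  have "set_integrable lborel unit_square (\<lambda>z. M * norm (u z))"
    using u square_integrable_imp_integrable[of u] by (intro set_integrable_mult_right set_integrable_norm) (simp add: square_integrable_def)
  then show ?thesis
    unfolding set_integrable_def
  proof (rule Bochner_Integration.integrable_bound)
    show "AE z in lborel. norm (indicat_real unit_square z *\<^sub>R (u z * cnj (v z))) \<le> norm (indicat_real unit_square z *\<^sub>R (M * norm (u z)))"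
      using M by (intro AE_I2) (auto simp: indicator_def norm_mult mult.commute[of M] mult_left_mono)
  qed measurable
qed

lemma sec_inner_add: "square_integrable u \<Longrightarrow> square_integrable w \<Longrightarrow> continuous_on UNIV v \<Longrightarrow> sec_inner (\<lambda>z. u z + w z) v = sec_inner u v + sec_inner w v"
  unfolding sec_inner_def by (simp add: distrib_right sec_inner_integrable set_integral_add)

lemma sec_inner_diff: "square_integrable u \<Longrightarrow> square_integrable w \<Longrightarrow> continuous_on UNIV v \<Longrightarrow> sec_inner (\<lambda>z. u z - w z) v = sec_inner u v - sec_inner w v"
  unfolding sec_inner_def by (simp add: left_diff_distrib sec_inner_integrable set_integral_diff)

lemma sec_inner_cmult: "sec_inner (\<lambda>z. c * u z) v = c * sec_inner u v"
  unfolding sec_inner_def mult.assoc by (rule set_integral_mult_right)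

lemma sec_inner_cmult_right: "sec_inner u (\<lambda>z. c * v z) = cnj c * sec_inner u v"
  unfolding sec_inner_def complex_cnj_mult mult.left_commute[of _ "cnj c"] by (rule set_integral_mult_right)

lemma sec_inner_sum: 
  assumes "\<And>i. i \<in> A \<Longrightarrow> square_integrable (f i)" "continuous_on UNIV v"
  shows "sec_inner (\<lambda>z. \<Sum>i\<in>A. f i z) v = (\<Sum>i\<in>A. sec_inner (f i) v)"
  using assms(1)
proof (induction A rule: infinite_finite_induct)
  case (insert i A)
  then show ?case by (simp add: sec_inner_add square_integrable_sum assms(2))
qed (simp_all add: sec_inner_def set_lebesgue_integral_def)

lemma sec_inner_cong_AE:
  assumes "square_integrable u" "square_integrable w" "continuous_on UNIV v" "AE z in lborel. u z = w z"
  shows "sec_inner u v = sec_inner w v"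
proof -
  have "AE z in lborel. indicat_real unit_square z *\<^sub>R (u z * cnj (v z)) = indicat_real unit_square z *\<^sub>R (w z * cnj (v z))"
    using assms(4) by eventually_elim simp
  moreover have "(\<lambda>z. indicat_real unit_square z *\<^sub>R (u z * cnj (v z))) \<in> borel_measurable lborel"
    "(\<lambda>z. indicat_real unit_square z *\<^sub>R (w z * cnj (v z))) \<in> borel_measurable lborel"
    using sec_inner_integrable[OF assms(1,3)] sec_inner_integrable[OF assms(2,3)]
    by (auto simp: set_integrable_def)
  ultimately show ?thesis
    unfolding sec_inner_def set_lebesgue_integral_def by (intro integral_cong_AE)
qed

text \<open>L2 convergence implies L1 convergence on the unit square, and a continuous
  \<open>v\<close> is bounded there. This carries identities from smooth approximants to the domain
  of the closure.\<close>

lemma sec_inner_tendsto: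
  assumes w: "\<And>n. square_integrable (w n)" and u: "square_integrable u" and v: "continuous_on UNIV v"
    and lim: "(\<lambda>n. L2_norm (\<lambda>z. w n z - u z)) \<longlonglongrightarrow> 0"
  shows "(\<lambda>n. sec_inner (w n) v) \<longlonglongrightarrow> sec_inner u v"
proof -
  obtain M where M: "M \<ge> 0" "\<And>z. z \<in> unit_square \<Longrightarrow> norm (v z) \<le> M" using continuous_bound_unit_square[OF v] by blast
  have b: "norm (sec_inner (w n) v - sec_inner u v) \<le> M * L2_norm (\<lambda>z. w n z - u z)" for n
  proof -
    let ?g = "\<lambda>z. w n z - u z"
    have g: "square_integrable ?g" by (intro square_integrable_diff w u)
    have ig: "set_integrable lborel unit_square (\<lambda>z. norm (?g z))"
      using g square_integrable_imp_integrable[of ?g] by (intro set_integrable_norm) (simp add: square_integrable_def)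
    have "norm (sec_inner ?g v) \<le> (LINT z:unit_square|lborel. norm (?g z * cnj (v z)))"
      unfolding sec_inner_def by (rule set_integral_norm_bound[OF sec_inner_integrable[OF g v]])
    also have "\<dots> \<le> (LINT z:unit_square|lborel. M * norm (?g z))"
      using M by (intro set_integral_mono set_integrable_norm sec_inner_integrable g v set_integrable_mult_right ig)
        (auto simp: norm_mult mult.commute[of M] mult_left_mono)
    also have "\<dots> = M * (LINT z:unit_square|lborel. norm (?g z))" by simp
    also have "\<dots> \<le> M * L2_norm ?g" by (intro mult_left_mono integral_norm_le_L2_norm g M)
    finally show ?thesis by (simp add: sec_inner_diff w u v)
  qed
  have l: "(\<lambda>n. M * L2_norm (\<lambda>z. w n z - u z)) \<longlonglongrightarrow> 0" using tendsto_mult[OF tendsto_const lim, of M] by simp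
  have "(\<lambda>n. sec_inner (w n) v - sec_inner u v) \<longlonglongrightarrow> 0"
    by (rule Lim_null_comparison[OF _ l]) (use b in simp)
  then show ?thesis by (simp add: LIM_zero_iff)
qed

section \<open>Landau levels and their multiplicities\<close>

definition landau_level :: "nat \<Rightarrow> nat \<Rightarrow> real" where
  "landau_level N k = 2 * pi * real N * (2 * real k + 1)"

definition landau_section :: "nat \<Rightarrow> nat \<Rightarrow> int \<Rightarrow> real \<times> real \<Rightarrow> complex" where
  "landau_section N k m = theta N (herm_poly N k) m"

lemma landau_level_inj: "N \<ge> 1 \<Longrightarrow> landau_level N k = landau_level N k' \<longleftrightarrow> k = k'"
  by (simp add: landau_level_def)

lemma landau_section_smooth: "N \<ge> 1 \<Longrightarrow> landau_section N k m \<in> smooth_sections N"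
  by (simp add: landau_section_def theta_smooth_section)

lemma landau_section_continuous: "N \<ge> 1 \<Longrightarrow> continuous_on A (landau_section N k m)"
  using landau_section_smooth by (auto simp: smooth_sections_def intro: smooth_continuous)

lemma landau_section_sqi: "N \<ge> 1 \<Longrightarrow> square_integrable (landau_section N k m)"
  by (intro square_integrable_continuous landau_section_continuous)

lemma magnetic_laplacian_landau_section: "N \<ge> 1 \<Longrightarrow> magnetic_laplacian N (landau_section N k m) = (\<lambda>z. of_real (landau_level N k) * landau_section N k m z)"
  unfolding landau_section_def landau_level_def by (rule magnetic_laplacian_herm_poly)

text \<open>For the smooth approximants of \<open>u\<close>, symmetry moves the operator to the
  Landau section. In the limit \<mu> and the Landau level multiply the same pairing, which must
  vanish when they differ.\<close>

lemma eigenfunction_orthogonal: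
  assumes N: "N \<ge> 1" and u: "u \<in> eigenspace N \<mu>" and \<mu>: "\<mu> \<noteq> landau_level N k"
  shows "sec_inner u (landau_section N k m) = 0"
proof -
  let ?v = "landau_section N k m"
  obtain w where u2: "u \<in> L2_sections N" and w: "\<And>n. w n \<in> smooth_sections N"
    and 1: "(\<lambda>n. L2_norm (\<lambda>z. w n z - u z)) \<longlonglongrightarrow> 0"
    and 2: "(\<lambda>n. L2_norm (\<lambda>z. magnetic_laplacian N (w n) z - of_real \<mu> * u z)) \<longlonglongrightarrow> 0"
    using u unfolding eigenspace_def H_graph_def by auto
  have us: "square_integrable u" using u2 by (simp add: L2_sections_iff)
  have ws: "square_integrable (w n)" "square_integrable (magnetic_laplacian N (w n))" for n
    using w[of n] by (auto intro!: square_integrable_continuous smooth_continuous continuous_magnetic_laplacian simp: smooth_sections_def)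
  have "(\<lambda>n. sec_inner (w n) ?v) \<longlonglongrightarrow> sec_inner u ?v"
    by (intro sec_inner_tendsto ws us landau_section_continuous N 1)
  then have "(\<lambda>n. of_real (landau_level N k) * sec_inner (w n) ?v) \<longlonglongrightarrow> of_real (landau_level N k) * sec_inner u ?v"
    by (intro tendsto_mult tendsto_const)
  moreover have "(\<lambda>n. of_real (landau_level N k) * sec_inner (w n) ?v) = (\<lambda>n. sec_inner (magnetic_laplacian N (w n)) ?v)"
    unfolding magnetic_laplacian_symmetric[OF w landau_section_smooth[OF N]] magnetic_laplacian_landau_section[OF N] sec_inner_cmult_right by simp
  moreover have "(\<lambda>n. sec_inner (magnetic_laplacian N (w n)) ?v) \<longlonglongrightarrow> sec_inner (\<lambda>z. of_real \<mu> * u z) ?v"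
    by (intro sec_inner_tendsto ws square_integrable_cmult us landau_section_continuous N 2)
  ultimately have "of_real (landau_level N k) * sec_inner u ?v = of_real \<mu> * sec_inner u ?v"
    unfolding sec_inner_cmult by (metis LIMSEQ_unique)
  with \<mu> show ?thesis by simp
qed

lemma landau_section_in_eigenspace:
  assumes N: "N \<ge> 1"
  shows "landau_section N k m \<in> eigenspace N (landau_level N k)"
proof -
  have s: "square_integrable (landau_section N k m)" and q: "quasiperiodic N (landau_section N k m)"
    using landau_section_smooth[OF N, of k m] landau_section_sqi[OF N] by (auto simp: smooth_sections_def)
  have "quasiperiodic N (\<lambda>z. of_real (landau_level N k) * landau_section N k m z)"
    using q by (simp add: quasiperiodic_def)
  then show ?thesis
    unfolding eigenspace_def H_graph_def mem_Collect_eq L2_sections_iff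
    using s q square_integrable_cmult[OF s] landau_section_smooth[OF N]
    by (intro conjI exI[of _ "\<lambda>_. landau_section N k m"])
      (auto simp: magnetic_laplacian_landau_section[OF N] L2_norm_def set_lebesgue_integral_def)
qed

text \<open>Different \<open>m\<close> are separated by their frequencies in y; for equal
  \<open>m\<close>, different levels are orthogonal as eigenspaces of a symmetric operator, which
  replaces any computation with Hermite polynomials.\<close>

lemma sec_inner_landau_section:
  assumes N: "N \<ge> 1" and m: "\<bar>m - m'\<bar> < int N" and ne: "k \<noteq> k' \<or> m \<noteq> m'"
  shows "sec_inner (landau_section N k m) (landau_section N k' m') = 0"
proof (cases "m = m'")
  case False
  then show ?thesis unfolding landau_section_def sec_inner_theta_theta(1)[OF N m] by simp
next
  case True
  with ne have "landau_level N k \<noteq> landau_level N k'" using N by (simp add: landau_level_inj)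
  then show ?thesis using eigenfunction_orthogonal[OF N landau_section_in_eigenspace[OF N]] by blast
qed

lemma sec_inner_landau_section_self: "N \<ge> 1 \<Longrightarrow> sec_inner (landau_section N k m) (landau_section N k m) \<noteq> 0"
  unfolding landau_section_def by (intro sec_inner_theta_self degree_herm_poly)

lemma landau_section_complete:
  assumes N: "N \<ge> 1" and u: "u \<in> L2_sections N" and 0: "\<And>k i. i < N \<Longrightarrow> sec_inner u (landau_section N k (int i)) = 0"
  shows "AE z in lborel. u z = 0"
proof (rule theta_complete[OF N u])
  fix k m
  have "nat (m mod int N) < N" using N by (simp add: nat_less_iff)
  then have "sec_inner u (landau_section N k (m mod int N)) = 0" using 0[of "nat (m mod int N)" k] N by simp
  moreover have "theta N (herm_poly N k) m = theta N (herm_poly N k) (m mod int N)"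
    using theta_index_shift[of N "herm_poly N k" "m mod int N" "m div int N"] by (intro ext) simp
  ultimately show "sec_inner u (theta N (herm_poly N k) m) = 0" by (simp add: landau_section_def)
qed

text \<open>Orthogonality dictates the coefficients. The remainder is orthogonal to level
  \<open>k\<close> by construction and to the other levels because \<open>u\<close> is an
  eigensection, so completeness makes it vanish almost everywhere.\<close>

lemma multiplicity_landau_level:
  assumes N: "N \<ge> 1"
  shows "has_multiplicity N (landau_level N k) N"
  unfolding has_multiplicity_def
proof (intro exI[of _ "\<lambda>i. landau_section N k (int i)"] conjI allI impI ballI landau_section_in_eigenspace N)
  fix u assume u: "u \<in> eigenspace N (landau_level N k)"
  then have u2: "u \<in> L2_sections N" by (simp add: eigenspace_def H_graph_def)
  then have us: "square_integrable u" and uq: "quasiperiodic N u" by (auto simp: L2_sections_iff)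
  let ?v = "\<lambda>i. landau_section N k (int i)"
  \<comment> \<open>Restricted to the index set, because coefficients are unique only among
    extensional functions.\<close>
  define c where "c = (\<lambda>i\<in>{..<N}. sec_inner u (?v i) / sec_inner (?v i) (?v i))"
  have sum: "square_integrable (\<lambda>z. \<Sum>i<N. d i * ?v i z)" for d by (intro square_integrable_sum square_integrable_cmult landau_section_sqi N)
  have ips: "sec_inner (\<lambda>z. \<Sum>i<N. d i * ?v i z) (landau_section N k' (int j)) = (if k' = k then d j * sec_inner (?v j) (?v j) else 0)"
    if "j < N" for d k' j
  proof -
    have "sec_inner (\<lambda>z. \<Sum>i<N. d i * ?v i z) (landau_section N k' (int j)) = (\<Sum>i<N. d i * sec_inner (?v i) (landau_section N k' (int j)))"
      by (subst sec_inner_sum) (auto intro!: square_integrable_cmult landau_section_sqi landau_section_continuous N simp: sec_inner_cmult)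
    also have "\<dots> = (\<Sum>i<N. if i = j then (if k' = k then d j * sec_inner (?v j) (?v j) else 0) else 0)"
    proof (intro sum.cong refl)
      fix i assume "i \<in> {..<N}"
      with that have "\<bar>int i - int j\<bar> < int N" by auto
      then show "d i * sec_inner (?v i) (landau_section N k' (int j)) = (if i = j then (if k' = k then d j * sec_inner (?v j) (?v j) else 0) else 0)"
        using sec_inner_landau_section[OF N, of "int i" "int j" k k'] by auto
    qed
    finally show ?thesis using that by simp
  qed
  show "\<exists>!c. c \<in> extensional {..<N} \<and> (AE z in lborel. u z = (\<Sum>i<N. c i * ?v i z))"
  proof (intro ex1I[of _ c] conjI)
    show "c \<in> extensional {..<N}" by (simp add: c_def)
    let ?d = "\<lambda>z. u z - (\<Sum>i<N. c i * ?v i z)"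
    have "?d \<in> L2_sections N"
    proof -
      have pq: "quasiperiodic N (landau_section N k m)" for m using landau_section_smooth[OF N] by (simp add: smooth_sections_def)
      have "quasiperiodic N ?d"
        by (rule quasiperiodicI)
          (simp_all only: quasiperiodic_x[OF uq] quasiperiodic_x[OF pq] quasiperiodic_y[OF uq] quasiperiodic_y[OF pq]
             right_diff_distrib sum_distrib_left mult.left_commute)
      then show ?thesis using square_integrable_diff[OF us sum] by (simp add: L2_sections_iff)
    qed
    moreover have "sec_inner ?d (landau_section N k' (int j)) = 0" if j: "j < N" for k' j
    proof -
      have "sec_inner ?d (landau_section N k' (int j)) = sec_inner u (landau_section N k' (int j)) - (if k' = k then c j * sec_inner (?v j) (?v j) else 0)"
        by (simp only: sec_inner_diff[OF us sum landau_section_continuous[OF N]] ips[OF j])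
      also have "\<dots> = 0"
      proof (cases "k' = k")
        case True
        then show ?thesis using j sec_inner_landau_section_self[OF N] by (simp add: c_def)
      next
        case False
        then have "landau_level N k \<noteq> landau_level N k'" using N by (simp add: landau_level_inj)
        then show ?thesis using False eigenfunction_orthogonal[OF N u] by simp
      qed
      finally show ?thesis .
    qed
    ultimately have "AE z in lborel. ?d z = 0" by (rule landau_section_complete[OF N])
    then show "AE z in lborel. u z = (\<Sum>i<N. c i * ?v i z)" by eventually_elim simp
  next
    fix c' assume c': "c' \<in> extensional {..<N} \<and> (AE z in lborel. u z = (\<Sum>i<N. c' i * ?v i z))"
    show "c' = c"
    proof (rule extensionalityI)
      show "c' \<in> extensional {..<N}" "c \<in> extensional {..<N}" using c' by (auto simp: c_def)
      fix i assume i: "i \<in> {..<N}"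
      have "sec_inner u (?v i) = sec_inner (\<lambda>z. \<Sum>i<N. c' i * ?v i z) (?v i)"
        using c' by (intro sec_inner_cong_AE us sum landau_section_continuous N) auto
      also have "\<dots> = c' i * sec_inner (?v i) (?v i)" using i by (simp add: ips)
      finally show "c' i = c i" using i sec_inner_landau_section_self[OF N] by (simp add: c_def)
    qed
  qed
qed

text \<open>An eigensection would be orthogonal to all Landau sections, hence null. The empty basis
  then works, its single coefficient function being \<open>undefined\<close> everywhere.\<close>

lemma multiplicity_other:
  assumes N: "N \<ge> 1" and \<mu>: "\<And>k. \<mu> \<noteq> landau_level N k"
  shows "has_multiplicity N \<mu> 0"
proof -
  have "AE z in lborel. u z = 0" if u: "u \<in> eigenspace N \<mu>" for u
    by (rule landau_section_complete[OF N]) (use u eigenfunction_orthogonal[OF N u \<mu>] in \<open>auto simp: eigenspace_def H_graph_def\<close>)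
  then show ?thesis unfolding has_multiplicity_def by auto
qed

text \<open>
  Two bases have the same size because the transition matrices \<open>C\<close> and \<open>D\<close> satisfy \<open>CD = 1\<close>,
  \<open>DC = 1\<close> and \<open>tr (CD) = tr (DC)\<close>.
\<close>

lemma basis_change_trace:
  fixes m m' :: nat
  assumes b: "\<And>i. i < m \<Longrightarrow> b i \<in> S"
    and unique: "\<And>u. u \<in> S \<Longrightarrow> \<exists>!c. c \<in> extensional {..<m} \<and> (AE z in lborel. u z = (\<Sum>i<m. c i * b i z))"
    and C: "\<And>i. i < m \<Longrightarrow> AE z in lborel. b i z = (\<Sum>j<m'. C i j * b' j z)"
    and D: "\<And>j. j < m' \<Longrightarrow> AE z in lborel. b' j z = (\<Sum>i<m. D j i * b i z)"
  shows "(\<Sum>i<m. \<Sum>j<m'. C i j * D j i) = (of_nat m :: complex)"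
proof -
  have "(\<Sum>j<m'. C i j * D j i) = 1" if i: "i < m" for i
  proof -
    \<comment> \<open>Both functions expand \<open>b i\<close> in the basis \<open>b\<close>,
      \<open>c\<close> by way of \<open>b'\<close> and back, \<open>d\<close> trivially; uniqueness
      equates them and gives a diagonal entry of CD = 1.\<close>
    define c where "c = (\<lambda>l\<in>{..<m}. \<Sum>j<m'. C i j * D j l)"
    define d where "d = (\<lambda>l\<in>{..<m}. if l = i then 1 else (0::complex))"
    have "AE z in lborel. \<forall>j\<in>{..<m'}. b' j z = (\<Sum>i<m. D j i * b i z)"
      by (intro AE_finite_allI finite_lessThan) (use D in auto)
    with C[OF i] have "AE z in lborel. b i z = (\<Sum>l<m. c l * b l z)"
    proof eventually_elim
      case (elim z)
      have "b i z = (\<Sum>j<m'. C i j * (\<Sum>l<m. D j l * b l z))" using elim by simp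
      also have "\<dots> = (\<Sum>l<m. \<Sum>j<m'. C i j * D j l * b l z)"
        unfolding sum_distrib_left mult.assoc by (rule sum.swap)
      finally show ?case by (simp add: c_def sum_distrib_right)
    qed
    moreover have "AE z in lborel. b i z = (\<Sum>l<m. d l * b l z)"
    proof (rule AE_I2)
      fix z
      have "(\<Sum>l<m. d l * b l z) = (\<Sum>l<m. if l = i then b l z else 0)"
        by (intro sum.cong) (auto simp: d_def)
      then show "b i z = (\<Sum>l<m. d l * b l z)" using i by simp
    qed
    ultimately have "c = d" using unique[OF b[OF i]] by (auto simp: c_def d_def)
    then have "c i = d i" by simp
    then show ?thesis using i by (simp add: c_def d_def)
  qed
  then show ?thesis by simp
qed

text \<open>\<open>has_multiplicity\<close> only asserts that some basis exists; uniqueness of its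
  size is what fixes the fibres of an arbitrary enumeration.\<close>

lemma multiplicity_unique:
  assumes "has_multiplicity N \<mu> m" "has_multiplicity N \<mu> m'"
  shows "m = m'"
proof -
  let ?E = "eigenspace N \<mu>"
  obtain b where "(\<forall>i<m. b i \<in> ?E) \<and>
     (\<forall>u\<in>?E. \<exists>!c. c \<in> extensional {..<m} \<and> (AE z in lborel. u z = (\<Sum>i<m. c i * b i z)))"
    using assms(1) unfolding has_multiplicity_def ..
  note b = conjunct1[OF this, rule_format] conjunct2[OF this, rule_format]
  obtain b' where "(\<forall>i<m'. b' i \<in> ?E) \<and>
     (\<forall>u\<in>?E. \<exists>!c. c \<in> extensional {..<m'} \<and> (AE z in lborel. u z = (\<Sum>i<m'. c i * b' i z)))"
    using assms(2) unfolding has_multiplicity_def ..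
  note b' = conjunct1[OF this, rule_format] conjunct2[OF this, rule_format]
  have "\<exists>c. AE z in lborel. b i z = (\<Sum>j<m'. c j * b' j z)" if "i < m" for i
    using ex1_implies_ex[OF b'(2)[OF b(1)[OF that]]] by (elim exE conjE) (rule exI)
  then obtain C where C: "\<And>i. i < m \<Longrightarrow> AE z in lborel. b i z = (\<Sum>j<m'. C i j * b' j z)" by metis
  have "\<exists>c. AE z in lborel. b' j z = (\<Sum>i<m. c i * b i z)" if "j < m'" for j
    using ex1_implies_ex[OF b(2)[OF b'(1)[OF that]]] by (elim exE conjE) (rule exI)
  then obtain D where D: "\<And>j. j < m' \<Longrightarrow> AE z in lborel. b' j z = (\<Sum>i<m. D j i * b i z)" by metis
  have "of_nat m = (\<Sum>i<m. \<Sum>j<m'. C i j * D j i)" by (rule basis_change_trace[OF b C D, symmetric])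
  also have "\<dots> = (\<Sum>j<m'. \<Sum>i<m. D j i * C i j)" by (subst sum.swap) (simp add: mult.commute)
  also have "\<dots> = of_nat m'" by (rule basis_change_trace[OF b' D C])
  finally show ?thesis by simp
qed

section \<open>The trace\<close>

text \<open>Valid for every enumeration, in particular for the one chosen by
  \<open>eigenvalue\<close>. A value off the Landau levels would have multiplicity 0, yet its fibre
  contains \<open>j\<close>.\<close>

lemma card_landau_fibre:
  assumes N: "N \<ge> 1" and \<nu>: "enumerates_eigenvalues N \<nu>"
  shows "finite {j. \<nu> j = landau_level N k}" "card {j. \<nu> j = landau_level N k} = N"
    and "\<exists>k. \<nu> j = landau_level N k"
proof -
  have fin: "finite {j. \<nu> j = \<mu>}" and mult: "has_multiplicity N \<mu> (card {j. \<nu> j = \<mu>})" for \<mu>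
    using \<nu> by (auto simp: enumerates_eigenvalues_def)
  show "finite {j. \<nu> j = landau_level N k}" by (rule fin)
  show "card {j. \<nu> j = landau_level N k} = N" by (rule multiplicity_unique[OF mult multiplicity_landau_level[OF N]])
  show "\<exists>k. \<nu> j = landau_level N k"
  proof (rule ccontr)
    assume "\<not> (\<exists>k. \<nu> j = landau_level N k)"
    then have "has_multiplicity N (\<nu> j) 0" by (intro multiplicity_other N) auto
    then have "card {i. \<nu> i = \<nu> j} = 0" by (rule multiplicity_unique[OF mult])
    with fin[of "\<nu> j"] have "{i. \<nu> i = \<nu> j} = {}" by simp
    then show False by auto
  qed
qed

text \<open>The witness that makes the choice in \<open>eigenvalue\<close> meaningful:
  \<open>j div N\<close> lists each level \<open>N\<close> times in a row.\<close>

lemma enumerates_landau_levels: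
  assumes N: "N \<ge> 1"
  shows "enumerates_eigenvalues N (\<lambda>j. landau_level N (j div N))"
  unfolding enumerates_eigenvalues_def
proof
  fix \<mu>
  show "finite {j. landau_level N (j div N) = \<mu>} \<and> has_multiplicity N \<mu> (card {j. landau_level N (j div N) = \<mu>})"
  proof (cases "\<exists>k. \<mu> = landau_level N k")
    case True
    then obtain k where k: "\<mu> = landau_level N k" by blast
    have "{j. landau_level N (j div N) = \<mu>} = {k * N..<k * N + N}"
    proof -
      have "j div N = k \<longleftrightarrow> k * N \<le> j \<and> j < k * N + N" for j
      proof
        assume "j div N = k"
        then have "k * N + j mod N = j" using div_mult_mod_eq[of j N] by simp
        moreover have "j mod N < N" using N by simp
        ultimately show "k * N \<le> j \<and> j < k * N + N" by linarith
      qed (auto intro: div_nat_eqI simp: mult.commute)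
      then show ?thesis
        by (intro set_eqI) (simp only: mem_Collect_eq k landau_level_inj[OF N] atLeastLessThan_iff)
    qed
    then show ?thesis using multiplicity_landau_level[OF N] by (simp add: k)
  next
    case False
    then have "{j. landau_level N (j div N) = \<mu>} = {}" by auto
    then show ?thesis using multiplicity_other[OF N, of \<mu>] False by auto
  qed
qed

text \<open>Absolute summability over the disjoint union of the fibres justifies regrouping,
  whatever the order in which \<kappa> takes its values.\<close>

lemma infsum_constant_fibres:
  fixes f :: "nat \<Rightarrow> complex" and \<kappa> :: "nat \<Rightarrow> nat"
  assumes f: "summable (\<lambda>k. norm (f k))"
    and fin: "\<And>k. finite {j. \<kappa> j = k}" and card: "\<And>k. card {j. \<kappa> j = k} = N"
  shows "(\<Sum>\<^sub>\<infinity>j. f (\<kappa> j)) = (\<Sum>k. f k) * of_nat N"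
proof -
  let ?B = "\<lambda>k. {j. \<kappa> j = k}"
  have hs: "(f has_sum (\<Sum>k. f k)) UNIV"
    by (rule norm_summable_imp_has_sum[OF f summable_sums[OF summable_norm_cancel[OF f]]])
  have abs: "(\<lambda>k. norm (f k)) summable_on UNIV"
    by (rule norm_summable_imp_summable_on) (simp add: f)
  have "bij_betw (\<lambda>j. (\<kappa> j, j)) UNIV (Sigma UNIV ?B)"
    by (rule bij_betw_byWitness[where f' = snd]) auto
  from infsum_reindex_bij_betw[OF this, of "\<lambda>(k, j). f k"]
  have "(\<Sum>\<^sub>\<infinity>j. f (\<kappa> j)) = infsum (\<lambda>(k, j). f k) (Sigma UNIV ?B)" by simp
  also have "\<dots> = (\<Sum>\<^sub>\<infinity>k. \<Sum>\<^sub>\<infinity>j\<in>?B k. f k)"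
  proof (rule infsum_Sigma'_banach[symmetric])
    have "(\<lambda>x. norm ((\<lambda>(k, j). f k) x)) summable_on (Sigma UNIV ?B)"
      unfolding Infinite_Sum.abs_summable_on_Sigma_iff
    proof (intro conjI ballI)
      show "(\<lambda>j. norm (case (k, j) of (k, j) \<Rightarrow> f k)) summable_on ?B k" for k using fin by simp
      have "(\<lambda>k. real N * norm (f k)) summable_on UNIV"
        using abs by (rule summable_on_cmult_right)
      then show "(\<lambda>k. norm (\<Sum>\<^sub>\<infinity>j\<in>?B k. norm (case (k, j) of (k, j) \<Rightarrow> f k))) summable_on UNIV"
        using fin card by simp
    qed
    then show "(\<lambda>(k, j). f k) summable_on (Sigma UNIV ?B)" by (rule Infinite_Sum.abs_summable_summable)
  qed
  also have "\<dots> = (\<Sum>\<^sub>\<infinity>k. f k * of_nat N)" using fin card by (simp add: mult.commute)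
  also have "\<dots> = (\<Sum>k. f k) * of_nat N"
    by (intro infsumI has_sum_cmult_left hs)
  finally show ?thesis .
qed

theorem theorem8:
  fixes \<phi> :: "real \<Rightarrow> complex" and N :: nat
  assumes "schwartz \<phi>" and "N \<ge> 1"
  shows "Y N \<phi> = f0 \<phi> * of_nat N"
proof -
  have \<nu>: "enumerates_eigenvalues N (eigenvalue N)"
    unfolding eigenvalue_def
    by (rule someI[where P = "enumerates_eigenvalues N", OF enumerates_landau_levels[OF assms(2)]])
  obtain \<kappa> where \<kappa>: "\<And>j. eigenvalue N j = landau_level N (\<kappa> j)"
    using card_landau_fibre(3)[OF assms(2) \<nu>] by metis
  have fib: "{j. \<kappa> j = k} = {j. eigenvalue N j = landau_level N k}" for k
    using assms(2) by (simp add: \<kappa> landau_level_inj)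
  \<comment> \<open>Here \<open>N\<close> drops out of the arguments of \<phi>; it survives only as
    the size of the fibres.\<close>
  have "landau_level N k / real N = 2 * pi * (2 * real k + 1)" for k
    using assms(2) by (simp add: landau_level_def)
  then have "Y N \<phi> = (\<Sum>\<^sub>\<infinity>j. \<phi> (2 * pi * (2 * real (\<kappa> j) + 1)))"
    unfolding Y_def \<kappa> by simp
  also have "\<dots> = (\<Sum>k. \<phi> (2 * pi * (2 * real k + 1))) * of_nat N"
  proof (rule infsum_constant_fibres)
    show "summable (\<lambda>k. norm (\<phi> (2 * pi * (2 * real k + 1))))" by (rule schwartz_landau_summable[OF assms(1)])
  qed (simp_all only: fib card_landau_fibre[OF assms(2) \<nu>])
  finally show ?thesis by (simp only: f0_eq_landau_sum[OF assms(1)])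
qed

end
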